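(* Let $n>1$ be an integer and let $\mathcal S_n$ be the group of all permutations of $\{1,\dots,n\}$. Write $\sigma_1\sim\sigma_2$ if $\sigma_2=\tau\circ\sigma_1$ for some transposition $\tau$. Let $Q_{\rm RT}(\sigma_1,\sigma_2)=\frac{2}{n(n-1)}$ if $\sigma_1\sim\sigma_2$ and $Q_{\rm RT}(\sigma_1,\sigma_2)=0$ otherwise, and let $\pi_{\rm RT}(\sigma)=1/n!$ for all $\sigma\in\mathcal S_n$. Then the Ricci curvature of the random transposition model $(\mathcal S_n,Q_{\rm RT},\pi_{\rm RT})$ is bounded from below by $\frac{4}{n(n-1)}$, i.e. $$\mathrm{Ric}(\mathcal S_n,Q_{\rm RT},\pi_{\rm RT})\ \ge\ \frac{4}{n(n-1)}.$$
   Context: A Markov triple $(\mathcal X,Q,\pi)$ consists of a finite set $\mathcal X$, transition rates $Q(x,y)\ge 0$ for $x\ne y$ with $Q(x,x)=0$, and a probability measure $\pi$ on $\mathcal X$ with $\pi(x)Q(x,y)=\pi(y)Q(y,x)$ for all $x,y$. Probability densities: $\mathscr P(\mathcal X)=\{\rho:\mathcal X\to[0,\infty) : \sum_{x}\pi(x)\rho(x)=1\}$. Relative entropy: $\mathcal H(\rho)=\sum_{x}\pi(x)\rho(x)\log\rho(x)$ (with $0\log 0=0$). Logarithmic mean: $\theta(r,s)=\int_0^1 r^{1-p}s^p\,dp$ for $r,s\ge 0$. For $\rho\in\mathscr P(\mathcal X)$ write $\hat\rho(x,y)=\theta(\rho(x),\rho(y))$. Transport metric $\mathcal W$ on $\mathscr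 P(\mathcal X)$: for $\rho_0,\rho_1\in\mathscr P(\mathcal X)$, $$\mathcal W(\rho_0,\rho_1)^2=\inf_{\rho,\psi}\Big\{\tfrac12\int_0^1\sum_{x,y\in\mathcal X}(\psi_t(x)-\psi_t(y))^2\hat\rho_t(x,y)Q(x,y)\pi(x)\,dt\Big\},$$ where the infimum runs over all piecewise smooth curves $\rho:[0,1]\to\mathscr P(\mathcal X)$ and all $\psi:[0,1]\times\mathcal X\to\mathbb R$ satisfying $\frac{d}{dt}\rho_t(x)+\sum_{y\in\mathcal X}(\psi_t(y)-\psi_t(x))\hat\rho_t(x,y)Q(x,y)=0$ for all $x\in\mathcal X$, with $\rho(0)=\rho_0$ and $\rho(1)=\rho_1$. A constant speed geodesic is a curve $\rho:[0,1]\to\mathscr P(\mathcal X)$ with $\mathcal W(\rho_s,\rho_t)=|t-s|\,\mathcal W(\rho_0,\rho_1)$ for all $s,t\in[0,1]$. Ricci curvature: for $\kappa\in\mathbb R$, $(\mathcal X,Q,\pi)$ has Ricci curvature bounded from below by $\kappa$, written $\mathrm{Ric}(\mathcal X,Q,\pi)\ge\kappa$, if for every constant speed geodesic $(\rho_t)_{t\in[0,1]}$ in $(\mathscr P(\mathcal X),\mathcal W)$ and every $t\in[0,1]$, $$\mathcal H(\rho_t)\le(1-t)\mathcal H(\rho_0)+t\,\mathcal H(\rho_1)-\frac{\kappa}{2}t(1-t)\mathcal W(\rho_0,\rho_1)^2.$$ *)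

theory Defs
  imports "HOL-Analysis.Analysis" "HOL-Combinatorics.Combinatorics"
begin

definition markov_triple :: "'a set \<Rightarrow> ('a \<Rightarrow> 'a \<Rightarrow> real) \<Rightarrow> ('a \<Rightarrow> real) \<Rightarrow> bool" where
  "markov_triple X Q \<pi> \<longleftrightarrow>
     finite X \<and>
     (\<forall>x\<in>X. \<forall>y\<in>X. x \<noteq> y \<longrightarrow> Q x y \<ge> 0) \<and>
     (\<forall>x\<in>X. Q x x = 0) \<and>
     (\<forall>x\<in>X. \<pi> x \<ge> 0) \<and> (\<Sum>x\<in>X. \<pi> x) = 1 \<and>
     (\<forall>x\<in>X. \<forall>y\<in>X. \<pi> x * Q x y = \<pi> y * Q y x)"

text \<open>Densities are extensional functions, so that the elements of this set are exactly the
  functions on the carrier and can be compared by equality.\<close>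

definition densities :: "'a set \<Rightarrow> ('a \<Rightarrow> real) \<Rightarrow> ('a \<Rightarrow> real) set" where
  "densities X \<pi> = {\<rho> \<in> X \<rightarrow>\<^sub>E {0..}. (\<Sum>x\<in>X. \<pi> x * \<rho> x) = 1}"

definition rel_entropy :: "'a set \<Rightarrow> ('a \<Rightarrow> real) \<Rightarrow> ('a \<Rightarrow> real) \<Rightarrow> real" where
  "rel_entropy X \<pi> \<rho> = (\<Sum>x\<in>X. \<pi> x * (\<rho> x * ln (\<rho> x)))"

text \<open>In HOL \<open>0 powr 0 = 0\<close>, but this concerns only the end points of the interval of
  integration.\<close>

definition log_mean :: "real \<Rightarrow> real \<Rightarrow> real" where
  "log_mean r s = integral {0..1} (\<lambda>p. r powr (1 - p) * s powr p)"

definition smooth_on_Icc :: "(real \<Rightarrow> real) \<Rightarrow> real \<Rightarrow> real \<Rightarrow> bool" where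
  "smooth_on_Icc f a b \<longleftrightarrow>
     (\<exists>D :: nat \<Rightarrow> real \<Rightarrow> real. D 0 = f \<and>
        (\<forall>k. \<forall>t\<in>{a..b}. (D k has_real_derivative D (Suc k) t) (at t within {a..b})))"

text \<open>\<open>T\<close> is the set of break points of a subdivision of the unit interval; the function is
  infinitely differentiable on each closed piece (one-sidedly at its end points), hence
  continuous on the whole interval.\<close>

definition piecewise_smooth :: "real set \<Rightarrow> (real \<Rightarrow> real) \<Rightarrow> bool" where
  "piecewise_smooth T f \<longleftrightarrow>
     finite T \<and> {0, 1} \<subseteq> T \<and> T \<subseteq> {0..1} \<and>
     (\<forall>a\<in>T. \<forall>b\<in>T. a < b \<and> {a<..<b} \<inter> T = {} \<longrightarrow> smooth_on_Icc f a b)"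

text \<open>The continuity equation is required off the break points, where the derivative exists.\<close>

definition transport_curve ::
  "'a set \<Rightarrow> ('a \<Rightarrow> 'a \<Rightarrow> real) \<Rightarrow> ('a \<Rightarrow> real) \<Rightarrow> ('a \<Rightarrow> real) \<Rightarrow> ('a \<Rightarrow> real) \<Rightarrow>
   (real \<Rightarrow> 'a \<Rightarrow> real) \<Rightarrow> (real \<Rightarrow> 'a \<Rightarrow> real) \<Rightarrow> bool" where
  "transport_curve X Q \<pi> \<rho>\<^sub>0 \<rho>\<^sub>1 \<rho> \<psi> \<longleftrightarrow>
     (\<forall>t\<in>{0..1}. \<rho> t \<in> densities X \<pi>) \<and> \<rho> 0 = \<rho>\<^sub>0 \<and> \<rho> 1 = \<rho>\<^sub>1 \<and>
     (\<exists>T. (\<forall>x\<in>X. piecewise_smooth T (\<lambda>t. \<rho> t x)) \<and>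
          (\<forall>t\<in>{0..1} - T. \<forall>x\<in>X. 
             \<exists>d. ((\<lambda>s. \<rho> s x) has_real_derivative d) (at t) \<and>
                 d + (\<Sum>y\<in>X. (\<psi> t y - \<psi> t x) * log_mean (\<rho> t x) (\<rho> t y) * Q x y) = 0))"

text \<open>The time integral is the extended nonnegative Lebesgue integral. No measurability of \<open>\<psi>\<close>
  is needed: for a Markov triple, two solutions \<open>\<psi>\<close> of the continuity equation for the same
  curve \<open>\<rho>\<close> give the same integrand off the break points, and the latter is a Borel function
  of \<open>\<rho> t\<close> and its derivative.\<close>

definition transport_action ::
  "'a set \<Rightarrow> ('a \<Rightarrow> 'a \<Rightarrow> real) \<Rightarrow> ('a \<Rightarrow> real) \<Rightarrow>
   (real \<Rightarrow> 'a \<Rightarrow> real) \<Rightarrow> (real \<Rightarrow> 'a \<Rightarrow> real) \<Rightarrow> ennreal" where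
  "transport_action X Q \<pi> \<rho> \<psi> =
     (\<integral>\<^sup>+t\<in>{0..1}. ennreal (1 / 2 * (\<Sum>x\<in>X. \<Sum>y\<in>X.
        (\<psi> t x - \<psi> t y)\<^sup>2 * log_mean (\<rho> t x) (\<rho> t y) * Q x y * \<pi> x)) \<partial>lborel)"

definition transport_cost ::
  "'a set \<Rightarrow> ('a \<Rightarrow> 'a \<Rightarrow> real) \<Rightarrow> ('a \<Rightarrow> real) \<Rightarrow> ('a \<Rightarrow> real) \<Rightarrow> ('a \<Rightarrow> real) \<Rightarrow> ennreal" where
  "transport_cost X Q \<pi> \<rho>\<^sub>0 \<rho>\<^sub>1 =
     Inf {transport_action X Q \<pi> \<rho> \<psi> | \<rho> \<psi>. transport_curve X Q \<pi> \<rho>\<^sub>0 \<rho>\<^sub>1 \<rho> \<psi>}"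

text \<open>The square root of the cost. As a Markov triple is not assumed irreducible, the value may
  be infinite.\<close>

definition transport_dist ::
  "'a set \<Rightarrow> ('a \<Rightarrow> 'a \<Rightarrow> real) \<Rightarrow> ('a \<Rightarrow> real) \<Rightarrow> ('a \<Rightarrow> real) \<Rightarrow> ('a \<Rightarrow> real) \<Rightarrow> ennreal" where
  "transport_dist X Q \<pi> \<rho>\<^sub>0 \<rho>\<^sub>1 =
     (if transport_cost X Q \<pi> \<rho>\<^sub>0 \<rho>\<^sub>1 = \<infinity> then \<infinity>
      else ennreal (sqrt (enn2real (transport_cost X Q \<pi> \<rho>\<^sub>0 \<rho>\<^sub>1))))"

lemma transport_dist_power2: "(transport_dist X Q \<pi> \<rho>\<^sub>0 \<rho>\<^sub>1)\<^sup>2 = transport_cost X Q \<pi> \<rho>\<^sub>0 \<rho>\<^sub>1"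
  by (auto simp: transport_dist_def ennreal_power less_top power2_eq_square ennreal_top_mult
      simp flip: ennreal_mult)

definition const_speed_geodesic ::
  "'a set \<Rightarrow> ('a \<Rightarrow> 'a \<Rightarrow> real) \<Rightarrow> ('a \<Rightarrow> real) \<Rightarrow> (real \<Rightarrow> 'a \<Rightarrow> real) \<Rightarrow> bool" where
  "const_speed_geodesic X Q \<pi> \<rho> \<longleftrightarrow>
     (\<forall>t\<in>{0..1}. \<rho> t \<in> densities X \<pi>) \<and>
     (\<forall>s\<in>{0..1}. \<forall>t\<in>{0..1}. transport_dist X Q \<pi> (\<rho> s) (\<rho> t) =
        ennreal \<bar>t - s\<bar> * transport_dist X Q \<pi> (\<rho> 0) (\<rho> 1))"

definition ricci_bounded_below ::
  "'a set \<Rightarrow> ('a \<Rightarrow> 'a \<Rightarrow> real) \<Rightarrow> ('a \<Rightarrow> real) \<Rightarrow> real \<Rightarrow> bool" where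
  "ricci_bounded_below X Q \<pi> \<kappa> \<longleftrightarrow>
     (\<forall>\<rho>. const_speed_geodesic X Q \<pi> \<rho> \<longrightarrow>
        (\<forall>t\<in>{0..1}.
           ereal (rel_entropy X \<pi> (\<rho> t)) \<le>
             ereal ((1 - t) * rel_entropy X \<pi> (\<rho> 0) + t * rel_entropy X \<pi> (\<rho> 1))
             - ereal (\<kappa> / 2 * t * (1 - t)) * enn2ereal ((transport_dist X Q \<pi> (\<rho> 0) (\<rho> 1))\<^sup>2)))"

definition perms :: "nat \<Rightarrow> (nat \<Rightarrow> nat) set" where
  "perms n = {\<sigma>. \<sigma> permutes {1..n}}"

definition transposition_adjacent :: "nat \<Rightarrow> (nat \<Rightarrow> nat) \<Rightarrow> (nat \<Rightarrow> nat) \<Rightarrow> bool" where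
  "transposition_adjacent n \<sigma>\<^sub>1 \<sigma>\<^sub>2 \<longleftrightarrow>
     (\<exists>i\<in>{1..n}. \<exists>j\<in>{1..n}. i \<noteq> j \<and> \<sigma>\<^sub>2 = Transposition.transpose i j \<circ> \<sigma>\<^sub>1)"

definition Q_RT :: "nat \<Rightarrow> (nat \<Rightarrow> nat) \<Rightarrow> (nat \<Rightarrow> nat) \<Rightarrow> real" where
  "Q_RT n \<sigma>\<^sub>1 \<sigma>\<^sub>2 =
     (if transposition_adjacent n \<sigma>\<^sub>1 \<sigma>\<^sub>2 then 2 / (real n * (real n - 1)) else 0)"

definition pi_RT :: "nat \<Rightarrow> (nat \<Rightarrow> nat) \<Rightarrow> real" where
  "pi_RT n \<sigma> = 1 / fact n"

lemma transposition_adjacent_sym: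
  assumes "transposition_adjacent n \<sigma>\<^sub>1 \<sigma>\<^sub>2"
  shows "transposition_adjacent n \<sigma>\<^sub>2 \<sigma>\<^sub>1"
proof -
  obtain i j where ij: "i \<in> {1..n}" "j \<in> {1..n}" "i \<noteq> j"
    "\<sigma>\<^sub>2 = Transposition.transpose i j \<circ> \<sigma>\<^sub>1"
    using assms unfolding transposition_adjacent_def by blast
  then have "\<sigma>\<^sub>1 = Transposition.transpose i j \<circ> \<sigma>\<^sub>2"
    by (simp add: fun_eq_iff)
  with ij show ?thesis
    unfolding transposition_adjacent_def by blast
qed

lemma transposition_adjacent_irrefl:
  assumes "\<sigma> \<in> perms n"
  shows "\<not> transposition_adjacent n \<sigma> \<sigma>"
proof
  assume "transposition_adjacent n \<sigma> \<sigma>"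
  then obtain i j where ij: "i \<noteq> j" "\<sigma> = Transposition.transpose i j \<circ> \<sigma>"
    unfolding transposition_adjacent_def by blast
  have "surj \<sigma>"
    using assms by (simp add: perms_def permutes_surj)
  then obtain k where "\<sigma> k = i"
    by (metis surjD)
  with ij show False
    by (metis comp_apply transpose_apply_first)
qed

lemma markov_triple_RT: "markov_triple (perms n) (Q_RT n) (pi_RT n)"
proof -
  have "finite (perms n)" "card (perms n) = fact n"
    by (simp_all add: perms_def finite_permutations card_permutations)
  moreover have "real n * (real n - 1) \<ge> 0"
    by (cases n) auto
  ultimately show ?thesis
    using transposition_adjacent_sym transposition_adjacent_irrefl
    by (auto simp: markov_triple_def Q_RT_def pi_RT_def)
qed

end

theory Submission
  imports Defs
begin

text \<open>Let \<open>E\<^sub>\<rho>\<close> be the quadratic form \<open>grad_form\<close> of a density \<open>\<rho>\<close>, so that the action of a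
  curve with potentials \<open>\<psi>\<^sub>t\<close> is the integral of \<open>E\<^sub>\<rho>(\<psi>, \<psi>)\<close>. The heat semigroup \<open>P\<^sub>t\<close> of the walk
  averages over translations \<open>x \<mapsto> g x\<close>, which permute the edges \<open>(x, \<tau> x)\<close>; since the logarithmic
  mean is concave and homogeneous, \<open>E\<^sub>\<rho>(P\<^sub>t\<^sup>*\<phi>, P\<^sub>t\<^sup>*\<phi>) \<le> c(t) E\<^bsub>P\<^sub>t\<rho>\<^esub>(\<phi>, \<phi>)\<close>. The constant
  \<open>c(t) = 1 - 4 q t + O(t\<^sup>2)\<close> is smaller than 1 because the translation by \<open>\<tau>\<close> itself reverses the
  edge \<open>(x, \<tau> x)\<close> and its gradient cancels against that of the identity.

  Running the heat flow for a time \<open>a(s)\<close> along a curve \<open>\<rho>\<^sub>s\<close> changes the action density by the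
  factor \<open>c(a(s))\<close> and by \<open>- 2 a'(s) d/ds H(P\<^bsub>a(s)\<^esub>\<rho>\<^sub>s)\<close>. Apply this to short pieces of a
  constant speed geodesic with a tent shaped profile \<open>a\<close> that vanishes at both ends and equals \<open>b\<close> at
  time \<open>t\<close>: the cost of the new curve is at least the squared distance of its end points, the entropy
  terms telescope, and the limit \<open>b \<rightarrow> 0\<close> is the convexity inequality. No regularity of the geodesic
  is needed, because the heat flow makes all densities positive.\<close>

section \<open>The logarithmic mean\<close>

text \<open>A geodesic is a purely metric notion: it comes without potentials, and an almost optimal
  curve between two of its points may stay away from it. Only costs between points of the geodesic
  are therefore compared.

  Short pieces are forced by the gain. On one piece the action contracts to first order by the
  factor 1 - 4 q min(\<alpha>, \<beta>), where \<alpha> and \<beta> are the heat times at its ends;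
  if the profile rises from 0 to b at once, nothing is gained. N equal pieces replace the minimum by
  the mean b / 2 up to O(1 / N). Each side of the tent thus gains the fraction 2 q b of its squared
  length, while the entropy enters with the factor 2 b. The quotient q is half of the curvature
  bound, and 2 q = 4 / (n (n - 1)).

  Two obstacles have nothing to do with curvature. Potentials are arbitrary functions of time, so
  integrals can be added only once the integrand is known to be measurable. And real valued costs
  require a finite distance between any two densities, even if they have zeros, where the mean
  degenerates.\<close>

lemma log_mean_0 [simp]: "log_mean 0 s = 0" "log_mean r 0 = 0"
  by (simp_all add: log_mean_def)

lemma log_mean_integrand_continuous:
  "continuous_on {0..1} (\<lambda>p. r powr (1 - p) * s powr p)" if "r > 0" "s > 0" for r s :: real
  using that by (intro continuous_intros) auto

lemma log_mean_integrable:
  "(\<lambda>p. r powr (1 - p) * s powr p) integrable_on {0..1}" if "r \<ge> 0" "s \<ge> 0" for r s :: real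
proof (cases "r = 0 \<or> s = 0")
  case False
  with that show ?thesis
    by (intro integrable_continuous_real log_mean_integrand_continuous) auto
qed auto

lemma log_mean_commute: "log_mean r s = log_mean s r"
proof -
  have "integral {0..1} (\<lambda>p. r powr (1 - p) * s powr p)
      = integral {-1..0} (\<lambda>p. r powr (1 + p) * s powr (- p))"
    using Henstock_Kurzweil_Integration.integral_reflect_real[of 0 "-1" "\<lambda>p. r powr (1 + p) * s powr (- p)"] by simp
  also have "\<dots> = integral {0..1} (\<lambda>p. r powr p * s powr (1 - p))"
    using integral_shift_Icc_real[where a = "-1" and b = 0 and c = 1 and f = "\<lambda>p. r powr p * s powr (1 - p)"]
    by (simp add: o_def)
  finally show ?thesis by (simp add: log_mean_def mult.commute)
qed

lemma log_mean_nonneg: "0 \<le> log_mean r s"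
  unfolding log_mean_def by (cases "(\<lambda>p. r powr (1 - p) * s powr p) integrable_on {0..1}")
    (auto intro: integral_nonneg simp: not_integrable_integral)

lemma log_mean_scale: "c \<ge> 0 \<Longrightarrow> log_mean (c * r) (c * s) = c * log_mean r s"
  if "r \<ge> 0" "s \<ge> 0" for c r s :: real
proof -
  assume c: "c \<ge> 0"
  have "(c * r) powr (1 - p) * (c * s) powr p = c * (r powr (1 - p) * s powr p)" for p
    using c that by (simp add: powr_mult powr_diff mult_ac) 
  then show ?thesis by (simp add: log_mean_def)
qed

lemma log_mean_mono:
  assumes "0 \<le> r" "r \<le> r'" "0 \<le> s" "s \<le> s'"
  shows "log_mean r s \<le> log_mean r' s'"
  unfolding log_mean_def using assms
  by (intro integral_le log_mean_integrable mult_mono powr_mono2) auto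

lemma log_mean_same: "r \<ge> 0 \<Longrightarrow> log_mean r r = r"
  by (cases "r = 0") (simp_all add: log_mean_def flip: powr_add)

lemma log_mean_ge: "0 \<le> m \<Longrightarrow> m \<le> r \<Longrightarrow> m \<le> s \<Longrightarrow> m \<le> log_mean r s"
  using log_mean_mono[of m r m s] by (simp add: log_mean_same)

lemma log_mean_pos: "0 < r \<Longrightarrow> 0 < s \<Longrightarrow> 0 < log_mean r s"
  using log_mean_ge[of "min r s" r s] by auto

text \<open>Weighted AM-GM for each summand after division by the totals \<open>r1 + r2\<close> and
  \<open>s1 + s2\<close>; the two bounds add up to (1 - p) + p = 1. Integrated over p this becomes
  the concavity of the mean.\<close>

lemma powr_mult_superadditive:
  fixes r1 r2 s1 s2 p :: real
  assumes "0 < r1" "0 < r2" "0 < s1" "0 < s2" "0 \<le> p" "p \<le> 1"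
  shows "r1 powr (1 - p) * s1 powr p + r2 powr (1 - p) * s2 powr p
    \<le> (r1 + r2) powr (1 - p) * (s1 + s2) powr p"
proof -
  let ?R = "r1 + r2" and ?S = "s1 + s2"
  have young: "(a / ?R) powr (1 - p) * (b / ?S) powr p \<le> (1 - p) * (a / ?R) + p * (b / ?S)"
    if "a > 0" "b > 0" for a b
    using assms that by (intro Youngs_inequality_0) auto
  have fact: "a powr (1 - p) * b powr p
      = (?R powr (1 - p) * ?S powr p) * ((a / ?R) powr (1 - p) * (b / ?S) powr p)"
    if "a > 0" "b > 0" for a b
    using assms that by (simp add: powr_divide)
  have "r1 powr (1 - p) * s1 powr p + r2 powr (1 - p) * s2 powr p
    = (?R powr (1 - p) * ?S powr p) * ((r1 / ?R) powr (1 - p) * (s1 / ?S) powr p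
        + (r2 / ?R) powr (1 - p) * (s2 / ?S) powr p)"
    using fact[of r1 s1] fact[of r2 s2] assms by (simp only: distrib_left)
  also have "\<dots> \<le> (?R powr (1 - p) * ?S powr p) *
      (((1 - p) * (r1 / ?R) + p * (s1 / ?S)) + ((1 - p) * (r2 / ?R) + p * (s2 / ?S)))"
    using young assms by (intro mult_left_mono add_mono) auto
  also have "((1 - p) * (r1 / ?R) + p * (s1 / ?S)) + ((1 - p) * (r2 / ?R) + p * (s2 / ?S))
      = (1 - p) * ((r1 + r2) / ?R) + p * ((s1 + s2) / ?S)"
    by (simp only: add_divide_distrib[of r1 r2] add_divide_distrib[of s1 s2] distrib_left ac_simps)
  also have "\<dots> = 1" using assms by simp
  finally show ?thesis by simp
qed

text \<open>For a homogeneous function superadditivity is concavity. If some argument is 0, one of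
  the two means vanishes and monotonicity bounds the other.\<close>

lemma log_mean_superadditive:
  assumes "0 \<le> r1" "0 \<le> r2" "0 \<le> s1" "0 \<le> s2"
  shows "log_mean r1 s1 + log_mean r2 s2 \<le> log_mean (r1 + r2) (s1 + s2)"
proof (cases "r1 = 0 \<or> s1 = 0 \<or> r2 = 0 \<or> s2 = 0")
  case True
  then show ?thesis
    using assms log_mean_mono[of r1 "r1 + r2" s1 "s1 + s2"] log_mean_mono[of r2 "r1 + r2" s2 "s1 + s2"]
    by auto
next
  case False
  have "log_mean r1 s1 + log_mean r2 s2
      = integral {0..1} (\<lambda>p. r1 powr (1 - p) * s1 powr p + r2 powr (1 - p) * s2 powr p)"
    using assms unfolding log_mean_def
    by (intro integral_add[symmetric] log_mean_integrable)
  also have "\<dots> \<le> log_mean (r1 + r2) (s1 + s2)"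
    unfolding log_mean_def using False assms
    by (intro integral_le integrable_add log_mean_integrable powr_mult_superadditive) auto
  finally show ?thesis .
qed

text \<open>Jensen's inequality, where homogeneity moves the weights into the arguments. The weights
  will be the heat kernel.\<close>

lemma log_mean_sum_ge:
  assumes "finite I" "\<And>i. i \<in> I \<Longrightarrow> 0 \<le> m i \<and> 0 \<le> r i \<and> 0 \<le> s i"
  shows "(\<Sum>i\<in>I. m i * log_mean (r i) (s i)) \<le> log_mean (\<Sum>i\<in>I. m i * r i) (\<Sum>i\<in>I. m i * s i)"
  using assms
proof (induction I rule: finite_induct)
  case (insert j I)
  have "(\<Sum>i\<in>insert j I. m i * log_mean (r i) (s i))
      = log_mean (m j * r j) (m j * s j) + (\<Sum>i\<in>I. m i * log_mean (r i) (s i))"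
    using insert by (simp add: log_mean_scale)
  also have "\<dots> \<le> log_mean (m j * r j) (m j * s j)
      + log_mean (\<Sum>i\<in>I. m i * r i) (\<Sum>i\<in>I. m i * s i)"
    using insert by auto
  also have "\<dots> \<le> log_mean (m j * r j + (\<Sum>i\<in>I. m i * r i)) (m j * s j + (\<Sum>i\<in>I. m i * s i))"
    using insert by (intro log_mean_superadditive sum_nonneg) auto
  finally show ?case using insert by simp
qed simp

text \<open>The integrand is the exponential of an affine function of p, hence up to the slope its
  own derivative. This discrete chain rule for the logarithm ties the mean to the entropy and makes
  the heat flow a solution of the continuity equation.\<close>

lemma log_mean_mult_ln_diff:
  assumes "0 < r" "0 < s"
  shows "log_mean r s * (ln r - ln s) = r - s"
proof -
  have "((\<lambda>p. (ln s - ln r) * exp ((1 - p) * ln r + p * ln s)) has_integral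
      (exp ((1 - 1) * ln r + 1 * ln s) - exp ((1 - 0) * ln r + 0 * ln s))) {0..1}"
    by (intro fundamental_theorem_of_calculus)
      (auto intro!: derivative_eq_intros
        simp: has_real_derivative_iff_has_vector_derivative[symmetric] algebra_simps)
  then have "((\<lambda>p. (ln s - ln r) * (r powr (1 - p) * s powr p)) has_integral (s - r)) {0..1}"
    using assms by (simp add: powr_def exp_add)
  moreover have "((\<lambda>p. (ln s - ln r) * (r powr (1 - p) * s powr p)) has_integral
      ((ln s - ln r) * log_mean r s)) {0..1}"
    unfolding log_mean_def using assms log_mean_integrable
    by (intro has_integral_mult_right integrable_integral) auto
  ultimately have "s - r = (ln s - ln r) * log_mean r s"
    by (rule has_integral_unique)
  then show ?thesis by (simp add: algebra_simps)
qed

text \<open>Only elementary functions occur on the right, which makes the mean Borel in its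
  arguments.\<close>

lemma log_mean_closed_form:
  assumes "0 \<le> r" "0 \<le> s"
  shows "log_mean r s =
    (if r = 0 \<or> s = 0 then 0 else if r = s then r else (r - s) / (ln r - ln s))"
proof -
  have "ln r \<noteq> ln s" if "r > 0" "s > 0" "r \<noteq> s" using that by simp
  then show ?thesis
    using assms log_mean_mult_ln_diff[of r s] by (auto simp: log_mean_same eq_divide_eq)
qed

lemma borel_measurable_log_mean:
  fixes f g :: "'a \<Rightarrow> real"
  assumes [measurable]: "f \<in> borel_measurable M" "g \<in> borel_measurable M"
    and nonneg: "\<And>x. 0 \<le> f x" "\<And>x. 0 \<le> g x"
  shows "(\<lambda>x. log_mean (f x) (g x)) \<in> borel_measurable M"
proof -
  have "(\<lambda>x. log_mean (f x) (g x)) = (\<lambda>x. if f x = 0 \<or> g x = 0 then 0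
      else if f x = g x then f x else (f x - g x) / (ln (f x) - ln (g x)))"
    using log_mean_closed_form[OF nonneg] by (rule ext)
  then show ?thesis by (rule ssubst) measurable
qed

section \<open>Smooth functions on intervals\<close>

text \<open>Choosing a derivative within S and iterating the choice yields the tower
  \<open>D\<close> of the definition. Explicit formulas for higher derivatives are thereby
  avoided.\<close>

lemma smooth_on_IccI:
  assumes "f \<in> S"
    and "\<And>g. g \<in> S \<Longrightarrow> \<exists>g'\<in>S. \<forall>t\<in>{a..b}. (g has_real_derivative g' t) (at t within {a..b})"
  shows "smooth_on_Icc f a b"
proof -
  define d where "d g = (SOME g'. g' \<in> S \<and>
    (\<forall>t\<in>{a..b}. (g has_real_derivative g' t) (at t within {a..b})))" for g
  have d: "d g \<in> S \<and> (\<forall>t\<in>{a..b}. (g has_real_derivative d g t) (at t within {a..b}))"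
    if "g \<in> S" for g
  proof -
    have "\<exists>g'. g' \<in> S \<and> (\<forall>t\<in>{a..b}. (g has_real_derivative g' t) (at t within {a..b}))"
      using assms(2)[OF that] by blast
    then show ?thesis unfolding d_def by (rule someI_ex)
  qed
  have S: "(d ^^ k) f \<in> S" for k
  proof (induction k)
    case (Suc k)
    then show ?case using d by simp
  qed (simp add: assms(1))
  show ?thesis
    unfolding smooth_on_Icc_def using d[OF S]
    by (intro exI[of _ "\<lambda>k. (d ^^ k) f"] conjI allI) simp_all
qed

lemma smooth_on_Icc_derivative:
  assumes "smooth_on_Icc f a b"
  shows "\<exists>f'. smooth_on_Icc f' a b \<and>
    (\<forall>t\<in>{a..b}. (f has_real_derivative f' t) (at t within {a..b}))"
proof -
  obtain D where D: "D 0 = f"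
    "\<And>k t. t \<in> {a..b} \<Longrightarrow> (D k has_real_derivative D (Suc k) t) (at t within {a..b})"
    using assms unfolding smooth_on_Icc_def by blast
  have "smooth_on_Icc (D 1) a b"
    unfolding smooth_on_Icc_def using D by (intro exI[of _ "\<lambda>k. D (Suc k)"]) auto
  then show ?thesis using D(2)[of _ 0] D(1) by (intro exI[of _ "D 1"]) simp
qed

lemma smooth_on_Icc_continuous:
  assumes "smooth_on_Icc f a b"
  shows "continuous_on {a..b} f"
proof -
  obtain f' where "\<forall>t\<in>{a..b}. (f has_real_derivative f' t) (at t within {a..b})"
    using smooth_on_Icc_derivative[OF assms] by auto
  then show ?thesis
    unfolding continuous_on_eq_continuous_within by (metis DERIV_continuous)
qed

lemma smooth_on_Icc_cong:
  assumes "smooth_on_Icc f a b" "\<And>t. t \<in> {a..b} \<Longrightarrow> f t = g t"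
  shows "smooth_on_Icc g a b"
proof -
  obtain D where D: "D 0 = f"
    "\<And>k t. t \<in> {a..b} \<Longrightarrow> (D k has_real_derivative D (Suc k) t) (at t within {a..b})"
    using assms(1) unfolding smooth_on_Icc_def by blast
  have "(g has_real_derivative D 1 t) (at t within {a..b})" if "t \<in> {a..b}" for t
    by (rule has_field_derivative_transform_within[of f _ t _ 1])
      (use D(2)[OF that, of 0] D(1) assms(2) that in auto)
  then have "((if k = 0 then g else D k) has_real_derivative D (Suc k) t) (at t within {a..b})"
    if "t \<in> {a..b}" for k t
    using D(2)[of t k] that by (cases k) simp_all
  then show ?thesis
    unfolding smooth_on_Icc_def
    by (intro exI[of _ "\<lambda>k. if k = 0 then g else D k"] conjI allI ballI) simp_all
qed

text \<open>Sums of products are closed under differentiation by the Leibniz rule, so that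
  \<open>smooth_on_IccI\<close> applies; this takes the place of the binomial formula for
  derivatives of a product.\<close>

inductive_set smooth_products :: "real \<Rightarrow> real \<Rightarrow> (real \<Rightarrow> real) set" for a b where
  prod: "smooth_on_Icc u a b \<Longrightarrow> smooth_on_Icc w a b \<Longrightarrow> (\<lambda>t. u t * w t) \<in> smooth_products a b"
| add: "f \<in> smooth_products a b \<Longrightarrow> g \<in> smooth_products a b \<Longrightarrow>
    (\<lambda>t. f t + g t) \<in> smooth_products a b"

lemma smooth_products_smooth:
  assumes "f \<in> smooth_products a b"
  shows "smooth_on_Icc f a b"
proof (rule smooth_on_IccI[OF assms])
  fix g assume "g \<in> smooth_products a b"
  then show "\<exists>g'\<in>smooth_products a b. \<forall>t\<in>{a..b}. (g has_real_derivative g' t) (at t within {a..b})"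
  proof induction
    case (prod u w)
    obtain u' w' where uw: "smooth_on_Icc u' a b" "smooth_on_Icc w' a b"
      "\<forall>t\<in>{a..b}. (u has_real_derivative u' t) (at t within {a..b})"
      "\<forall>t\<in>{a..b}. (w has_real_derivative w' t) (at t within {a..b})"
      using smooth_on_Icc_derivative[OF prod(1)] smooth_on_Icc_derivative[OF prod(2)] by blast
    show ?case
      using prod uw
      by (intro bexI[of _ "\<lambda>t. u' t * w t + u t * w' t"] smooth_products.intros ballI)
        (auto intro!: derivative_eq_intros)
  next
    case (add f g)
    then obtain f' g' where "f' \<in> smooth_products a b" "g' \<in> smooth_products a b"
      "\<forall>t\<in>{a..b}. (f has_real_derivative f' t) (at t within {a..b})"
      "\<forall>t\<in>{a..b}. (g has_real_derivative g' t) (at t within {a..b})"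
      by blast
    then show ?case
      by (intro bexI[of _ "\<lambda>t. f' t + g' t"] smooth_products.intros ballI)
        (auto intro!: derivative_eq_intros)
  qed
qed

lemma smooth_on_Icc_mult:
  "smooth_on_Icc f a b \<Longrightarrow> smooth_on_Icc g a b \<Longrightarrow> smooth_on_Icc (\<lambda>t. f t * g t) a b"
  by (rule smooth_products_smooth, rule smooth_products.prod)

lemma smooth_on_Icc_const: "smooth_on_Icc (\<lambda>_. c) a b"
  by (rule smooth_on_IccI[of _ "range (\<lambda>c _. c)"]) (auto intro!: derivative_eq_intros)

lemma smooth_on_Icc_ident: "smooth_on_Icc (\<lambda>t. t) a b"
  by (rule smooth_on_IccI[of _ "insert (\<lambda>t. t) (range (\<lambda>c _. c))"])
    (auto intro!: derivative_eq_intros)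

lemma smooth_on_Icc_add:
  assumes "smooth_on_Icc f a b" "smooth_on_Icc g a b"
  shows "smooth_on_Icc (\<lambda>t. f t + g t) a b"
proof -
  have "(\<lambda>t. f t * 1 + g t * 1) \<in> smooth_products a b"
    by (rule smooth_products.add[OF smooth_products.prod[OF assms(1) smooth_on_Icc_const]
          smooth_products.prod[OF assms(2) smooth_on_Icc_const]])
  then show ?thesis using smooth_products_smooth by fastforce
qed

lemma smooth_on_Icc_diff:
  assumes "smooth_on_Icc f a b" "smooth_on_Icc g a b"
  shows "smooth_on_Icc (\<lambda>t. f t - g t) a b"
  using smooth_on_Icc_add[OF assms(1) smooth_on_Icc_mult[OF smooth_on_Icc_const[of "-1"] assms(2)]]
  by simp

lemma smooth_on_Icc_power: "smooth_on_Icc f a b \<Longrightarrow> smooth_on_Icc (\<lambda>t. f t ^ k) a b"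
  by (induction k) (simp_all add: smooth_on_Icc_const smooth_on_Icc_mult)

lemma smooth_on_Icc_sum:
  "(\<And>i. i \<in> I \<Longrightarrow> smooth_on_Icc (f i) a b) \<Longrightarrow> smooth_on_Icc (\<lambda>t. \<Sum>i\<in>I. f i t) a b"
  by (induction I rule: infinite_finite_induct) (auto simp: smooth_on_Icc_const smooth_on_Icc_add)

lemmas smooth_on_Icc_intros = smooth_on_Icc_mult smooth_on_Icc_const smooth_on_Icc_ident
  smooth_on_Icc_add smooth_on_Icc_diff smooth_on_Icc_power smooth_on_Icc_sum

text \<open>An affine inner function keeps the tower explicit, with a factor c^k at the k-th
  derivative. It covers both the change of speed in a concatenation and linear heat times.\<close>

lemma smooth_on_Icc_affine:
  assumes "smooth_on_Icc f a b" "\<And>t. t \<in> {a'..b'} \<Longrightarrow> c * t + d \<in> {a..b}"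
  shows "smooth_on_Icc (\<lambda>t. f (c * t + d)) a' b'"
proof -
  obtain D where D: "D 0 = f"
    "\<And>k t. t \<in> {a..b} \<Longrightarrow> (D k has_real_derivative D (Suc k) t) (at t within {a..b})"
    using assms(1) unfolding smooth_on_Icc_def by blast
  have "((\<lambda>t. c ^ k * D k (c * t + d)) has_real_derivative c ^ Suc k * D (Suc k) (c * t + d))
      (at t within {a'..b'})" if "t \<in> {a'..b'}" for k t
  proof -
    have "((\<lambda>t. D k (c * t + d)) has_real_derivative D (Suc k) (c * t + d) * c)
      (at t within {a'..b'})"
    proof (rule DERIV_image_chain[where s = "{a'..b'}" and f = "D k" and g = "\<lambda>t. c * t + d",
        unfolded o_def])
      show "((\<lambda>t. c * t + d) has_real_derivative c) (at t within {a'..b'})"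
        by (auto intro!: derivative_eq_intros)
      have "(D k has_real_derivative D (Suc k) (c * t + d)) (at (c * t + d) within {a..b})"
        by (rule D(2)) (rule assms(2)[OF that])
      then show "(D k has_real_derivative D (Suc k) (c * t + d))
          (at (c * t + d) within (\<lambda>t. c * t + d) ` {a'..b'})"
        by (rule DERIV_subset) (use assms(2) in auto)
    qed
    from DERIV_cmult[OF this, of "c ^ k"] show ?thesis by (simp add: mult_ac)
  qed
  then show ?thesis
    unfolding smooth_on_Icc_def
    by (intro exI[of _ "\<lambda>k t. c ^ k * D k (c * t + d)"]) (simp add: D(1))
qed

lemma adjacent_points:
  fixes T :: "real set"
  assumes "finite T" "a0 \<in> T" "b0 \<in> T" "a0 \<le> t" "t < b0"
  obtains a b where "a \<in> T" "b \<in> T" "a \<le> t" "t < b" "{a<..<b} \<inter> T = {}"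
proof -
  let ?A = "{u\<in>T. u \<le> t}" and ?B = "{u\<in>T. t < u}"
  have "finite ?A" "?A \<noteq> {}" "finite ?B" "?B \<noteq> {}"
    using assms by auto
  then have "Max ?A \<in> ?A" "Min ?B \<in> ?B"
    using Max_in[of ?A] Min_in[of ?B] by blast+
  moreover have "{Max ?A<..<Min ?B} \<inter> T = {}"
  proof (rule ccontr)
    assume "{Max ?A<..<Min ?B} \<inter> T \<noteq> {}"
    then obtain u where u: "u \<in> T" "Max ?A < u" "u < Min ?B" by auto
    show False
    proof (cases "u \<le> t")
      case True
      then have "u \<le> Max ?A" using assms u by (intro Max_ge) auto
      with u show False by simp
    next
      case False
      then have "Min ?B \<le> u" using assms u by (intro Min_le) auto
      with u show False by simp
    qed
  qed
  ultimately show ?thesis by (intro that[of "Max ?A" "Min ?B"]) blast+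
qed

lemma piecewise_smooth_continuous:
  assumes "piecewise_smooth T f"
  shows "continuous_on {0..1} f"
proof -
  define J where "J = {(a, b) \<in> T \<times> T. a < b \<and> {a<..<b} \<inter> T = {}}"
  have T: "finite T" "0 \<in> T" "1 \<in> T" "T \<subseteq> {0..1}"
    using assms unfolding piecewise_smooth_def by simp_all
  have "J \<subseteq> T \<times> T" by (auto simp: J_def)
  then have "finite J" using T(1) by (meson finite_SigmaI finite_subset)
  have "continuous_on {a..b} f" if "(a, b) \<in> J" for a b
  proof (rule smooth_on_Icc_continuous)
    have "a \<in> T" "b \<in> T" "a < b \<and> {a<..<b} \<inter> T = {}" using that by (simp_all add: J_def)
    then show "smooth_on_Icc f a b" using assms unfolding piecewise_smooth_def by blast
  qed
  then have "continuous_on (\<Union>(a, b)\<in>J. {a..b}) f"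
    using \<open>finite J\<close> by (intro continuous_on_closed_Union) auto
  moreover have "{0..1} \<subseteq> (\<Union>(a, b)\<in>J. {a..b})"
  proof
    fix t :: real assume t: "t \<in> {0..1}"
    have *: "\<exists>a b. (a, b) \<in> J \<and> a \<le> s \<and> s < b" if s: "0 \<le> s" "s < 1" for s
    proof -
      obtain a b where "a \<in> T" "b \<in> T" "a \<le> s" "s < b" "{a<..<b} \<inter> T = {}"
        using adjacent_points[OF T(1-3) s] by blast
      then show ?thesis unfolding J_def by (intro exI[of _ a] exI[of _ b]) simp
    qed
    have "\<exists>a b. (a, b) \<in> J \<and> a \<le> t \<and> t \<le> b"
    proof (cases "t = 1")
      case False
      with t have "0 \<le> t" "t < 1" by simp_all
      from *[OF this] show ?thesis by (meson less_imp_le)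
    next
      case True
      \<comment> \<open>No break point lies to the right of 1, so * does not apply to it. It is
        applied to the last break point u below 1, whose piece can only end at 1.\<close>
      define u where "u = Max (T - {1})"
      have "0 \<in> T - {1}" using T by simp
      then have u: "u \<in> T - {1}" unfolding u_def using T(1) by (intro Max_in) auto
      with T have "u \<in> {0..1}" "u \<noteq> 1" by blast+
      then have "0 \<le> u" "u < 1" by simp_all
      from *[OF this] obtain a b where ab: "(a, b) \<in> J" "a \<le> u" "u < b" by blast
      have "b = 1"
      proof (rule ccontr)
        assume "b \<noteq> 1"
        with ab have "b \<in> T - {1}" by (simp add: J_def)
        then have "b \<le> u" unfolding u_def using T by (intro Max_ge) auto
        with ab show False by simp
      qed
      with ab True \<open>u < 1\<close> show ?thesis by (intro exI[of _ a] exI[of _ b]) simp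
    qed
    then obtain a b where "(a, b) \<in> J" "a \<le> t" "t \<le> b" by blast
    then show "t \<in> (\<Union>(a, b)\<in>J. {a..b})" by (intro UN_I[of "(a, b)"]) simp_all
  qed
  ultimately show ?thesis by (rule continuous_on_subset)
qed

section \<open>The quadratic form of a density\<close>

text \<open>Polarised because the continuity equation pairs the velocity with arbitrary test
  functions, which occupy the first slot. On the diagonal the form is the action density.\<close>

definition grad_form ::
  "'a set \<Rightarrow> ('a \<Rightarrow> 'a \<Rightarrow> real) \<Rightarrow> ('a \<Rightarrow> real) \<Rightarrow> ('a \<Rightarrow> real) \<Rightarrow> ('a \<Rightarrow> real) \<Rightarrow> ('a \<Rightarrow> real) \<Rightarrow> real"
  where "grad_form X Q \<pi> \<rho> \<xi> \<psi> =
    1 / 2 * (\<Sum>x\<in>X. \<Sum>y\<in>X. (\<xi> x - \<xi> y) * (\<psi> x - \<psi> y) * log_mean (\<rho> x) (\<rho> y) * Q x y * \<pi> x)"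

lemma grad_form_scale:
  "grad_form X Q \<pi> \<rho> (\<lambda>x. c * \<psi> x) (\<lambda>x. c * \<psi> x) = c\<^sup>2 * grad_form X Q \<pi> \<rho> \<psi> \<psi>"
  unfolding grad_form_def sum_distrib_left
  by (intro sum.cong) (simp_all add: power2_eq_square algebra_simps)

lemma grad_form_commute: "grad_form X Q \<pi> \<rho> \<xi> \<psi> = grad_form X Q \<pi> \<rho> \<psi> \<xi>"
  by (simp add: grad_form_def mult.commute mult.left_commute)

lemma grad_form_add_scaled:
  "grad_form X Q \<pi> \<rho> \<xi> (\<lambda>x. \<psi> x + c * \<phi> x) =
    grad_form X Q \<pi> \<rho> \<xi> \<psi> + c * grad_form X Q \<pi> \<rho> \<xi> \<phi>"
  unfolding grad_form_def sum_distrib_left sum.distrib[symmetric]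
  by (intro sum.cong) (simp_all add: algebra_simps)

lemma grad_form_parallelogram:
  "grad_form X Q \<pi> \<rho> (\<lambda>x. \<xi> x + \<psi> x) (\<lambda>x. \<xi> x + \<psi> x) + grad_form X Q \<pi> \<rho> (\<lambda>x. \<xi> x - \<psi> x) (\<lambda>x. \<xi> x - \<psi> x) =
    2 * (grad_form X Q \<pi> \<rho> \<xi> \<xi> + grad_form X Q \<pi> \<rho> \<psi> \<psi>)"
  unfolding grad_form_def sum_distrib_left sum.distrib[symmetric]
  by (intro sum.cong refl) (simp add: algebra_simps)

lemma transport_action_eq:
  "transport_action X Q \<pi> \<rho> \<psi> =
    (\<integral>\<^sup>+t\<in>{0..1}. ennreal (grad_form X Q \<pi> (\<rho> t) (\<psi> t) (\<psi> t)) \<partial>lborel)"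
  by (simp add: transport_action_def grad_form_def power2_eq_square)

context
  fixes X :: "'a set" and Q :: "'a \<Rightarrow> 'a \<Rightarrow> real" and \<pi> :: "'a \<Rightarrow> real"
  assumes markov: "markov_triple X Q \<pi>"
begin

lemma finite_states: "finite X"
  using markov by (simp add: markov_triple_def)

lemma rate_nonneg: "x \<in> X \<Longrightarrow> y \<in> X \<Longrightarrow> 0 \<le> Q x y"
  using markov unfolding markov_triple_def by (metis order_refl)

lemma stationary_nonneg: "x \<in> X \<Longrightarrow> 0 \<le> \<pi> x"
  using markov by (simp add: markov_triple_def)

lemma detailed_balance: "x \<in> X \<Longrightarrow> y \<in> X \<Longrightarrow> Q x y * \<pi> x = Q y x * \<pi> y"
  using markov by (simp add: markov_triple_def mult.commute)

lemma grad_form_nonneg: "0 \<le> grad_form X Q \<pi> \<rho> \<psi> \<psi>"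
  unfolding grad_form_def power2_eq_square[symmetric]
  by (intro mult_nonneg_nonneg sum_nonneg)
    (simp_all add: log_mean_nonneg rate_nonneg stationary_nonneg)

text \<open>Expands the form at \<xi> - c \<psi>, which is nonnegative. The free constant c is later
  matched to the factor by which two forms are compared.\<close>

lemma grad_form_young:
  assumes "c > 0"
  shows "2 * grad_form X Q \<pi> \<rho> \<xi> \<psi> \<le>
    grad_form X Q \<pi> \<rho> \<xi> \<xi> / c + c * grad_form X Q \<pi> \<rho> \<psi> \<psi>"
proof -
  have "0 \<le> grad_form X Q \<pi> \<rho> (\<lambda>x. \<xi> x + (- c) * \<psi> x) (\<lambda>x. \<xi> x + (- c) * \<psi> x)"
    by (rule grad_form_nonneg)
  also have "\<dots> = grad_form X Q \<pi> \<rho> (\<lambda>x. \<xi> x + (- c) * \<psi> x) \<xi>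
      + (- c) * grad_form X Q \<pi> \<rho> (\<lambda>x. \<xi> x + (- c) * \<psi> x) \<psi>"
    by (rule grad_form_add_scaled)
  also have "grad_form X Q \<pi> \<rho> (\<lambda>x. \<xi> x + (- c) * \<psi> x) \<xi> =
      grad_form X Q \<pi> \<rho> \<xi> \<xi> + (- c) * grad_form X Q \<pi> \<rho> \<xi> \<psi>"
    using grad_form_add_scaled[of X Q \<pi> \<rho> \<xi> \<xi> "- c" \<psi>] by (metis grad_form_commute)
  also have "grad_form X Q \<pi> \<rho> (\<lambda>x. \<xi> x + (- c) * \<psi> x) \<psi> =
      grad_form X Q \<pi> \<rho> \<xi> \<psi> + (- c) * grad_form X Q \<pi> \<rho> \<psi> \<psi>"
    using grad_form_add_scaled[of X Q \<pi> \<rho> \<psi> \<xi> "- c" \<psi>] by (metis grad_form_commute)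
  finally have "c * (2 * grad_form X Q \<pi> \<rho> \<xi> \<psi>) \<le>
      c * (grad_form X Q \<pi> \<rho> \<xi> \<xi> / c + c * grad_form X Q \<pi> \<rho> \<psi> \<psi>)"
    using assms by (simp add: algebra_simps power2_eq_square)
  then show ?thesis using assms by (simp only: mult_le_cancel_left_pos)
qed

text \<open>Detailed balance makes the edge weight symmetric; averaging the sum with its image under
  the exchange of x and y produces the gradient of \<xi>.\<close>

lemma sum_gradient_by_parts:
  "(\<Sum>x\<in>X. \<pi> x * \<xi> x * (\<Sum>y\<in>X. (\<psi> x - \<psi> y) * log_mean (\<rho> x) (\<rho> y) * Q x y)) =
    grad_form X Q \<pi> \<rho> \<xi> \<psi>"
proof -
  let ?w = "\<lambda>x y. log_mean (\<rho> x) (\<rho> y) * (Q x y * \<pi> x)"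
  have w: "?w x y = ?w y x" if "x \<in> X" "y \<in> X" for x y
    using detailed_balance[OF that] by (simp add: log_mean_commute[of "\<rho> x"])
  let ?S = "\<Sum>x\<in>X. \<Sum>y\<in>X. \<xi> x * (\<psi> x - \<psi> y) * ?w x y"
  have "?S = (\<Sum>y\<in>X. \<Sum>x\<in>X. \<xi> x * (\<psi> x - \<psi> y) * ?w x y)"
    by (rule sum.swap)
  also have "\<dots> = (\<Sum>x\<in>X. \<Sum>y\<in>X. \<xi> y * (\<psi> y - \<psi> x) * ?w x y)"
    using w by (intro sum.cong refl) metis
  finally have "2 * ?S = ?S + (\<Sum>x\<in>X. \<Sum>y\<in>X. \<xi> y * (\<psi> y - \<psi> x) * ?w x y)"
    by simp
  also have "\<dots> = (\<Sum>x\<in>X. \<Sum>y\<in>X. (\<xi> x - \<xi> y) * (\<psi> x - \<psi> y) * ?w x y)"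
    unfolding sum.distrib[symmetric] by (intro sum.cong refl) (simp add: algebra_simps)
  finally have "?S = grad_form X Q \<pi> \<rho> \<xi> \<psi>"
    by (simp add: grad_form_def mult.assoc)
  then show ?thesis
    by (simp add: sum_distrib_left mult_ac)
qed

text \<open>The left side involves the velocity v but no potential. Hence potentials of one velocity
  have the same pairings, and identities between velocities at different densities transfer to their
  forms.\<close>

lemma continuity_equation_weak:
  assumes "\<And>x. x \<in> X \<Longrightarrow>
    v x + (\<Sum>y\<in>X. (\<psi> y - \<psi> x) * log_mean (\<rho> x) (\<rho> y) * Q x y) = 0"
  shows "(\<Sum>x\<in>X. \<pi> x * \<xi> x * v x) = grad_form X Q \<pi> \<rho> \<xi> \<psi>"
proof -
  have "v x = (\<Sum>y\<in>X. (\<psi> x - \<psi> y) * log_mean (\<rho> x) (\<rho> y) * Q x y)" if "x \<in> X" for x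
  proof -
    have "(\<Sum>y\<in>X. (\<psi> x - \<psi> y) * log_mean (\<rho> x) (\<rho> y) * Q x y)
        = - (\<Sum>y\<in>X. (\<psi> y - \<psi> x) * log_mean (\<rho> x) (\<rho> y) * Q x y)"
      unfolding sum_negf[symmetric] by (intro sum.cong refl) (simp add: algebra_simps)
    with assms[OF that] show ?thesis by simp
  qed
  then show ?thesis
    unfolding sum_gradient_by_parts[symmetric] by (intro sum.cong refl) simp
qed

text \<open>Half of a Legendre duality: the left side is free of the potential and attains the right
  side at \<xi> = \<psi>. The action density is thereby a supremum of expressions in the density and
  its velocity.\<close>

lemma grad_form_dual:
  assumes "\<And>x. x \<in> X \<Longrightarrow>
    v x + (\<Sum>y\<in>X. (\<psi> y - \<psi> x) * log_mean (\<rho> x) (\<rho> y) * Q x y) = 0"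
  shows "2 * (\<Sum>x\<in>X. \<pi> x * \<xi> x * v x) - grad_form X Q \<pi> \<rho> \<xi> \<xi> \<le> grad_form X Q \<pi> \<rho> \<psi> \<psi>"
  using grad_form_young[of 1 \<rho> \<xi> \<psi>] continuity_equation_weak[OF assms, of \<xi>] by simp

end

section \<open>Solvability of the Poisson equation\<close>

text \<open>Gaussian elimination: the Schur complement of a diagonal entry is again positive
  definite.\<close>

lemma positive_definite_solvable:
  fixes M :: "'a \<Rightarrow> 'a \<Rightarrow> real"
  assumes "finite X"
    and "\<And>\<xi>. \<exists>x\<in>X. \<xi> x \<noteq> 0 \<Longrightarrow> 0 < (\<Sum>x\<in>X. \<xi> x * (\<Sum>y\<in>X. M x y * \<xi> y))"
  shows "\<exists>\<xi>. \<forall>x\<in>X. (\<Sum>y\<in>X. M x y * \<xi> y) = b x"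
  using assms
proof (induction X arbitrary: M b rule: finite_induct)
  case (insert z Y)
  have posdef: "0 < (\<Sum>x\<in>insert z Y. \<xi> x * (\<Sum>y\<in>insert z Y. M x y * \<xi> y))"
    if "\<exists>x\<in>insert z Y. \<xi> x \<noteq> 0" for \<xi>
    using insert.prems that by blast
  have "(\<Sum>x\<in>Y. (if x = z then 1 else 0) * (\<Sum>y\<in>insert z Y. M x y * (if y = z then 1 else 0))) = 0"
    using insert.hyps by (intro sum.neutral) auto
  moreover have "(\<Sum>y\<in>Y. M z y * (if y = z then 1 else 0)) = 0"
    using insert.hyps by (intro sum.neutral) auto
  ultimately have z: "M z z > 0"
    using posdef[of "\<lambda>x. if x = z then 1 else 0"] insert.hyps by simp
  define M' where "M' x y = M x y - M x z * M z y / M z z" for x y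
  \<comment> \<open>\<open>ext \<beta> \<eta>\<close> extends \<eta> by the value at z for which row
    z evaluates to \<beta>. The choice \<beta> = 0 transfers positivity to the Schur complement,
    \<beta> = b z lifts a solution back.\<close>
  define ext where "ext \<beta> \<eta> = (\<lambda>x. if x = z then (\<beta> - (\<Sum>y\<in>Y. M z y * \<eta> y)) / M z z else \<eta> x)"
    for \<beta> :: real and \<eta>
  have extY: "(\<Sum>y\<in>Y. N y * ext \<beta> \<eta> y) = (\<Sum>y\<in>Y. N y * \<eta> y)" for N :: "'a \<Rightarrow> real" and \<beta> \<eta>
    using insert.hyps by (intro sum.cong) (auto simp: ext_def)
  have row_z: "(\<Sum>y\<in>insert z Y. M z y * ext \<beta> \<eta> y) = \<beta>" for \<beta> \<eta>
    using insert.hyps z by (simp add: extY) (simp add: ext_def)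
  have row: "(\<Sum>y\<in>insert z Y. M x y * ext \<beta> \<eta> y) = (\<Sum>y\<in>Y. M' x y * \<eta> y) + M x z * \<beta> / M z z"
    for x \<beta> \<eta>
  proof -
    have "(\<Sum>y\<in>Y. M' x y * \<eta> y) = (\<Sum>y\<in>Y. M x y * \<eta> y) - M x z / M z z * (\<Sum>y\<in>Y. M z y * \<eta> y)"
      unfolding M'_def sum_distrib_left sum_subtractf[symmetric]
      by (intro sum.cong) (simp_all add: algebra_simps)
    then show ?thesis
      using insert.hyps by (simp add: extY) (simp add: ext_def diff_divide_distrib algebra_simps)
  qed
  have "0 < (\<Sum>x\<in>Y. \<eta> x * (\<Sum>y\<in>Y. M' x y * \<eta> y))" if "\<exists>x\<in>Y. \<eta> x \<noteq> 0" for \<eta>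
  proof -
    have "\<exists>x\<in>insert z Y. ext 0 \<eta> x \<noteq> 0"
      using that insert.hyps by (auto simp: ext_def)
    then have "0 < (\<Sum>x\<in>insert z Y. ext 0 \<eta> x * (\<Sum>y\<in>insert z Y. M x y * ext 0 \<eta> y))"
      by (rule posdef)
    also have "\<dots> = ext 0 \<eta> z * (\<Sum>y\<in>insert z Y. M z y * ext 0 \<eta> y) +
        (\<Sum>x\<in>Y. ext 0 \<eta> x * (\<Sum>y\<in>insert z Y. M x y * ext 0 \<eta> y))"
      using insert.hyps by simp
    also have "\<dots> = (\<Sum>x\<in>Y. \<eta> x * (\<Sum>y\<in>Y. M' x y * \<eta> y))"
      unfolding row_z unfolding row
      using extY[of "\<lambda>x. \<Sum>y\<in>Y. M' x y * \<eta> y" 0 \<eta>] by (simp add: mult.commute)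
    finally show ?thesis .
  qed
  from insert.IH[OF this, of "\<lambda>x. b x - M x z * b z / M z z"]
  obtain \<eta> where \<eta>: "\<forall>x\<in>Y. (\<Sum>y\<in>Y. M' x y * \<eta> y) = b x - M x z * b z / M z z"
    by blast
  have "(\<Sum>y\<in>insert z Y. M x y * ext (b z) \<eta> y) = b x" if "x \<in> insert z Y" for x
  proof (cases "x = z")
    case False
    with that \<eta> show ?thesis unfolding row by simp
  qed (simp only: row_z)
  then show ?case by blast
qed simp

text \<open>The operator of the equation annihilates constants. Adding the rank one term
  \<open>\<pi> x * \<pi> y\<close> makes its matrix positive definite, provided that the form
  vanishes only at functions constant on X. Since v has mean zero, so has the solution, and the
  added term drops out.\<close>

lemma continuity_equation_solvable:
  assumes markov: "markov_triple X Q \<pi>" and pos: "\<And>x. x \<in> X \<Longrightarrow> 0 < \<pi> x"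
    and irreducible: "\<And>\<xi> x y. grad_form X Q \<pi> \<rho> \<xi> \<xi> = 0 \<Longrightarrow> x \<in> X \<Longrightarrow> y \<in> X \<Longrightarrow> \<xi> x = \<xi> y"
    and mean: "(\<Sum>x\<in>X. \<pi> x * v x) = 0"
  shows "\<exists>\<psi>. \<forall>x\<in>X. v x + (\<Sum>y\<in>X. (\<psi> y - \<psi> x) * log_mean (\<rho> x) (\<rho> y) * Q x y) = 0"
proof -
  note fin = finite_states[OF markov]
  let ?w = "\<lambda>x y. log_mean (\<rho> x) (\<rho> y) * Q x y"
  let ?L = "\<lambda>\<xi> x. \<Sum>y\<in>X. (\<xi> x - \<xi> y) * log_mean (\<rho> x) (\<rho> y) * Q x y"
  define M where "M x y = \<pi> x * ((if y = x then (\<Sum>z\<in>X. ?w x z) else 0) - ?w x y) + \<pi> x * \<pi> y" for x y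
  have row: "(\<Sum>y\<in>X. M x y * \<xi> y) = \<pi> x * ?L \<xi> x + \<pi> x * (\<Sum>y\<in>X. \<pi> y * \<xi> y)" if "x \<in> X" for x \<xi>
  proof -
    have "(\<Sum>y\<in>X. M x y * \<xi> y) = (\<Sum>y\<in>X. \<pi> x * ((if y = x then (\<Sum>z\<in>X. ?w x z) * \<xi> y else 0) - ?w x y * \<xi> y)
        + \<pi> x * (\<pi> y * \<xi> y))"
      by (intro sum.cong) (auto simp: M_def algebra_simps)
    also have "\<dots> = \<pi> x * ((\<Sum>z\<in>X. ?w x z) * \<xi> x - (\<Sum>y\<in>X. ?w x y * \<xi> y)) + \<pi> x * (\<Sum>y\<in>X. \<pi> y * \<xi> y)"
      using fin that by (simp add: sum.distrib sum_subtractf flip: sum_distrib_left)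
    also have "(\<Sum>z\<in>X. ?w x z) * \<xi> x - (\<Sum>y\<in>X. ?w x y * \<xi> y) = ?L \<xi> x"
      unfolding sum_distrib_right sum_subtractf[symmetric]
      by (intro sum.cong) (simp_all add: algebra_simps)
    finally show ?thesis .
  qed
  have quad: "(\<Sum>x\<in>X. \<eta> x * (\<Sum>y\<in>X. M x y * \<xi> y)) =
      grad_form X Q \<pi> \<rho> \<eta> \<xi> + (\<Sum>x\<in>X. \<pi> x * \<eta> x) * (\<Sum>x\<in>X. \<pi> x * \<xi> x)" for \<eta> \<xi>
  proof -
    have "(\<Sum>x\<in>X. \<eta> x * (\<Sum>y\<in>X. M x y * \<xi> y)) =
        (\<Sum>x\<in>X. \<pi> x * \<eta> x * ?L \<xi> x + \<pi> x * \<eta> x * (\<Sum>y\<in>X. \<pi> y * \<xi> y))"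
      by (intro sum.cong refl, subst row) (simp_all add: distrib_left mult_ac)
    then show ?thesis
      by (simp only: sum.distrib sum_gradient_by_parts[OF markov] sum_distrib_right)
  qed
  have "0 < (\<Sum>x\<in>X. \<xi> x * (\<Sum>y\<in>X. M x y * \<xi> y))" if nonzero: "\<exists>x\<in>X. \<xi> x \<noteq> 0" for \<xi>
  proof (rule ccontr)
    assume "\<not> ?thesis"
    then have le: "grad_form X Q \<pi> \<rho> \<xi> \<xi> + (\<Sum>x\<in>X. \<pi> x * \<xi> x) * (\<Sum>x\<in>X. \<pi> x * \<xi> x) \<le> 0"
      by (simp add: quad)
    have nn: "0 \<le> grad_form X Q \<pi> \<rho> \<xi> \<xi>" "0 \<le> (\<Sum>x\<in>X. \<pi> x * \<xi> x) * (\<Sum>x\<in>X. \<pi> x * \<xi> x)"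
      by (simp_all add: grad_form_nonneg[OF markov])
    with le have "grad_form X Q \<pi> \<rho> \<xi> \<xi> = 0" by linarith
    moreover from le nn have "(\<Sum>x\<in>X. \<pi> x * \<xi> x) * (\<Sum>x\<in>X. \<pi> x * \<xi> x) = 0" by linarith
    ultimately have *: "\<And>x y. x \<in> X \<Longrightarrow> y \<in> X \<Longrightarrow> \<xi> x = \<xi> y" "(\<Sum>x\<in>X. \<pi> x * \<xi> x) = 0"
      using irreducible by auto
    obtain z where z: "z \<in> X" "\<xi> z \<noteq> 0" using nonzero by blast
    have "(\<Sum>x\<in>X. \<pi> x * \<xi> x) = (\<Sum>x\<in>X. \<pi> x * \<xi> z)"
      using *(1)[OF _ z(1)] by (intro sum.cong) auto
    also have "\<dots> = \<xi> z"
      using markov by (simp add: markov_triple_def flip: sum_distrib_right)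
    finally show False using *(2) z by simp
  qed
  from positive_definite_solvable[OF fin this, of "\<lambda>x. \<pi> x * v x"]
  obtain \<psi> where \<psi>: "\<forall>x\<in>X. (\<Sum>y\<in>X. M x y * \<psi> y) = \<pi> x * v x" by blast
  \<comment> \<open>Summing all rows of the solved system, that is, testing with the constant 1,
    leaves only the mean of \<psi>.\<close>
  have "grad_form X Q \<pi> \<rho> (\<lambda>_. 1) \<psi> = 0" by (simp add: grad_form_def)
  then have "(\<Sum>x\<in>X. \<pi> x * \<psi> x) = 0"
    using quad[of "\<lambda>_. 1" \<psi>] \<psi> mean markov by (simp add: markov_triple_def)
  then have L: "?L \<psi> x = v x" if "x \<in> X" for x
    using row[OF that, of \<psi>] bspec[OF \<psi> that] pos[OF that] by simp
  have "v x + (\<Sum>y\<in>X. (\<psi> y - \<psi> x) * log_mean (\<rho> x) (\<rho> y) * Q x y) = 0" if "x \<in> X" for x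
    unfolding L[OF that, symmetric] sum.distrib[symmetric]
    by (intro sum.neutral) (simp add: algebra_simps)
  then show ?thesis by blast
qed

section \<open>Admissible costs\<close>

text \<open>The action as a real gauge integral, which can be rescaled, added and changed at
  finitely many times. Every curve of finite action provides one by
  \<open>transport_action_has_integral\<close>.\<close>

definition admissible_cost ::
  "'a set \<Rightarrow> ('a \<Rightarrow> 'a \<Rightarrow> real) \<Rightarrow> ('a \<Rightarrow> real) \<Rightarrow> ('a \<Rightarrow> real) \<Rightarrow> ('a \<Rightarrow> real) \<Rightarrow> real \<Rightarrow> bool" where
  "admissible_cost X Q \<pi> \<rho>\<^sub>0 \<rho>\<^sub>1 I \<longleftrightarrow>
     (\<exists>\<rho> \<psi>. transport_curve X Q \<pi> \<rho>\<^sub>0 \<rho>\<^sub>1 \<rho> \<psi> \<and>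
        ((\<lambda>t. grad_form X Q \<pi> (\<rho> t) (\<psi> t) (\<psi> t)) has_integral I) {0..1})"

lemma transport_cost_le_admissible:
  assumes "markov_triple X Q \<pi>" "admissible_cost X Q \<pi> \<rho>\<^sub>0 \<rho>\<^sub>1 I"
  shows "transport_cost X Q \<pi> \<rho>\<^sub>0 \<rho>\<^sub>1 \<le> ennreal I"
proof -
  obtain \<rho> \<psi> where curve: "transport_curve X Q \<pi> \<rho>\<^sub>0 \<rho>\<^sub>1 \<rho> \<psi>"
    and I: "((\<lambda>t. grad_form X Q \<pi> (\<rho> t) (\<psi> t) (\<psi> t)) has_integral I) {0..1}"
    using assms(2) unfolding admissible_cost_def by (elim exE conjE)
  have "transport_action X Q \<pi> \<rho> \<psi> = ennreal I"
    unfolding transport_action_eq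
    by (rule nn_integral_has_integral_lebesgue'[OF _ I]) (rule grad_form_nonneg[OF assms(1)])
  with curve show ?thesis
    unfolding transport_cost_def by (intro Inf_lower) (simp, metis)
qed

lemma transport_curve_continuous:
  assumes "transport_curve X Q \<pi> \<rho>\<^sub>0 \<rho>\<^sub>1 \<rho> \<psi>" "x \<in> X"
  shows "continuous_on {0..1} (\<lambda>t. \<rho> t x)"
  using assms unfolding transport_curve_def by (metis piecewise_smooth_continuous)

text \<open>On N the derivative is the pointwise limit of difference quotients, which are Borel
  because f is continuous.\<close>

lemma measurable_difference_quotient_limit:
  fixes f :: "real \<Rightarrow> real"
  assumes cont: "continuous_on UNIV f" and N: "N \<in> sets borel"
    and deriv: "\<And>t. t \<in> N \<Longrightarrow> (f has_real_derivative f' t) (at t)"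
  shows "(\<lambda>t. if t \<in> N then f' t else 0) \<in> borel_measurable borel"
proof (rule borel_measurable_LIMSEQ_real)
  have [measurable]: "f \<in> borel_measurable borel" using cont by (rule borel_measurable_continuous_onI)
  note N[measurable]
  fix k :: nat
  show "(\<lambda>t. if t \<in> N then (f (t + 1 / Suc k) - f t) / (1 / Suc k) else 0) \<in> borel_measurable borel"
    by measurable
next
  fix t :: real
  show "(\<lambda>k. if t \<in> N then (f (t + 1 / Suc k) - f t) / (1 / Suc k) else 0)
      \<longlonglongrightarrow> (if t \<in> N then f' t else 0)"
  proof (cases "t \<in> N")
    case True
    have "((\<lambda>h. (f (t + h) - f t) / h) \<longlongrightarrow> f' t) (at 0)"
      using deriv[OF True] by (simp add: DERIV_def)
    moreover have "filterlim (\<lambda>k. 1 / real (Suc k)) (at 0) sequentially"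
      unfolding filterlim_at using LIMSEQ_Suc[OF lim_1_over_n] by (auto simp: o_def)
    ultimately have "(\<lambda>k. (f (t + 1 / Suc k) - f t) / (1 / Suc k)) \<longlonglongrightarrow> f' t"
      by (rule filterlim_compose)
    then show ?thesis using True by simp
  qed simp
qed

text \<open>Off the break points the integrand is a supremum of countably many Borel functions, by
  duality over rational test functions.\<close>

lemma transport_action_has_integral:
  assumes markov: "markov_triple X Q \<pi>" and curve: "transport_curve X Q \<pi> \<rho>\<^sub>0 \<rho>\<^sub>1 \<rho> \<psi>"
    and finite: "transport_action X Q \<pi> \<rho> \<psi> < \<infinity>"
  shows "((\<lambda>t. grad_form X Q \<pi> (\<rho> t) (\<psi> t) (\<psi> t)) has_integral
    enn2real (transport_action X Q \<pi> \<rho> \<psi>)) {0..1}"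
proof -
  note fin = finite_states[OF markov]
  obtain T where T: "\<forall>x\<in>X. piecewise_smooth T (\<lambda>t. \<rho> t x)"
    and CE: "\<forall>t\<in>{0..1} - T. \<forall>x\<in>X. \<exists>d. ((\<lambda>s. \<rho> s x) has_real_derivative d) (at t) \<and>
      d + (\<Sum>y\<in>X. (\<psi> t y - \<psi> t x) * log_mean (\<rho> t x) (\<rho> t y) * Q x y) = 0"
    using curve unfolding transport_curve_def by (elim conjE exE)
  have "X \<noteq> {}"
    using markov by (auto simp: markov_triple_def)
  with T have T: "finite T"
    unfolding piecewise_smooth_def by blast
  define A where "A t = grad_form X Q \<pi> (\<rho> t) (\<psi> t) (\<psi> t)" for t
  define N where "N = {0<..<1} - T"
  have N[measurable]: "N \<in> sets borel"
    unfolding N_def using T by (intro sets.Diff) (auto intro: finite_imp_closed borel_closed)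
  \<comment> \<open>Clamping time to the unit interval extends the curve continuously to the whole
    line, where the difference quotients are formed.\<close>
  define c :: "real \<Rightarrow> real" where "c t = max 0 (min 1 t)" for t
  have c: "c t \<in> {0..1}" "t \<in> {0..1} \<Longrightarrow> c t = t" for t by (auto simp: c_def)
  have cont: "continuous_on UNIV (\<lambda>t. \<rho> (c t) x)" if "x \<in> X" for x
    by (rule continuous_on_compose2[OF transport_curve_continuous[OF curve that]])
      (auto simp: c_def intro!: continuous_intros)
  have nonneg: "0 \<le> \<rho> (c t) x" if "x \<in> X" for t x
    using curve c(1)[of t] that unfolding transport_curve_def densities_def by (auto simp: PiE_iff)
  define V where "V t x = - (\<Sum>y\<in>X. (\<psi> t y - \<psi> t x) * log_mean (\<rho> t x) (\<rho> t y) * Q x y)" for t x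
  have deriv: "((\<lambda>s. \<rho> (c s) x) has_real_derivative V t x) (at t)" if "t \<in> N" "x \<in> X" for t x
  proof -
    have "t \<in> {0..1} - T" using that by (auto simp: N_def)
    then obtain d where d: "((\<lambda>s. \<rho> s x) has_real_derivative d) (at t)"
      "d + (\<Sum>y\<in>X. (\<psi> t y - \<psi> t x) * log_mean (\<rho> t x) (\<rho> t y) * Q x y) = 0"
      using CE \<open>x \<in> X\<close> by blast
    then have "d = V t x" by (simp add: V_def)
    with d have "((\<lambda>s. \<rho> s x) has_real_derivative V t x) (at t)" by simp
    then show ?thesis
      by (rule has_field_derivative_transform_within_open[of _ _ _ "{0<..<1}"])
        (use that c(2) in \<open>auto simp: N_def\<close>)
  qed
  have V_meas: "(\<lambda>t. if t \<in> N then V t x else 0) \<in> borel_measurable borel" if "x \<in> X" for x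
    by (rule measurable_difference_quotient_limit[OF cont[OF that] N deriv[OF _ that]])
  have log_meas: "(\<lambda>t. log_mean (\<rho> (c t) x) (\<rho> (c t) y)) \<in> borel_measurable borel"
    if "x \<in> X" "y \<in> X" for x y
    using that by (intro borel_measurable_log_mean borel_measurable_continuous_onI cont nonneg)
  define \<Phi> where "\<Phi> \<xi> t = 2 * (\<Sum>x\<in>X. \<pi> x * \<xi> x * (if t \<in> N then V t x else 0))
      - grad_form X Q \<pi> (\<rho> (c t)) \<xi> \<xi>" for \<xi> t
  have \<Phi>_meas: "\<Phi> \<xi> \<in> borel_measurable borel" for \<xi>
    unfolding \<Phi>_def grad_form_def
    by (intro borel_measurable_diff borel_measurable_times borel_measurable_sum
        borel_measurable_const V_meas log_meas)
  \<comment> \<open>Extensionality makes the set of rational test functions countable; values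
    outside X do not enter the form.\<close>
  define S where "S = (PiE X (\<lambda>_. \<rat>) :: ('a \<Rightarrow> real) set)"
  have "countable S" unfolding S_def using fin by (intro countable_PiE countable_rat)
  \<comment> \<open>\<open>ennreal\<close> cuts negative values off at 0, which is harmless because
    the supremum \<open>A t\<close> is nonnegative.\<close>
  define F where "F t = (SUP \<xi>\<in>S. ennreal (\<Phi> \<xi> t))" for t
  have F_meas[measurable]: "F \<in> borel_measurable borel"
    unfolding F_def using \<open>countable S\<close> \<Phi>_meas by (intro borel_measurable_SUP) auto
  have F: "F t = ennreal (A t)" if t: "t \<in> N" for t
  proof (rule antisym)
    have ct: "c t = t" using t by (intro c(2)) (auto simp: N_def)
    have eq: "V t x + (\<Sum>y\<in>X. (\<psi> t y - \<psi> t x) * log_mean (\<rho> t x) (\<rho> t y) * Q x y) = 0" for x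
      by (simp add: V_def)
    have \<Phi>_eq: "\<Phi> \<xi> t = 2 * (\<Sum>x\<in>X. \<pi> x * \<xi> x * V t x) - grad_form X Q \<pi> (\<rho> t) \<xi> \<xi>" for \<xi>
      using t by (simp add: \<Phi>_def ct)
    have "\<Phi> \<xi> t \<le> A t" for \<xi>
      unfolding \<Phi>_eq A_def by (rule grad_form_dual[OF markov eq])
    then show "F t \<le> ennreal (A t)"
      unfolding F_def by (intro SUP_least ennreal_leI)
    define \<xi> where "\<xi> k = restrict (\<lambda>x. of_int \<lfloor>real (Suc k) * \<psi> t x\<rfloor> / real (Suc k)) X" for k
    have "\<xi> k \<in> S" for k by (auto simp: \<xi>_def S_def)
    have lim: "(\<lambda>k. \<xi> k x) \<longlonglongrightarrow> \<psi> t x" if "x \<in> X" for x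
    proof (rule tendsto_sandwich)
      show "\<forall>\<^sub>F k in sequentially. \<psi> t x - 1 / real (Suc k) \<le> \<xi> k x"
      proof (intro always_eventually allI)
        fix k
        have "real (Suc k) * \<psi> t x - 1 \<le> of_int \<lfloor>real (Suc k) * \<psi> t x\<rfloor>" by linarith
        then have "(real (Suc k) * \<psi> t x - 1) / real (Suc k) \<le> \<xi> k x"
          unfolding \<xi>_def using that by (simp add: divide_right_mono)
        then show "\<psi> t x - 1 / real (Suc k) \<le> \<xi> k x" by (simp add: diff_divide_distrib)
      qed
      show "\<forall>\<^sub>F k in sequentially. \<xi> k x \<le> \<psi> t x"
      proof (intro always_eventually allI)
        fix k
        have "of_int \<lfloor>real (Suc k) * \<psi> t x\<rfloor> / real (Suc k) \<le> (real (Suc k) * \<psi> t x) / real (Suc k)"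
          by (intro divide_right_mono) linarith+
        then show "\<xi> k x \<le> \<psi> t x" using that by (simp add: \<xi>_def)
      qed
      have "(\<lambda>k. 1 / real (Suc k)) \<longlonglongrightarrow> 0" using LIMSEQ_Suc[OF lim_1_over_n] by simp
      from tendsto_diff[OF tendsto_const[of "\<psi> t x"] this]
      show "(\<lambda>k. \<psi> t x - 1 / real (Suc k)) \<longlonglongrightarrow> \<psi> t x" by simp
    qed simp
    \<comment> \<open>At the potential itself the dual expression is 2 A - A, so its rational
      approximations exhaust the supremum.\<close>
    have "(\<lambda>k. \<Phi> (\<xi> k) t) \<longlonglongrightarrow> 2 * (\<Sum>x\<in>X. \<pi> x * \<psi> t x * V t x) - A t"
      unfolding \<Phi>_eq A_def grad_form_def by (intro tendsto_intros lim)
    also have "2 * (\<Sum>x\<in>X. \<pi> x * \<psi> t x * V t x) - A t = A t"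
      using continuity_equation_weak[OF markov eq, of "\<psi> t"] by (simp add: A_def)
    finally have "(\<lambda>k. ennreal (\<Phi> (\<xi> k) t)) \<longlonglongrightarrow> ennreal (A t)"
      by (rule tendsto_ennrealI)
    then show "ennreal (A t) \<le> F t"
      by (rule LIMSEQ_le_const2) (auto simp: F_def intro!: SUP_upper \<open>\<And>k. \<xi> k \<in> S\<close>)
  qed
  define G where "G t = (if t \<in> N then A t else 0)" for t
  have A_nonneg: "0 \<le> A t" for t unfolding A_def by (rule grad_form_nonneg[OF markov])
  have "G = (\<lambda>t. enn2real (if t \<in> N then F t else 0))"
    by (auto simp: G_def F A_nonneg)
  then have G_meas: "G \<in> borel_measurable borel"
    by (rule ssubst) measurable
  have "AE t in lborel. t \<notin> insert 0 (insert 1 T)"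
    using T by (intro AE_not_in finite_imp_null_set_lborel) auto
  then have "AE t in lborel. ennreal (G t) = ennreal (A t) * indicator {0..1} t"
    by eventually_elim (auto simp: G_def N_def indicator_def)
  then have "(\<integral>\<^sup>+t. ennreal (G t) \<partial>lborel) = transport_action X Q \<pi> \<rho> \<psi>"
    unfolding transport_action_eq A_def[symmetric] by (rule nn_integral_cong_AE)
  also have "\<dots> = ennreal (enn2real (transport_action X Q \<pi> \<rho> \<psi>))"
    using finite by simp
  finally have "(G has_integral enn2real (transport_action X Q \<pi> \<rho> \<psi>)) UNIV"
    using A_nonneg by (intro nn_integral_has_integral[OF G_meas]) (simp_all add: G_def)
  then have "((\<lambda>t. if t \<in> {0..1} then G t else 0) has_integral
      enn2real (transport_action X Q \<pi> \<rho> \<psi>)) UNIV"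
    by (rule has_integral_eq[rotated]) (auto simp: G_def N_def)
  then have "(G has_integral enn2real (transport_action X Q \<pi> \<rho> \<psi>)) {0..1}"
    by (simp only: has_integral_restrict_UNIV)
  then show ?thesis
    unfolding A_def[symmetric]
    by (rule has_integral_spike_finite[rotated 2, where S = "insert 0 (insert 1 T)"])
      (use T in \<open>auto simp: G_def N_def\<close>)
qed

lemma transport_cost_less_admissible:
  assumes markov: "markov_triple X Q \<pi>" and less: "transport_cost X Q \<pi> \<rho>\<^sub>0 \<rho>\<^sub>1 < ennreal r"
  shows "\<exists>I. 0 \<le> I \<and> I < r \<and> admissible_cost X Q \<pi> \<rho>\<^sub>0 \<rho>\<^sub>1 I"
proof -
  obtain \<rho> \<psi> where curve: "transport_curve X Q \<pi> \<rho>\<^sub>0 \<rho>\<^sub>1 \<rho> \<psi>"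
    and act: "transport_action X Q \<pi> \<rho> \<psi> < ennreal r"
    using less unfolding transport_cost_def Inf_less_iff by blast
  let ?I = "enn2real (transport_action X Q \<pi> \<rho> \<psi>)"
  have fin: "transport_action X Q \<pi> \<rho> \<psi> < \<infinity>"
    using act by (simp add: order_less_trans)
  have "admissible_cost X Q \<pi> \<rho>\<^sub>0 \<rho>\<^sub>1 ?I"
    unfolding admissible_cost_def using curve transport_action_has_integral[OF markov curve fin] by blast
  moreover have "?I < r"
    using act fin ennreal_less_iff[of ?I r] by simp
  ultimately show ?thesis using enn2real_nonneg by blast
qed

section \<open>Concatenation of curves\<close>

text \<open>Running the first curve in time l multiplies its velocity and potential by 1 / l, so the
  action density by 1 / l^2 on an interval of length l. The second curve is treated alike with 1 -
  l.\<close>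

lemma admissible_cost_concat:
  assumes I1: "admissible_cost X Q \<pi> \<rho>\<^sub>0 \<rho>\<^sub>1 I1" and I2: "admissible_cost X Q \<pi> \<rho>\<^sub>1 \<rho>\<^sub>2 I2"
    and l: "0 < l" "l < 1"
  shows "admissible_cost X Q \<pi> \<rho>\<^sub>0 \<rho>\<^sub>2 (I1 / l + I2 / (1 - l))"
proof -
  obtain r1 p1 where curve1: "transport_curve X Q \<pi> \<rho>\<^sub>0 \<rho>\<^sub>1 r1 p1"
    and int1: "((\<lambda>t. grad_form X Q \<pi> (r1 t) (p1 t) (p1 t)) has_integral I1) {0..1}"
    using I1 unfolding admissible_cost_def by (elim exE conjE)
  obtain r2 p2 where curve2: "transport_curve X Q \<pi> \<rho>\<^sub>1 \<rho>\<^sub>2 r2 p2"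
    and int2: "((\<lambda>t. grad_form X Q \<pi> (r2 t) (p2 t) (p2 t)) has_integral I2) {0..1}"
    using I2 unfolding admissible_cost_def by (elim exE conjE)
  have dens1: "\<forall>t\<in>{0..1}. r1 t \<in> densities X \<pi>" "r1 0 = \<rho>\<^sub>0" "r1 1 = \<rho>\<^sub>1"
    and dens2: "\<forall>t\<in>{0..1}. r2 t \<in> densities X \<pi>" "r2 0 = \<rho>\<^sub>1" "r2 1 = \<rho>\<^sub>2"
    using curve1 curve2 unfolding transport_curve_def by blast+
  obtain T1 where T1: "\<forall>x\<in>X. piecewise_smooth T1 (\<lambda>t. r1 t x)"
    and CE1: "\<forall>t\<in>{0..1} - T1. \<forall>x\<in>X. \<exists>d. ((\<lambda>s. r1 s x) has_real_derivative d) (at t) \<and>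
      d + (\<Sum>y\<in>X. (p1 t y - p1 t x) * log_mean (r1 t x) (r1 t y) * Q x y) = 0"
    using curve1 unfolding transport_curve_def by (elim conjE exE)
  obtain T2 where T2: "\<forall>x\<in>X. piecewise_smooth T2 (\<lambda>t. r2 t x)"
    and CE2: "\<forall>t\<in>{0..1} - T2. \<forall>x\<in>X. \<exists>d. ((\<lambda>s. r2 s x) has_real_derivative d) (at t) \<and>
      d + (\<Sum>y\<in>X. (p2 t y - p2 t x) * log_mean (r2 t x) (r2 t y) * Q x y) = 0"
    using curve2 unfolding transport_curve_def by (elim conjE exE)
  \<comment> \<open>The \<open>+ 0\<close> gives both halves the shape \<open>c * t + d\<close> of
    \<open>smooth_on_Icc_affine\<close> and of affine substitution in integrals.\<close>
  define \<rho> where "\<rho> t = (if t \<le> l then r1 (1 / l * t + 0) else r2 (1 / (1 - l) * t + - (l / (1 - l))))" for t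
  define \<psi> where "\<psi> t = (if t \<le> l then (\<lambda>x. 1 / l * p1 (1 / l * t + 0) x)
      else (\<lambda>x. 1 / (1 - l) * p2 (1 / (1 - l) * t + - (l / (1 - l))) x))" for t
  define T where "T = (\<lambda>s. l * s) ` T1 \<union> (\<lambda>s. l + (1 - l) * s) ` T2"
  have scale2: "1 / (1 - l) * (l + (1 - l) * s) + - (l / (1 - l)) = s" for s
  proof -
    have "1 / (1 - l) * (l + (1 - l) * s) + - (l / (1 - l)) = (1 - l) * s / (1 - l)"
      by (simp add: add_divide_distrib)
    then show ?thesis using l by simp
  qed
  have scale2': "l + (1 - l) * (1 / (1 - l) * t + - (l / (1 - l))) = t" for t
  proof -
    have "(1 - l) * (1 / (1 - l) * t + - (l / (1 - l))) = (1 - l) * ((t - l) / (1 - l))"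
      by (simp add: diff_divide_distrib)
    then show ?thesis using l by simp
  qed
  have scale1: "1 / l * (l * s) + 0 = s" "l * (1 / l * s + 0) = s" for s
    using l by simp_all
  have mono2: "1 / (1 - l) * t + - (l / (1 - l)) \<in> {0..1} \<longleftrightarrow> t \<in> {l..1}" for t
    using l by (auto simp: divide_simps)
  have mono1: "1 / l * t + 0 \<in> {0..1} \<longleftrightarrow> t \<in> {0..l}" for t
    using l by (auto simp: divide_simps)
  \<comment> \<open>The two formulas agree at the junction, so the right one holds on the closed
    interval from l on, as one-sided smoothness at l requires.\<close>
  have \<rho>_right: "\<rho> t = r2 (1 / (1 - l) * t + - (l / (1 - l)))" if "l \<le> t" for t
  proof (cases "t = l")
    case True
    have "1 / (1 - l) * l + - (l / (1 - l)) = 0" "1 / l * l + 0 = 1" using l by simp_all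
    with True show ?thesis unfolding \<rho>_def by (simp only: dens1 dens2 if_True order_refl)
  qed (use that in \<open>simp add: \<rho>_def\<close>)
  have ps: "piecewise_smooth T (\<lambda>t. \<rho> t x)" if x: "x \<in> X" for x
  proof -
    have P1: "finite T1" "{0, 1} \<subseteq> T1" "T1 \<subseteq> {0..1}" and P2: "finite T2" "{0, 1} \<subseteq> T2" "T2 \<subseteq> {0..1}"
      and S1: "\<And>a b. a \<in> T1 \<Longrightarrow> b \<in> T1 \<Longrightarrow> a < b \<Longrightarrow> {a<..<b} \<inter> T1 = {} \<Longrightarrow> smooth_on_Icc (\<lambda>t. r1 t x) a b"
      and S2: "\<And>a b. a \<in> T2 \<Longrightarrow> b \<in> T2 \<Longrightarrow> a < b \<Longrightarrow> {a<..<b} \<inter> T2 = {} \<Longrightarrow> smooth_on_Icc (\<lambda>t. r2 t x) a b"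
      using T1 T2 x unfolding piecewise_smooth_def by simp_all
    have "l * 0 \<in> T" "l * 1 \<in> T" "l + (1 - l) * 1 \<in> T"
      unfolding T_def using P1(2) P2(2) by blast+
    then have TT: "0 \<in> T" "1 \<in> T" "l \<in> T" by simp_all
    have bound1: "l * s \<in> {0..l}" if "s \<in> T1" for s
    proof -
      have "s \<in> {0..1}" using P1(3) that by blast
      then have "l * s \<le> l * 1" "0 \<le> l * s"
        using l by (intro mult_left_mono mult_nonneg_nonneg, auto)
      then show ?thesis by simp
    qed
    have bound2: "l + (1 - l) * s \<in> {l..1}" if "s \<in> T2" for s
    proof -
      have "s \<in> {0..1}" using P2(3) that by blast
      then have "(1 - l) * s \<le> (1 - l) * 1" "0 \<le> (1 - l) * s"
        using l by (intro mult_left_mono mult_nonneg_nonneg, auto)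
      then show ?thesis by simp
    qed
    have T01: "T \<subseteq> {0..1}"
    proof
      fix t assume "t \<in> T"
      then consider s where "s \<in> T1" "t = l * s" | s where "s \<in> T2" "t = l + (1 - l) * s"
        unfolding T_def by blast
      then show "t \<in> {0..1}"
      proof cases
        case 1
        then have "l * s \<in> {0..l}" by (intro bound1)
        with 1(2) l show ?thesis unfolding atLeastAtMost_iff by linarith
      next
        case 2
        with bound2[of s] l show ?thesis by simp
      qed
    qed
    have inT1: "\<exists>s\<in>T1. t = l * s" if "t \<in> T" "t < l" for t
      using that bound2 unfolding T_def by fastforce
    have inT2: "\<exists>s\<in>T2. t = l + (1 - l) * s" if "t \<in> T" "l < t" for t
      using that bound1 unfolding T_def by fastforce
    have inT1': "1 / l * t + 0 \<in> T1" if t: "t \<in> T" "t \<le> l" for t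
    proof (cases "t = l")
      case True
      then show ?thesis using P1(2) l by simp
    next
      case False
      with t inT1[of t] obtain s where "s \<in> T1" "t = l * s" by auto
      then show ?thesis using scale1 by simp
    qed
    have inT2': "1 / (1 - l) * t + - (l / (1 - l)) \<in> T2" if t: "t \<in> T" "l \<le> t" for t
    proof (cases "t = l")
      case True
      then show ?thesis using P2(2) l by simp
    next
      case False
      with t inT2[of t] obtain s where "s \<in> T2" "t = l + (1 - l) * s" by auto
      then show ?thesis using scale2 by simp
    qed
    have "smooth_on_Icc (\<lambda>t. \<rho> t x) a b" if ab: "a \<in> T" "b \<in> T" "a < b" "{a<..<b} \<inter> T = {}" for a b
    proof (cases "b \<le> l")
      case True
      let ?f = "\<lambda>t. 1 / l * t + 0"
      have "{?f a<..<?f b} \<inter> T1 = {}"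
      proof (rule ccontr)
        assume "\<not> ?thesis"
        then obtain s where s: "s \<in> T1" "?f a < s" "s < ?f b" by auto
        then have "l * s \<in> {a<..<b}" using l by (simp add: field_simps)
        moreover have "l * s \<in> T" unfolding T_def using s(1) by blast
        ultimately show False using ab(4) by blast
      qed
      then have "smooth_on_Icc (\<lambda>t. r1 t x) (?f a) (?f b)"
        using ab True l by (intro S1 inT1') (auto simp: divide_strict_right_mono)
      then have "smooth_on_Icc (\<lambda>t. r1 (?f t) x) a b"
        by (rule smooth_on_Icc_affine) (use l in \<open>simp add: divide_right_mono\<close>)
      then show ?thesis
        by (rule smooth_on_Icc_cong) (use True in \<open>simp add: \<rho>_def\<close>)
    next
      case False
      have "l \<le> a"
      proof (rule ccontr)
        assume "\<not> l \<le> a"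
        with False have "l \<in> {a<..<b} \<inter> T" using TT by simp
        with ab show False by blast
      qed
      let ?f = "\<lambda>t. 1 / (1 - l) * t + - (l / (1 - l))"
      have "{?f a<..<?f b} \<inter> T2 = {}"
      proof (rule ccontr)
        assume "\<not> ?thesis"
        then obtain s where s: "s \<in> T2" "?f a < s" "s < ?f b" by auto
        have "(1 - l) * ?f a < (1 - l) * s" "(1 - l) * s < (1 - l) * ?f b"
          using s l by (intro mult_strict_left_mono, auto)+
        then have "l + (1 - l) * s \<in> {a<..<b}" using scale2'[of a] scale2'[of b] by simp
        moreover have "l + (1 - l) * s \<in> T" unfolding T_def using s(1) by blast
        ultimately show False using ab(4) by blast
      qed
      then have "smooth_on_Icc (\<lambda>t. r2 t x) (?f a) (?f b)"
        using ab False \<open>l \<le> a\<close> l by (intro S2 inT2') (auto simp: divide_strict_right_mono)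
      then have "smooth_on_Icc (\<lambda>t. r2 (?f t) x) a b"
        by (rule smooth_on_Icc_affine) (use l in \<open>simp add: divide_right_mono\<close>)
      then show ?thesis
        by (rule smooth_on_Icc_cong) (use \<open>l \<le> a\<close> \<rho>_right in simp)
    qed
    moreover have "finite T" using P1 P2 by (simp add: T_def)
    ultimately show ?thesis using TT T01 unfolding piecewise_smooth_def by simp
  qed
  have CE: "\<exists>d. ((\<lambda>s. \<rho> s x) has_real_derivative d) (at t) \<and>
      d + (\<Sum>y\<in>X. (\<psi> t y - \<psi> t x) * log_mean (\<rho> t x) (\<rho> t y) * Q x y) = 0"
    if t: "t \<in> {0..1} - T" and x: "x \<in> X" for t x
  proof -
    have "1 \<in> T1" using T1 x unfolding piecewise_smooth_def by blast
    then have "l \<in> T" unfolding T_def by (intro UnI1 image_eqI[of _ _ 1]) auto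
    with t have "t \<noteq> l" by blast
    then consider "t < l" | "l < t" by linarith
    then show ?thesis
    proof cases
      case 1
      let ?s = "1 / l * t + 0"
      have "?s \<notin> T1" using t scale1(2)[of t] unfolding T_def by (metis DiffD2 UnI1 image_eqI)
      moreover have "?s \<in> {0..1}" using mono1 1 t by simp
      ultimately obtain d where d: "((\<lambda>s. r1 s x) has_real_derivative d) (at ?s)"
        "d + (\<Sum>y\<in>X. (p1 ?s y - p1 ?s x) * log_mean (r1 ?s x) (r1 ?s y) * Q x y) = 0"
        using CE1 x by blast
      have "((\<lambda>s. 1 / l * s + 0) has_real_derivative 1 / l) (at t)"
        using l by (auto intro!: derivative_eq_intros)
      from DERIV_chain2[OF d(1) this]
      have "((\<lambda>s. r1 (1 / l * s + 0) x) has_real_derivative d * (1 / l)) (at t)" .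
      then have "((\<lambda>s. \<rho> s x) has_real_derivative d * (1 / l)) (at t)"
        by (rule has_field_derivative_transform_within_open[of _ _ _ "{..<l}"])
          (use 1 in \<open>auto simp: \<rho>_def\<close>)
      moreover have "d * (1 / l) + (\<Sum>y\<in>X. (\<psi> t y - \<psi> t x) * log_mean (\<rho> t x) (\<rho> t y) * Q x y)
          = 1 / l * (d + (\<Sum>y\<in>X. (p1 ?s y - p1 ?s x) * log_mean (r1 ?s x) (r1 ?s y) * Q x y))"
        using 1 unfolding \<rho>_def \<psi>_def distrib_left sum_distrib_left
        by (intro arg_cong2[of _ _ _ _ "(+)"] sum.cong) (simp_all add: right_diff_distrib left_diff_distrib)
      ultimately show ?thesis using d(2) by (intro exI[of _ "d * (1 / l)"]) simp
    next
      case 2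
      let ?s = "1 / (1 - l) * t + - (l / (1 - l))"
      have "?s \<notin> T2" using t scale2'[of t] unfolding T_def by (metis DiffD2 UnI2 image_eqI)
      moreover have "?s \<in> {0..1}" using mono2 2 t by simp
      ultimately obtain d where d: "((\<lambda>s. r2 s x) has_real_derivative d) (at ?s)"
        "d + (\<Sum>y\<in>X. (p2 ?s y - p2 ?s x) * log_mean (r2 ?s x) (r2 ?s y) * Q x y) = 0"
        using CE2 x by blast
      have "((\<lambda>s. 1 / (1 - l) * s + - (l / (1 - l))) has_real_derivative 1 / (1 - l)) (at t)"
        using l by (auto intro!: derivative_eq_intros)
      from DERIV_chain2[OF d(1) this]
      have "((\<lambda>s. r2 (1 / (1 - l) * s + - (l / (1 - l))) x) has_real_derivative d * (1 / (1 - l))) (at t)" .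
      then have "((\<lambda>s. \<rho> s x) has_real_derivative d * (1 / (1 - l))) (at t)"
        by (rule has_field_derivative_transform_within_open[of _ _ _ "{l<..}"])
          (use 2 in \<open>auto simp: \<rho>_def\<close>)
      moreover have "d * (1 / (1 - l)) + (\<Sum>y\<in>X. (\<psi> t y - \<psi> t x) * log_mean (\<rho> t x) (\<rho> t y) * Q x y)
          = 1 / (1 - l) * (d + (\<Sum>y\<in>X. (p2 ?s y - p2 ?s x) * log_mean (r2 ?s x) (r2 ?s y) * Q x y))"
        using 2 unfolding \<rho>_def \<psi>_def distrib_left sum_distrib_left
        by (intro arg_cong2[of _ _ _ _ "(+)"] sum.cong) (simp_all add: right_diff_distrib left_diff_distrib)
      ultimately show ?thesis using d(2) by (intro exI[of _ "d * (1 / (1 - l))"]) simp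
    qed
  qed
  have "transport_curve X Q \<pi> \<rho>\<^sub>0 \<rho>\<^sub>2 \<rho> \<psi>"
    unfolding transport_curve_def
  proof (intro conjI ballI exI[of _ T])
    fix t :: real assume t: "t \<in> {0..1}"
    show "\<rho> t \<in> densities X \<pi>"
    proof (cases "t \<le> l")
      case True
      then have "1 / l * t + 0 \<in> {0..1}" unfolding mono1 using t by simp
      then show ?thesis using True dens1(1) by (simp only: \<rho>_def if_True)
    next
      case False
      then have "1 / (1 - l) * t + - (l / (1 - l)) \<in> {0..1}" unfolding mono2 using t by simp
      then show ?thesis using False dens2(1) by (simp only: \<rho>_def if_False)
    qed
  next
    show "\<rho> 0 = \<rho>\<^sub>0" using l dens1 by (simp add: \<rho>_def)
    have "1 / (1 - l) * 1 + - (l / (1 - l)) = 1" using l by (simp add: divide_simps)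
    then show "\<rho> 1 = \<rho>\<^sub>2" using l dens2 \<rho>_right[of 1] by simp
  next
    fix x assume "x \<in> X"
    then show "piecewise_smooth T (\<lambda>t. \<rho> t x)" by (rule ps)
  next
    fix t x assume "t \<in> {0..1} - T" "x \<in> X"
    then show "\<exists>d. ((\<lambda>s. \<rho> s x) has_real_derivative d) (at t) \<and>
      d + (\<Sum>y\<in>X. (\<psi> t y - \<psi> t x) * log_mean (\<rho> t x) (\<rho> t y) * Q x y) = 0" by (rule CE)
  qed
  moreover have "((\<lambda>t. grad_form X Q \<pi> (\<rho> t) (\<psi> t) (\<psi> t)) has_integral (I1 / l + I2 / (1 - l))) {0..1}"
  proof (rule has_integral_combine[of 0 l 1])
    have "((\<lambda>t. grad_form X Q \<pi> (r1 ((1 / l) *\<^sub>R t + 0)) (p1 ((1 / l) *\<^sub>R t + 0)) (p1 ((1 / l) *\<^sub>R t + 0)))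
        has_integral I1 /\<^sub>R (1 / l) ^ DIM(real)) (cbox ((0 - 0) /\<^sub>R (1 / l)) ((1 - 0) /\<^sub>R (1 / l)))"
      by (rule has_integral_affinity'[where f = "\<lambda>t. grad_form X Q \<pi> (r1 t) (p1 t) (p1 t)"])
        (use int1 l in auto)
    then have "((\<lambda>t. grad_form X Q \<pi> (r1 (1 / l * t + 0)) (p1 (1 / l * t + 0)) (p1 (1 / l * t + 0)))
        has_integral l * I1) {0..l}"
      using l by (simp add: mult.commute)
    from has_integral_mult_right[OF this, of "(1 / l)\<^sup>2"]
    have "((\<lambda>t. (1 / l)\<^sup>2 * grad_form X Q \<pi> (r1 (1 / l * t + 0)) (p1 (1 / l * t + 0)) (p1 (1 / l * t + 0)))
        has_integral I1 / l) {0..l}"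
      using l by (simp add: power2_eq_square)
    then show "((\<lambda>t. grad_form X Q \<pi> (\<rho> t) (\<psi> t) (\<psi> t)) has_integral (I1 / l)) {0..l}"
      by (rule has_integral_eq[rotated]) (simp add: \<rho>_def \<psi>_def flip: grad_form_scale)
    let ?d = "- (l / (1 - l))"
    have "((\<lambda>t. grad_form X Q \<pi> (r2 ((1 / (1 - l)) *\<^sub>R t + ?d)) (p2 ((1 / (1 - l)) *\<^sub>R t + ?d)) (p2 ((1 / (1 - l)) *\<^sub>R t + ?d)))
        has_integral I2 /\<^sub>R (1 / (1 - l)) ^ DIM(real))
        (cbox ((0 - ?d) /\<^sub>R (1 / (1 - l))) ((1 - ?d) /\<^sub>R (1 / (1 - l))))"
      by (rule has_integral_affinity'[where f = "\<lambda>t. grad_form X Q \<pi> (r2 t) (p2 t) (p2 t)"])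
        (use int2 l in auto)
    moreover have "(0 - ?d) /\<^sub>R (1 / (1 - l)) = l" "(1 - ?d) /\<^sub>R (1 / (1 - l)) = 1"
      "I2 /\<^sub>R (1 / (1 - l)) ^ DIM(real) = (1 - l) * I2"
      using l by (simp_all add: field_simps)
    ultimately have "((\<lambda>t. grad_form X Q \<pi> (r2 (1 / (1 - l) * t + ?d)) (p2 (1 / (1 - l) * t + ?d))
        (p2 (1 / (1 - l) * t + ?d))) has_integral (1 - l) * I2) {l..1}"
      by (simp only: real_scaleR_def box_real)
    from has_integral_mult_right[OF this, of "(1 / (1 - l))\<^sup>2"]
    have "((\<lambda>t. (1 / (1 - l))\<^sup>2 * grad_form X Q \<pi> (r2 (1 / (1 - l) * t + ?d)) (p2 (1 / (1 - l) * t + ?d))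
        (p2 (1 / (1 - l) * t + ?d))) has_integral I2 / (1 - l)) {l..1}"
      using l by (simp add: power2_eq_square)
    \<comment> \<open>At l itself \<psi> still follows the left formula; this single time does not
      affect the integral.\<close>
    then show "((\<lambda>t. grad_form X Q \<pi> (\<rho> t) (\<psi> t) (\<psi> t)) has_integral (I2 / (1 - l))) {l..1}"
    proof (rule has_integral_spike_finite[rotated 2, where S = "{l}"])
      fix t assume "t \<in> {l..1} - {l}"
      then have "(t \<le> l) = False" by auto
      then show "grad_form X Q \<pi> (\<rho> t) (\<psi> t) (\<psi> t) = (1 / (1 - l))\<^sup>2 *
          grad_form X Q \<pi> (r2 (1 / (1 - l) * t + ?d)) (p2 (1 / (1 - l) * t + ?d)) (p2 (1 / (1 - l) * t + ?d))"
        by (simp only: \<rho>_def \<psi>_def if_False grad_form_scale)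
    qed simp
  qed (use l in auto)
  ultimately show ?thesis unfolding admissible_cost_def by (intro exI conjI)
qed

text \<open>Takes the place of the triangle inequality: it relates squared distances directly, and
  the best ratio l would give the triangle inequality back.\<close>

lemma transport_cost_concat:
  assumes markov: "markov_triple X Q \<pi>" and l: "0 < l" "l < 1"
    and fin: "transport_cost X Q \<pi> \<rho>\<^sub>0 \<rho>\<^sub>1 \<noteq> \<infinity>" "transport_cost X Q \<pi> \<rho>\<^sub>1 \<rho>\<^sub>2 \<noteq> \<infinity>"
  shows "enn2real (transport_cost X Q \<pi> \<rho>\<^sub>0 \<rho>\<^sub>2) \<le>
    enn2real (transport_cost X Q \<pi> \<rho>\<^sub>0 \<rho>\<^sub>1) / l + enn2real (transport_cost X Q \<pi> \<rho>\<^sub>1 \<rho>\<^sub>2) / (1 - l)"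
    (is "_ \<le> ?A / l + ?B / (1 - l)")
proof (rule field_le_epsilon)
  fix e :: real assume e: "e > 0"
  \<comment> \<open>Chosen such that e' / l + e' / (1 - l) = e.\<close>
  define e' where "e' = e * (l * (1 - l))"
  have e': "e' > 0" using e l by (simp add: e'_def)
  have approx: "\<exists>I. 0 \<le> I \<and> I < enn2real C + e' \<and> admissible_cost X Q \<pi> \<mu> \<nu> I"
    if "C = transport_cost X Q \<pi> \<mu> \<nu>" "C \<noteq> \<infinity>" for C \<mu> \<nu>
  proof -
    have "transport_cost X Q \<pi> \<mu> \<nu> < ennreal (enn2real C + e')"
    proof -
      have "C = ennreal (enn2real C)" using that by (simp add: less_top)
      also have "\<dots> < ennreal (enn2real C + e')" using e' by (simp add: ennreal_less_iff)
      finally show ?thesis using that by simp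
    qed
    then show ?thesis by (rule transport_cost_less_admissible[OF markov])
  qed
  obtain I1 where I1: "0 \<le> I1" "I1 < ?A + e'" "admissible_cost X Q \<pi> \<rho>\<^sub>0 \<rho>\<^sub>1 I1"
    using approx[OF refl fin(1)] by blast
  obtain I2 where I2: "0 \<le> I2" "I2 < ?B + e'" "admissible_cost X Q \<pi> \<rho>\<^sub>1 \<rho>\<^sub>2 I2"
    using approx[OF refl fin(2)] by blast
  have "transport_cost X Q \<pi> \<rho>\<^sub>0 \<rho>\<^sub>2 \<le> ennreal (I1 / l + I2 / (1 - l))"
    using admissible_cost_concat[OF I1(3) I2(3) l] by (rule transport_cost_le_admissible[OF markov])
  then have "enn2real (transport_cost X Q \<pi> \<rho>\<^sub>0 \<rho>\<^sub>2) \<le> I1 / l + I2 / (1 - l)"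
    using I1 I2 l by (intro enn2real_leI) auto
  also have "\<dots> \<le> (?A + e') / l + (?B + e') / (1 - l)"
    using I1 I2 l by (intro add_mono divide_right_mono) auto
  also have "\<dots> = ?A / l + ?B / (1 - l) + (e' / l + e' / (1 - l))"
    by (simp add: add_divide_distrib)
  also have "e' / l + e' / (1 - l) = e"
    using l by (simp add: e'_def field_simps)
  finally show "enn2real (transport_cost X Q \<pi> \<rho>\<^sub>0 \<rho>\<^sub>2) \<le> ?A / l + ?B / (1 - l) + e" .
qed

section \<open>The heat kernel of an involutive random walk\<close>

text \<open>The features of transpositions behind the bound: conjugation invariance lets left
  translations permute the edges, involutivity makes the rates symmetric and lets a translation
  reverse an edge, and generation gives irreducibility. Generation is phrased as an induction rule
  that appends factors on the right.\<close>

locale involution_walk =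
  fixes G D :: "('a \<Rightarrow> 'a) set" and q :: real
  assumes finite_G: "finite G" and id_in: "id \<in> G"
    and comp_in: "g \<in> G \<Longrightarrow> h \<in> G \<Longrightarrow> g \<circ> h \<in> G"
    and inv_in: "g \<in> G \<Longrightarrow> inv g \<in> G" and bij: "g \<in> G \<Longrightarrow> bij g"
    and D_subset: "D \<subseteq> G" and involution: "\<tau> \<in> D \<Longrightarrow> \<tau> \<circ> \<tau> = id" and id_notin: "id \<notin> D"
    and conj_in: "g \<in> G \<Longrightarrow> \<tau> \<in> D \<Longrightarrow> g \<circ> \<tau> \<circ> inv g \<in> D"
    and generated: "g \<in> G \<Longrightarrow> P id \<Longrightarrow> (\<And>g \<tau>. g \<in> G \<Longrightarrow> \<tau> \<in> D \<Longrightarrow> P g \<Longrightarrow> P (g \<circ> \<tau>)) \<Longrightarrow> P g"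
    and rate_pos: "q > 0"
begin

definition rate :: "('a \<Rightarrow> 'a) \<Rightarrow> ('a \<Rightarrow> 'a) \<Rightarrow> real" where
  "rate x y = (if \<exists>\<tau>\<in>D. y = \<tau> \<circ> x then q else 0)"

definition unif :: "('a \<Rightarrow> 'a) \<Rightarrow> real" where
  "unif x = 1 / real (card G)"

lemma D_in: "\<tau> \<in> D \<Longrightarrow> \<tau> \<in> G"
  using D_subset by blast

lemma finite_D: "finite D"
  using D_subset finite_G by (rule finite_subset)

lemma card_pos: "0 < real (card G)"
  using finite_G id_in by (auto simp: card_gt_0_iff)

lemma unif_pos: "0 < unif x"
  using card_pos by (simp add: unif_def)

lemma inv_comp: "g \<in> G \<Longrightarrow> inv g \<circ> g = id" "g \<in> G \<Longrightarrow> g \<circ> inv g = id"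
  using bij[of g] bij_is_surj[of g] by (simp_all add: bij_is_inj inv_o_cancel flip: surj_iff)

lemma inv_comp_assoc: "g \<in> G \<Longrightarrow> inv g \<circ> (g \<circ> x) = x" "g \<in> G \<Longrightarrow> g \<circ> (inv g \<circ> x) = x"
  by (simp_all add: inv_comp flip: comp_assoc)

lemma inv_inv: "g \<in> G \<Longrightarrow> inv (inv g) = g"
  using bij by (rule inv_inv_eq)

lemma inv_involution: "\<tau> \<in> D \<Longrightarrow> inv \<tau> = \<tau>"
  using involution inv_comp_assoc(1)[OF D_in, of \<tau> \<tau>] by simp

lemma involution_assoc: "\<tau> \<in> D \<Longrightarrow> \<tau> \<circ> (\<tau> \<circ> x) = x"
  by (simp add: involution flip: comp_assoc)

lemma bij_betw_left: "g \<in> G \<Longrightarrow> bij_betw (\<lambda>x. g \<circ> x) G G"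
  by (rule bij_betwI[where g = "\<lambda>x. inv g \<circ> x"]) (auto simp: comp_in inv_in inv_comp_assoc)

lemma bij_betw_right_involution: "\<tau> \<in> D \<Longrightarrow> bij_betw (\<lambda>x. x \<circ> \<tau>) G G"
  by (rule bij_betwI[where g = "\<lambda>x. x \<circ> \<tau>"]) (auto simp: comp_in D_in comp_assoc involution)

lemma bij_betw_conj: "g \<in> G \<Longrightarrow> bij_betw (\<lambda>\<tau>. g \<circ> \<tau> \<circ> inv g) D D"
proof (rule bij_betwI[where g = "\<lambda>\<tau>. inv g \<circ> \<tau> \<circ> g"])
  assume g: "g \<in> G"
  then show "(\<lambda>\<tau>. g \<circ> \<tau> \<circ> inv g) \<in> D \<rightarrow> D" by (auto intro: conj_in)
  show "(\<lambda>\<tau>. inv g \<circ> \<tau> \<circ> g) \<in> D \<rightarrow> D"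
    using g conj_in[OF inv_in[OF g]] by (auto simp: inv_inv)
  show "inv g \<circ> (g \<circ> \<tau> \<circ> inv g) \<circ> g = \<tau>" for \<tau>
    using g by (simp add: comp_assoc inv_comp_assoc inv_comp)
  show "g \<circ> (inv g \<circ> \<tau> \<circ> g) \<circ> inv g = \<tau>" for \<tau>
    using g by (simp add: comp_assoc inv_comp_assoc inv_comp)
qed

lemma sum_left: "g \<in> G \<Longrightarrow> (\<Sum>x\<in>G. f (g \<circ> x)) = (\<Sum>x\<in>G. f x)"
  by (rule sum.reindex_bij_betw[OF bij_betw_left])

lemma sum_right: "\<tau> \<in> D \<Longrightarrow> (\<Sum>x\<in>G. f (x \<circ> \<tau>)) = (\<Sum>x\<in>G. f x)"
  by (rule sum.reindex_bij_betw[OF bij_betw_right_involution])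

lemma comp_right_cancel: "x \<in> G \<Longrightarrow> \<tau> \<circ> x = \<tau>' \<circ> x \<Longrightarrow> \<tau> = \<tau>'"
  by (metis comp_assoc comp_id inv_comp(2))

lemma sum_rate:
  assumes x: "x \<in> G"
  shows "(\<Sum>y\<in>G. f y * rate x y) = q * (\<Sum>\<tau>\<in>D. f (\<tau> \<circ> x))"
proof -
  have "(\<Sum>y\<in>G. f y * rate x y) = (\<Sum>y\<in>(\<lambda>\<tau>. \<tau> \<circ> x) ` D. f y * rate x y)"
    using x finite_G by (intro sum.mono_neutral_right) (auto simp: rate_def comp_in D_in)
  also have "\<dots> = (\<Sum>\<tau>\<in>D. f (\<tau> \<circ> x) * rate x (\<tau> \<circ> x))"
    using comp_right_cancel[OF x] by (subst sum.reindex) (auto simp: inj_on_def)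
  also have "\<dots> = (\<Sum>\<tau>\<in>D. q * f (\<tau> \<circ> x))"
    by (intro sum.cong) (auto simp: rate_def)
  finally show ?thesis by (simp add: sum_distrib_left)
qed

lemma rate_commute: "rate x y = rate y x"
proof -
  have "\<exists>\<tau>\<in>D. x = \<tau> \<circ> y" if "\<exists>\<tau>\<in>D. y = \<tau> \<circ> x" for x y
    using that by (metis involution_assoc)
  then show ?thesis unfolding rate_def by metis
qed

lemma rate_self: "x \<in> G \<Longrightarrow> rate x x = 0"
  using comp_right_cancel[of x _ id] id_notin unfolding rate_def by (metis id_comp)

lemma markov: "markov_triple G rate unif"
proof -
  have "0 \<le> rate x y" for x y using rate_pos by (simp add: rate_def)
  then show ?thesis
    using finite_G id_in card_pos rate_commute rate_self unfolding markov_triple_def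
    by (auto simp: unif_def)
qed

abbreviation "form \<equiv> grad_form G rate unif"

lemma form_eq:
  "form \<rho> \<xi> \<psi> = q / (2 * real (card G)) * (\<Sum>x\<in>G. \<Sum>\<tau>\<in>D.
    (\<xi> x - \<xi> (\<tau> \<circ> x)) * (\<psi> x - \<psi> (\<tau> \<circ> x)) * log_mean (\<rho> x) (\<rho> (\<tau> \<circ> x)))"
proof -
  have "(\<Sum>y\<in>G. (\<xi> x - \<xi> y) * (\<psi> x - \<psi> y) * log_mean (\<rho> x) (\<rho> y) * rate x y * unif x)
    = q / real (card G) * (\<Sum>\<tau>\<in>D. (\<xi> x - \<xi> (\<tau> \<circ> x)) * (\<psi> x - \<psi> (\<tau> \<circ> x)) * log_mean (\<rho> x) (\<rho> (\<tau> \<circ> x)))"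
    if "x \<in> G" for x
    unfolding sum_distrib_right[symmetric] sum_rate[OF that] by (simp add: unif_def)
  then show ?thesis by (simp add: grad_form_def flip: sum_distrib_left sum_divide_distrib)
qed

lemma form_density_cong:
  "(\<And>x. x \<in> G \<Longrightarrow> \<rho> x = \<rho>' x) \<Longrightarrow> form \<rho> \<xi> \<psi> = form \<rho>' \<xi> \<psi>"
  unfolding grad_form_def by (intro arg_cong2[of _ _ _ _ "(*)"] sum.cong refl) auto

lemma form_zero_constant:
  assumes pos: "\<And>x. x \<in> G \<Longrightarrow> 0 < \<rho> x" and zero: "form \<rho> \<xi> \<xi> = 0" and "x \<in> G" "y \<in> G"
  shows "\<xi> x = \<xi> y"
proof -
  have "(\<Sum>x\<in>G. \<Sum>\<tau>\<in>D. (\<xi> x - \<xi> (\<tau> \<circ> x)) * (\<xi> x - \<xi> (\<tau> \<circ> x)) * log_mean (\<rho> x) (\<rho> (\<tau> \<circ> x))) = 0"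
    using zero rate_pos card_pos unfolding form_eq by simp
  then have "\<forall>x\<in>G. \<forall>\<tau>\<in>D. (\<xi> x - \<xi> (\<tau> \<circ> x)) * (\<xi> x - \<xi> (\<tau> \<circ> x)) * log_mean (\<rho> x) (\<rho> (\<tau> \<circ> x)) = 0"
    using finite_G finite_D
    by (subst (asm) sum_nonneg_eq_0_iff; (subst (asm) sum_nonneg_eq_0_iff)?)
      (auto simp: log_mean_nonneg intro!: sum_nonneg)
  then have step: "\<xi> (\<tau> \<circ> x) = \<xi> x" if "x \<in> G" "\<tau> \<in> D" for x \<tau>
    using that log_mean_pos[of "\<rho> x" "\<rho> (\<tau> \<circ> x)"] pos[of x] pos[of "\<tau> \<circ> x"]
    by (fastforce simp: comp_in D_in)
  have "\<xi> g = \<xi> id" if "g \<in> G" for g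
    using that
  proof (rule generated)
    fix g \<tau> assume *: "g \<in> G" "\<tau> \<in> D" "\<xi> g = \<xi> id"
    \<comment> \<open>The induction appends \<tau> on the right, whereas edges multiply on the left;
      conjugation by g turns one into the other.\<close>
    have "g \<circ> \<tau> = (g \<circ> \<tau> \<circ> inv g) \<circ> g"
      using * by (simp add: comp_assoc inv_comp)
    with step[OF *(1) conj_in[OF *(1,2)]] * show "\<xi> (g \<circ> \<tau>) = \<xi> id" by simp
  qed simp
  with assms show ?thesis by simp
qed

lemma continuity_solvable:
  assumes "\<And>x. x \<in> G \<Longrightarrow> 0 < \<rho> x" and "(\<Sum>x\<in>G. unif x * v x) = 0"
  shows "\<exists>\<psi>. \<forall>x\<in>G. v x + (\<Sum>y\<in>G. (\<psi> y - \<psi> x) * log_mean (\<rho> x) (\<rho> y) * rate x y) = 0"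
proof (rule continuity_equation_solvable[OF markov unif_pos _ assms(2)])
  fix \<xi> x y assume "form \<rho> \<xi> \<xi> = 0" "x \<in> G" "y \<in> G"
  then show "\<xi> x = \<xi> y" using form_zero_constant[of \<rho> \<xi> x y] assms(1) by simp
qed

section \<open>The heat kernel as a Poisson series over words in D\<close>

primrec walk :: "nat \<Rightarrow> ('a \<Rightarrow> 'a) \<Rightarrow> real" where
  "walk 0 g = (if g = id then 1 else 0)"
| "walk (Suc k) g = q * (\<Sum>\<tau>\<in>D. walk k (g \<circ> \<tau>))"

definition exit_rate :: real where "exit_rate = q * real (card D)"

text \<open>\<open>walk k g\<close> is q^k times the number of words of length k over D with product
  g. The series is therefore the law at time t of the walk started at the identity. It is written
  out because its terms are nonnegative, so that single terms are lower bounds.\<close>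

definition kern :: "real \<Rightarrow> ('a \<Rightarrow> 'a) \<Rightarrow> real" where
  "kern t g = exp (- exit_rate * t) * (\<Sum>k. walk k g / fact k * t ^ k)"

lemma exit_rate_nonneg: "0 \<le> exit_rate"
  using rate_pos by (simp add: exit_rate_def)

lemma walk_nonneg: "0 \<le> walk k g"
  using rate_pos by (induction k arbitrary: g) (auto intro!: sum_nonneg mult_nonneg_nonneg)

lemma sum_walk: "(\<Sum>g\<in>G. walk k g) = exit_rate ^ k"
proof (induction k)
  case 0
  show ?case using finite_G id_in by simp
next
  case (Suc k)
  have "(\<Sum>g\<in>G. walk (Suc k) g) = q * (\<Sum>\<tau>\<in>D. \<Sum>g\<in>G. walk k (g \<circ> \<tau>))"
    by (subst sum.swap) (simp add: sum_distrib_left)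
  also have "\<dots> = q * (\<Sum>\<tau>\<in>D. exit_rate ^ k)"
    using Suc by (simp add: sum_right)
  finally show ?case by (simp add: exit_rate_def)
qed

lemma walk_le: "g \<in> G \<Longrightarrow> walk k g \<le> exit_rate ^ k"
  using member_le_sum[of g G "walk k"] finite_G by (simp add: walk_nonneg sum_walk)

lemma summable_walk: "g \<in> G \<Longrightarrow> summable (\<lambda>k. walk k g / fact k * t ^ k)"
proof (rule summable_comparison_test'[where N = 0])
  show "summable (\<lambda>k. (exit_rate * \<bar>t\<bar>) ^ k / fact k)"
    using summable_exp_generic[of "exit_rate * \<bar>t\<bar>"] by (simp add: divide_inverse mult.commute)
  fix k assume "g \<in> G"
  then show "norm (walk k g / fact k * t ^ k) \<le> (exit_rate * \<bar>t\<bar>) ^ k / fact k"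
    using walk_le[of g k] walk_nonneg[of k g]
    by (simp add: abs_mult power_abs power_mult_distrib divide_right_mono mult_right_mono)
qed

lemma kern_has_derivative:
  assumes g: "g \<in> G"
  shows "((\<lambda>t. kern t g) has_real_derivative
    q * (\<Sum>\<tau>\<in>D. kern t (g \<circ> \<tau>)) - exit_rate * kern t g) (at t within S)"
proof -
  let ?F = "\<lambda>g t. \<Sum>k. walk k g / fact k * t ^ k"
  have "diffs (\<lambda>k. walk k g / fact k) = (\<lambda>k. q * (\<Sum>\<tau>\<in>D. walk k (g \<circ> \<tau>) / fact k))"
    by (rule ext) (simp add: diffs_def divide_simps flip: sum_divide_distrib)
  then have "(\<Sum>k. diffs (\<lambda>k. walk k g / fact k) k * t ^ k)
      = (\<Sum>k. q * (\<Sum>\<tau>\<in>D. walk k (g \<circ> \<tau>) / fact k * t ^ k))"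
    by (simp add: mult.assoc sum_distrib_right)
  also have "\<dots> = q * (\<Sum>k. \<Sum>\<tau>\<in>D. walk k (g \<circ> \<tau>) / fact k * t ^ k)"
    by (intro suminf_mult summable_sum summable_walk comp_in g D_in)
  also have "(\<Sum>k. \<Sum>\<tau>\<in>D. walk k (g \<circ> \<tau>) / fact k * t ^ k) = (\<Sum>\<tau>\<in>D. ?F (g \<circ> \<tau>) t)"
    by (intro suminf_sum summable_walk comp_in g D_in)
  finally have "(?F g has_real_derivative q * (\<Sum>\<tau>\<in>D. ?F (g \<circ> \<tau>) t)) (at t)"
    using termdiffs_strong_converges_everywhere[OF summable_walk[OF g], of t] by simp
  then have F: "(?F g has_real_derivative q * (\<Sum>\<tau>\<in>D. ?F (g \<circ> \<tau>) t)) (at t within S)"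
    by (rule has_field_derivative_at_within)
  have "((\<lambda>t. exp (- exit_rate * t)) has_real_derivative exp (- exit_rate * t) * (- exit_rate)) (at t within S)"
    by (auto intro!: derivative_eq_intros)
  from DERIV_mult[OF this F] show ?thesis
    unfolding kern_def by (simp add: sum_distrib_left algebra_simps)
qed

lemma smooth_on_Icc_kern:
  assumes "g \<in> G"
  shows "smooth_on_Icc (\<lambda>t. kern t g) a b"
proof -
  \<comment> \<open>\<open>nu k\<close> is the k-th power of the generator applied to the kernel,
    hence by the Kolmogorov equation its k-th time derivative.\<close>
  define nu where "nu = rec_nat kern (\<lambda>_ f t g. q * (\<Sum>\<tau>\<in>D. f t (g \<circ> \<tau>)) - exit_rate * f t g)"
  have nu: "nu 0 = kern" "nu (Suc k) t g = q * (\<Sum>\<tau>\<in>D. nu k t (g \<circ> \<tau>)) - exit_rate * nu k t g"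
    for k t g by (simp_all add: nu_def)
  have "((\<lambda>t. nu k t g) has_real_derivative nu (Suc k) t g) (at t within S)" if "g \<in> G" for k t g S
    using that
  proof (induction k arbitrary: g)
    case 0
    then show ?case using kern_has_derivative[OF 0] by (simp add: nu)
  next
    case (Suc k)
    have "((\<lambda>t. q * (\<Sum>\<tau>\<in>D. nu k t (g \<circ> \<tau>)) - exit_rate * nu k t g) has_real_derivative
      q * (\<Sum>\<tau>\<in>D. nu (Suc k) t (g \<circ> \<tau>)) - exit_rate * nu (Suc k) t g) (at t within S)"
      by (intro DERIV_diff DERIV_cmult DERIV_sum Suc.IH[OF comp_in[OF Suc.prems D_in]] Suc.IH[OF Suc.prems])
    then show ?case by (simp only: nu)
  qed
  with assms show ?thesis
    unfolding smooth_on_Icc_def by (intro exI[of _ "\<lambda>k t. nu k t g"]) (simp add: nu(1))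
qed

lemma kern_0: "kern 0 g = (if g = id then 1 else 0)"
  using powser_zero[of "\<lambda>k. walk k g / fact k"] by (simp add: kern_def)

text \<open>The terms k = 0 and k = 1 give the two lower bounds that determine the constant of the
  gradient estimate; any nonzero term gives positivity.\<close>

lemma kern_ge:
  assumes "g \<in> G" "0 \<le> t"
  shows "exp (- exit_rate * t) * (walk k g / fact k * t ^ k) \<le> kern t g"
  unfolding kern_def
  using assms sum_le_suminf[OF summable_walk[OF assms(1)], of "{k}" t]
  by (intro mult_left_mono) (auto simp: walk_nonneg)

lemma kern_nonneg: "g \<in> G \<Longrightarrow> 0 \<le> t \<Longrightarrow> 0 \<le> kern t g"
  using kern_ge[of g t 0] by (smt (verit) exp_gt_zero mult_nonneg_nonneg walk_nonneg divide_nonneg_nonneg fact_ge_zero zero_le_power)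

lemma sum_kern: "(\<Sum>g\<in>G. kern t g) = 1"
proof -
  have "(\<Sum>g\<in>G. \<Sum>k. walk k g / fact k * t ^ k) = (\<Sum>k. \<Sum>g\<in>G. walk k g / fact k * t ^ k)"
    by (rule suminf_sum[symmetric]) (rule summable_walk)
  also have "\<dots> = (\<Sum>k. (exit_rate * t) ^ k /\<^sub>R fact k)"
    by (intro suminf_cong) (simp add: power_mult_distrib divide_inverse mult_ac flip: sum_distrib_left sum_distrib_right sum_walk)
  also have "\<dots> = exp (exit_rate * t)" by (simp add: exp_def)
  finally show ?thesis by (simp add: kern_def flip: sum_distrib_left exp_add)
qed

lemma kern_id_ge: "0 \<le> t \<Longrightarrow> exp (- exit_rate * t) \<le> kern t id"
  using kern_ge[OF id_in, of t 0] by simp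

lemma kern_D_ge:
  assumes "0 \<le> t" "\<tau> \<in> D"
  shows "exp (- exit_rate * t) * (q * t) \<le> kern t \<tau>"
proof -
  have "1 \<le> (\<Sum>\<tau>'\<in>D. walk 0 (\<tau> \<circ> \<tau>'))"
    using member_le_sum[of \<tau> D "\<lambda>\<tau>'. walk 0 (\<tau> \<circ> \<tau>')"] assms finite_D by (simp add: involution)
  then have "q \<le> walk 1 \<tau>" using rate_pos by simp
  then have "exp (- exit_rate * t) * (q * t) \<le> exp (- exit_rate * t) * (walk 1 \<tau> * t)"
    using assms by (intro mult_left_mono mult_right_mono) auto
  also have "\<dots> \<le> kern t \<tau>" using kern_ge[OF D_in assms(1), of \<tau> 1] assms(2) by simp
  finally show ?thesis .
qed

lemma kern_pos: "0 < kern t g" if "g \<in> G" "0 < t"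
proof -
  have "\<exists>k. 0 < walk k g" using that(1)
  proof (rule generated)
    show "\<exists>k. 0 < walk k id" by (intro exI[of _ 0]) simp
    fix g \<tau> assume *: "g \<in> G" "\<tau> \<in> D" "\<exists>k. 0 < walk k g"
    then obtain k where "0 < walk k g" by blast
    then have "0 < walk k ((g \<circ> \<tau>) \<circ> \<tau>)" using * by (simp add: comp_assoc involution)
    then have "0 < (\<Sum>\<tau>'\<in>D. walk k ((g \<circ> \<tau>) \<circ> \<tau>'))"
      using * finite_D by (intro sum_pos2[of D \<tau>]) (auto simp: walk_nonneg)
    then show "\<exists>k. 0 < walk k (g \<circ> \<tau>)" using rate_pos by (intro exI[of _ "Suc k"]) simp
  qed
  then obtain k where "0 < walk k g" by blast
  then have "0 < exp (- exit_rate * t) * (walk k g / fact k * t ^ k)" using that by simp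
  also have "\<dots> \<le> kern t g" using that by (intro kern_ge) auto
  finally show ?thesis .
qed

section \<open>The gradient estimate\<close>

definition avg :: "real \<Rightarrow> (('a \<Rightarrow> 'a) \<Rightarrow> real) \<Rightarrow> ('a \<Rightarrow> 'a) \<Rightarrow> real" where
  "avg t f x = (\<Sum>g\<in>G. kern t g * f (g \<circ> x))"

text \<open>The adjoint of \<open>avg t\<close> for the uniform measure: substituting g x for x
  turns translation by g into translation by its inverse.\<close>

definition dual_avg :: "real \<Rightarrow> (('a \<Rightarrow> 'a) \<Rightarrow> real) \<Rightarrow> ('a \<Rightarrow> 'a) \<Rightarrow> real" where
  "dual_avg t f x = (\<Sum>g\<in>G. kern t g * f (inv g \<circ> x))"

lemma sum_avg_dual: "(\<Sum>x\<in>G. unif x * \<phi> x * avg t v x) = (\<Sum>x\<in>G. unif x * dual_avg t \<phi> x * v x)"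
proof -
  have "(\<Sum>x\<in>G. unif x * \<phi> x * avg t v x) = (\<Sum>g\<in>G. \<Sum>x\<in>G. unif x * kern t g * (\<phi> (inv g \<circ> (g \<circ> x)) * v (g \<circ> x)))"
    unfolding avg_def sum_distrib_left
    by (subst sum.swap) (intro sum.cong refl, simp add: inv_comp_assoc)
  also have "\<dots> = (\<Sum>g\<in>G. \<Sum>x\<in>G. unif x * kern t g * (\<phi> (inv g \<circ> x) * v x))"
    unfolding unif_def by (intro sum.cong refl sum_left[of _ "\<lambda>x. 1 / real (card G) * kern t g * (\<phi> (inv g \<circ> x) * v x)" for g])
  also have "\<dots> = (\<Sum>x\<in>G. unif x * dual_avg t \<phi> x * v x)"
    unfolding dual_avg_def sum_distrib_left sum_distrib_right
    by (subst sum.swap) (intro sum.cong refl, simp)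
  finally show ?thesis .
qed

end

text \<open>A function that is odd under the exchange of \<open>e\<close> and \<open>d\<close> has small mean: replace the
  constant weight 1 in the Cauchy-Schwarz inequality by \<open>\<plusminus>(\<mu> e - \<mu> d) / (\<mu> e + \<mu> d)\<close> at these
  two points.\<close>

lemma odd_pair_mean_square:
  fixes \<mu> f :: "'b \<Rightarrow> real"
  assumes fin: "finite I" and ed: "e \<in> I" "d \<in> I" "e \<noteq> d" and nonneg: "\<And>i. i \<in> I \<Longrightarrow> 0 \<le> \<mu> i"
    and total: "(\<Sum>i\<in>I. \<mu> i) = 1" and odd: "f d = - f e"
  shows "(\<Sum>i\<in>I. \<mu> i * f i)\<^sup>2 \<le> (1 - 4 * (\<mu> e * \<mu> d)) * (\<Sum>i\<in>I. \<mu> i * (f i)\<^sup>2)"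
proof -
  \<comment> \<open>Forced by preserving the mean: with f d = - f e the two points contribute (\<mu>
    e - \<mu> d) f e. If both weights are 0, the division gives k = 0 and the identities below
    persist.\<close>
  define k where "k = (\<mu> e - \<mu> d) / (\<mu> e + \<mu> d)"
  define w where "w i = (if i = e then k else if i = d then - k else 1)" for i
  let ?J = "I - {e, d}"
  have split: "(\<Sum>i\<in>I. g i) = g e + g d + (\<Sum>i\<in>?J. g i)" for g :: "'b \<Rightarrow> real"
  proof -
    have "(\<Sum>i\<in>I. g i) = (\<Sum>i\<in>{e, d}. g i) + (\<Sum>i\<in>?J. g i)"
      using fin ed by (subst sum.subset_diff[of "{e, d}"]) auto
    then show ?thesis using ed by simp
  qed
  have J: "(\<Sum>i\<in>?J. \<mu> i * w i * f i) = (\<Sum>i\<in>?J. \<mu> i * f i)" "(\<Sum>i\<in>?J. \<mu> i * (w i)\<^sup>2) = (\<Sum>i\<in>?J. \<mu> i)"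
    by (intro sum.cong refl; simp add: w_def)+
  have nn: "0 \<le> \<mu> e" "0 \<le> \<mu> d" using nonneg ed by auto
  have k: "(\<mu> e + \<mu> d) * k = \<mu> e - \<mu> d"
    using nn by (cases "\<mu> e + \<mu> d = 0") (auto simp: k_def)
  have "\<mu> e * w e * f e + \<mu> d * w d * f d = ((\<mu> e + \<mu> d) * k) * f e"
    using ed odd by (simp add: w_def algebra_simps)
  then have "(\<Sum>i\<in>I. \<mu> i * w i * f i) = (\<Sum>i\<in>I. \<mu> i * f i)"
    unfolding split J k using odd by (simp add: algebra_simps)
  moreover have "(\<Sum>i\<in>I. \<mu> i * (w i)\<^sup>2) \<le> 1 - 4 * (\<mu> e * \<mu> d)"
  proof -
    have le1: "\<mu> e + \<mu> d \<le> 1"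
      using total nonneg sum_nonneg[of ?J \<mu>] unfolding split[of \<mu>] by auto
    \<comment> \<open>For a nonzero sum of the two weights the right side is 4 \<mu> e \<mu> d /
      (\<mu> e + \<mu> d), and this sum is at most 1.\<close>
    have "4 * (\<mu> e * \<mu> d) \<le> (\<mu> e + \<mu> d) * (1 - k\<^sup>2)"
    proof (cases "\<mu> e + \<mu> d = 0")
      case False
      then have pos: "0 < \<mu> e + \<mu> d" using nn by simp
      have "(\<mu> e + \<mu> d) * (4 * (\<mu> e * \<mu> d)) \<le> 1 * (4 * (\<mu> e * \<mu> d))"
        using le1 nn by (intro mult_right_mono) auto
      also have "\<dots> = (\<mu> e + \<mu> d)\<^sup>2 - (\<mu> e - \<mu> d)\<^sup>2"
        by (simp add: power2_eq_square algebra_simps)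
      also have "\<dots> = (\<mu> e + \<mu> d) * ((\<mu> e + \<mu> d) * (1 - k\<^sup>2))"
        unfolding k[symmetric] by (simp add: power2_eq_square algebra_simps)
      finally show ?thesis using pos by (simp only: mult_le_cancel_left_pos)
    qed (use nn in \<open>simp add: add_nonneg_eq_0_iff\<close>)
    moreover have "(\<Sum>i\<in>?J. \<mu> i) = 1 - (\<mu> e + \<mu> d)" using total unfolding split[of \<mu>] by simp
    moreover have "\<mu> e * (w e)\<^sup>2 + \<mu> d * (w d)\<^sup>2 = (\<mu> e + \<mu> d) * k\<^sup>2"
      using ed by (simp add: w_def algebra_simps)
    ultimately show ?thesis unfolding split J by (simp add: algebra_simps)
  qed
  moreover have "(\<Sum>i\<in>I. \<mu> i * w i * f i)\<^sup>2 \<le> (\<Sum>i\<in>I. \<mu> i * (w i)\<^sup>2) * (\<Sum>i\<in>I. \<mu> i * (f i)\<^sup>2)"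
  proof -
    have "(\<Sum>i\<in>I. \<mu> i * w i * f i) = (\<Sum>i\<in>I. (sqrt (\<mu> i) * w i) * (sqrt (\<mu> i) * f i))"
    proof (intro sum.cong refl)
      fix i assume "i \<in> I"
      then have "sqrt (\<mu> i) * sqrt (\<mu> i) = \<mu> i" using nonneg by simp
      then show "\<mu> i * w i * f i = (sqrt (\<mu> i) * w i) * (sqrt (\<mu> i) * f i)"
        by (metis mult.assoc mult.left_commute)
    qed
    also have "\<dots>\<^sup>2 \<le> (\<Sum>i\<in>I. (sqrt (\<mu> i) * w i)\<^sup>2) * (\<Sum>i\<in>I. (sqrt (\<mu> i) * f i)\<^sup>2)"
      by (rule Cauchy_Schwarz_ineq_sum)
    also have "\<dots> = (\<Sum>i\<in>I. \<mu> i * (w i)\<^sup>2) * (\<Sum>i\<in>I. \<mu> i * (f i)\<^sup>2)"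
      using nonneg by (simp add: power_mult_distrib)
    finally show ?thesis .
  qed
  moreover have "0 \<le> (\<Sum>i\<in>I. \<mu> i * (f i)\<^sup>2)" using nonneg by (intro sum_nonneg) auto
  ultimately show ?thesis by (metis (no_types, lifting) mult_right_mono order_trans)
qed

context involution_walk
begin

text \<open>The squared gradient of the average is bounded edge by edge, with the opposite gradients
  at g = id and g = \<tau> providing the gain. A change of variables then moves the translations
  from \<phi> onto \<rho>, where Jensen's inequality for the mean collects them. One m serves all
  \<tau>, so that the factor can be pulled out of the sum over edges.\<close>

lemma gradient_estimate:
  assumes t: "0 \<le> t" and \<rho>: "\<And>x. x \<in> G \<Longrightarrow> 0 \<le> \<rho> x"
    and m: "\<And>\<tau>. \<tau> \<in> D \<Longrightarrow> m \<le> kern t id * kern t \<tau>"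
    and m1: "4 * m \<le> 1"
  shows "form \<rho> (dual_avg t \<phi>) (dual_avg t \<phi>) \<le> (1 - 4 * m) * form (avg t \<rho>) \<phi> \<phi>"
proof -
  let ?\<mu> = "kern t"
  let ?d = "\<lambda>x \<tau>. (\<phi> x - \<phi> (\<tau> \<circ> x))\<^sup>2"
  note kn = kern_nonneg[OF _ t]
  have mean: "(dual_avg t \<phi> x - dual_avg t \<phi> (\<tau> \<circ> x))\<^sup>2 \<le>
      (1 - 4 * m) * (\<Sum>g\<in>G. ?\<mu> g * (\<phi> (inv g \<circ> x) - \<phi> (inv g \<circ> (\<tau> \<circ> x)))\<^sup>2)"
    if "x \<in> G" "\<tau> \<in> D" for x \<tau>
  proof -
    let ?f = "\<lambda>g. \<phi> (inv g \<circ> x) - \<phi> (inv g \<circ> (\<tau> \<circ> x))"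
    have "(dual_avg t \<phi> x - dual_avg t \<phi> (\<tau> \<circ> x))\<^sup>2 = (\<Sum>g\<in>G. ?\<mu> g * ?f g)\<^sup>2"
      by (simp add: dual_avg_def right_diff_distrib sum_subtractf)
    also have "\<dots> \<le> (1 - 4 * (?\<mu> id * ?\<mu> \<tau>)) * (\<Sum>g\<in>G. ?\<mu> g * (?f g)\<^sup>2)"
    proof (rule odd_pair_mean_square[OF finite_G id_in D_in[OF that(2)] _ kn sum_kern])
      show "id \<noteq> \<tau>" using that id_notin by blast
      show "?f \<tau> = - ?f id" using that by (simp add: inv_involution involution_assoc)
    qed
    also have "\<dots> \<le> (1 - 4 * m) * (\<Sum>g\<in>G. ?\<mu> g * (?f g)\<^sup>2)"
      using m[OF that(2)] by (intro mult_right_mono sum_nonneg mult_nonneg_nonneg kn) auto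
    finally show ?thesis .
  qed
  have "(\<Sum>x\<in>G. \<Sum>\<tau>\<in>D. (dual_avg t \<phi> x - dual_avg t \<phi> (\<tau> \<circ> x))\<^sup>2 * log_mean (\<rho> x) (\<rho> (\<tau> \<circ> x)))
      \<le> (\<Sum>x\<in>G. \<Sum>\<tau>\<in>D. (1 - 4 * m) * (\<Sum>g\<in>G. ?\<mu> g * (\<phi> (inv g \<circ> x) - \<phi> (inv g \<circ> (\<tau> \<circ> x)))\<^sup>2)
          * log_mean (\<rho> x) (\<rho> (\<tau> \<circ> x)))"
    by (intro sum_mono mult_right_mono mean log_mean_nonneg)
  also have "\<dots> = (1 - 4 * m) * (\<Sum>x\<in>G. \<Sum>\<tau>\<in>D. \<Sum>g\<in>G. ?\<mu> g *
      ((\<phi> (inv g \<circ> x) - \<phi> (inv g \<circ> (\<tau> \<circ> x)))\<^sup>2 * log_mean (\<rho> x) (\<rho> (\<tau> \<circ> x))))"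
    by (simp add: sum_distrib_left sum_distrib_right mult.assoc)
  also have "(\<Sum>x\<in>G. \<Sum>\<tau>\<in>D. \<Sum>g\<in>G. ?\<mu> g *
      ((\<phi> (inv g \<circ> x) - \<phi> (inv g \<circ> (\<tau> \<circ> x)))\<^sup>2 * log_mean (\<rho> x) (\<rho> (\<tau> \<circ> x))))
    = (\<Sum>g\<in>G. \<Sum>\<tau>\<in>D. \<Sum>x\<in>G. ?\<mu> g *
      ((\<phi> (inv g \<circ> x) - \<phi> (inv g \<circ> (\<tau> \<circ> x)))\<^sup>2 * log_mean (\<rho> x) (\<rho> (\<tau> \<circ> x))))"
    by (subst sum.swap, subst (2) sum.swap, subst sum.swap) (rule refl)
  also have "\<dots> = (\<Sum>g\<in>G. \<Sum>\<tau>\<in>D. \<Sum>x\<in>G. ?\<mu> g * (?d x \<tau> * log_mean (\<rho> (g \<circ> x)) (\<rho> (g \<circ> (\<tau> \<circ> x)))))"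
  proof (rule sum.cong[OF refl])
    fix g assume g: "g \<in> G"
    let ?h = "\<lambda>x \<tau>. ?\<mu> g * ((\<phi> (inv g \<circ> x) - \<phi> (inv g \<circ> (\<tau> \<circ> x)))\<^sup>2 * log_mean (\<rho> x) (\<rho> (\<tau> \<circ> x)))"
    \<comment> \<open>For fixed g the substitution \<open>x \<mapsto> g \<circ> x\<close>,
      \<open>\<tau> \<mapsto> g \<circ> \<tau> \<circ> inv g\<close> carries the edge (x, \<tau> x)
      to (g x, g \<tau> x).\<close>
    have "(\<Sum>\<tau>\<in>D. \<Sum>x\<in>G. ?h x \<tau>) = (\<Sum>\<tau>\<in>D. \<Sum>x\<in>G. ?h x (g \<circ> \<tau> \<circ> inv g))"
      by (rule sum.reindex_bij_betw[OF bij_betw_conj[OF g], symmetric])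
    also have "\<dots> = (\<Sum>\<tau>\<in>D. \<Sum>x\<in>G. ?h (g \<circ> x) (g \<circ> \<tau> \<circ> inv g))"
      by (intro sum.cong refl sum_left[OF g, symmetric])
    also have "\<dots> = (\<Sum>\<tau>\<in>D. \<Sum>x\<in>G. ?\<mu> g * (?d x \<tau> * log_mean (\<rho> (g \<circ> x)) (\<rho> (g \<circ> (\<tau> \<circ> x)))))"
      using g by (intro sum.cong refl) (simp add: comp_assoc inv_comp_assoc)
    finally show "(\<Sum>\<tau>\<in>D. \<Sum>x\<in>G. ?h x \<tau>) = \<dots>" .
  qed
  also have "\<dots> = (\<Sum>x\<in>G. \<Sum>\<tau>\<in>D. ?d x \<tau> * (\<Sum>g\<in>G. ?\<mu> g * log_mean (\<rho> (g \<circ> x)) (\<rho> (g \<circ> (\<tau> \<circ> x)))))"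
    unfolding sum_distrib_left
    by (subst (2) sum.swap, subst sum.swap, subst (2) sum.swap) (intro sum.cong refl, simp)
  also have "(1 - 4 * m) * \<dots> \<le> (1 - 4 * m) *
      (\<Sum>x\<in>G. \<Sum>\<tau>\<in>D. ?d x \<tau> * log_mean (avg t \<rho> x) (avg t \<rho> (\<tau> \<circ> x)))"
    unfolding avg_def using m1
    by (intro mult_left_mono sum_mono log_mean_sum_ge finite_G) (simp_all add: kn \<rho> comp_in D_in)
  finally show ?thesis
    unfolding form_eq power2_eq_square[symmetric] mult.left_commute[of "1 - 4 * m"]
    using rate_pos by (intro mult_left_mono) (simp_all add: comp_def)
qed

end

section \<open>Contraction of the action along the heat flow\<close>

text \<open>The point 0 matters: densities on the geodesic may vanish, and the limit of small heat
  times must reach them.\<close>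

lemma continuous_on_mult_ln: "continuous_on {0..} (\<lambda>x::real. x * ln x)"
  unfolding continuous_on_def
proof
  fix x :: real assume "x \<in> {0..}"
  then consider "x > 0" | "x = 0" by fastforce
  then show "((\<lambda>x. x * ln x) \<longlongrightarrow> x * ln x) (at x within {0..})"
  proof cases
    case 1
    then show ?thesis by (auto intro!: tendsto_intros)
  next
    case 2
    \<comment> \<open>From ln z \<le> z - 1 at z = 1 / sqrt y.\<close>
    have bound: "\<bar>y * ln y\<bar> \<le> 2 * sqrt y" if "y \<in> {0..}" "y < 1" for y
    proof (cases "y = 0")
      case False
      with that have y: "0 < y" "y < 1" by auto
      then have "ln (1 / sqrt y) \<le> 1 / sqrt y"
        using ln_le_minus_one[of "1 / sqrt y"] by simp
      then have "- ln y \<le> 2 / sqrt y" using y by (simp add: ln_div ln_sqrt)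
      then have "y * (- ln y) \<le> y * (2 / sqrt y)" using y by (intro mult_left_mono) auto
      also have "\<dots> = 2 * (y / sqrt y)" by simp
      also have "\<dots> = 2 * sqrt y" using y real_div_sqrt[of y] by simp
      finally show ?thesis using y by (simp add: abs_mult)
    qed simp
    have "((\<lambda>y::real. y * ln y) \<longlongrightarrow> 0) (at 0 within {0..})"
    proof (rule Lim_null_comparison)
      have "\<forall>\<^sub>F y in at (0::real) within {0..}. y < 1"
        by (intro order_tendstoD[OF tendsto_ident_at]) simp
      moreover have "\<forall>\<^sub>F y in at (0::real) within {0..}. y \<in> {0..}"
        by (simp add: eventually_at_filter)
      ultimately show "\<forall>\<^sub>F y in at 0 within {0..}. norm (y * ln y) \<le> 2 * sqrt y"
        by eventually_elim (use bound in simp)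
      have "((\<lambda>y. 2 * sqrt y) \<longlongrightarrow> 2 * sqrt 0) (at 0 within {0..})"
        by (intro tendsto_intros)
      then show "((\<lambda>y. 2 * sqrt y) \<longlongrightarrow> 0) (at 0 within {0..})" by simp
    qed
    with 2 show ?thesis by simp
  qed
qed

section \<open>The heat semigroup on densities\<close>

context involution_walk
begin

abbreviation "dens \<equiv> densities G unif"
abbreviation "ent \<equiv> rel_entropy G unif"

lemma dens_nonneg: "\<rho> \<in> dens \<Longrightarrow> x \<in> G \<Longrightarrow> 0 \<le> \<rho> x"
  by (auto simp: densities_def PiE_iff)

lemma dens_sum: "\<rho> \<in> dens \<Longrightarrow> (\<Sum>x\<in>G. unif x * \<rho> x) = 1"
  by (simp add: densities_def)

lemma sum_unif: "(\<Sum>x\<in>G. unif x) = 1"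
  using markov by (simp add: markov_triple_def)

lemma avg_nonneg: "0 \<le> t \<Longrightarrow> \<rho> \<in> dens \<Longrightarrow> x \<in> G \<Longrightarrow> 0 \<le> avg t \<rho> x"
  unfolding avg_def by (intro sum_nonneg mult_nonneg_nonneg) (simp_all add: kern_nonneg dens_nonneg comp_in)

lemma avg_pos:
  assumes "0 < t" "\<rho> \<in> dens" "x \<in> G"
  shows "0 < avg t \<rho> x"
proof -
  obtain y where y: "y \<in> G" "\<rho> y > 0"
  proof (rule ccontr)
    assume "\<not> thesis"
    with that have "\<forall>y\<in>G. \<rho> y \<le> 0" by (meson not_le)
    then have "(\<Sum>x\<in>G. unif x * \<rho> x) \<le> 0"
      using unif_pos by (intro sum_nonpos mult_nonneg_nonpos) (auto intro: less_imp_le)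
    then show False using dens_sum[OF assms(2)] by simp
  qed
  have "y \<circ> inv x \<circ> x = y" using assms by (simp add: comp_assoc inv_comp)
  then have "0 < kern t (y \<circ> inv x) * \<rho> (y \<circ> inv x \<circ> x)"
    using y assms by (intro mult_pos_pos kern_pos comp_in inv_in) auto
  then show ?thesis
    unfolding avg_def using assms(1,3) y(1) finite_G
    by (intro sum_pos2[of G "y \<circ> inv x"] mult_nonneg_nonneg)
      (simp_all add: kern_nonneg dens_nonneg[OF assms(2)] comp_in inv_in)
qed

lemma avg_0: "avg 0 \<rho> x = \<rho> x"
proof -
  have "avg 0 \<rho> x = (\<Sum>g\<in>G. if g = id then \<rho> x else 0)"
    unfolding avg_def by (intro sum.cong) (auto simp: kern_0)
  then show ?thesis using finite_G id_in by simp
qed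

lemma sum_avg: "(\<Sum>x\<in>G. unif x * avg t \<rho> x) = (\<Sum>x\<in>G. unif x * \<rho> x)"
  using sum_avg_dual[of "\<lambda>_. 1" t \<rho>] by (simp add: dual_avg_def sum_kern)

text \<open>The restriction makes the average extensional, as membership in \<open>densities\<close>
  demands.\<close>

definition heat :: "real \<Rightarrow> (('a \<Rightarrow> 'a) \<Rightarrow> real) \<Rightarrow> ('a \<Rightarrow> 'a) \<Rightarrow> real" where
  "heat t \<rho> = restrict (avg t \<rho>) G"

lemma heat_in: "0 \<le> t \<Longrightarrow> \<rho> \<in> dens \<Longrightarrow> heat t \<rho> \<in> dens"
  using dens_sum[of \<rho>] avg_nonneg[of t \<rho>] sum_avg[of t \<rho>]
  by (simp add: densities_def heat_def)

lemma heat_0: "\<rho> \<in> dens \<Longrightarrow> heat 0 \<rho> = \<rho>"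
  by (auto simp: heat_def avg_0 densities_def PiE_iff extensional_def restrict_def)

definition gen :: "(('a \<Rightarrow> 'a) \<Rightarrow> real) \<Rightarrow> ('a \<Rightarrow> 'a) \<Rightarrow> real" where
  "gen f x = q * (\<Sum>\<tau>\<in>D. f (\<tau> \<circ> x) - f x)"

text \<open>By the chain rule for the logarithm the heat equation is the continuity equation with
  potential - ln f. This is what brings the entropy into the action estimate.\<close>

lemma gen_ln:
  assumes pos: "\<And>x. x \<in> G \<Longrightarrow> 0 < f x" and x: "x \<in> G"
  shows "(\<Sum>y\<in>G. (ln (f y) - ln (f x)) * log_mean (f x) (f y) * rate x y) = gen f x"
proof -
  have "(\<Sum>y\<in>G. (ln (f y) - ln (f x)) * log_mean (f x) (f y) * rate x y) = (\<Sum>y\<in>G. (f y - f x) * rate x y)"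
  proof (intro sum.cong refl arg_cong2[of _ _ _ _ "(*)"])
    fix y assume "y \<in> G"
    then show "(ln (f y) - ln (f x)) * log_mean (f x) (f y) = f y - f x"
      using log_mean_mult_ln_diff[of "f y" "f x"] pos x by (simp add: mult.commute log_mean_commute)
  qed
  also have "\<dots> = gen f x" by (simp add: sum_rate[OF x] gen_def)
  finally show ?thesis .
qed

lemma avg_has_derivative:
  assumes x: "x \<in> G" and \<rho>: "\<And>x. x \<in> G \<Longrightarrow> ((\<lambda>s. \<rho> s x) has_real_derivative v x) (at s)"
  shows "((\<lambda>s. avg (\<alpha> + b * s) (\<rho> s) x) has_real_derivative
    avg (\<alpha> + b * s) v x + b * gen (avg (\<alpha> + b * s) (\<rho> s)) x) (at s)"
proof -
  let ?a = "\<alpha> + b * s"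
  let ?k = "\<lambda>g. q * (\<Sum>\<tau>\<in>D. kern ?a (g \<circ> \<tau>)) - exit_rate * kern ?a g"
  have kern: "((\<lambda>s. kern (\<alpha> + b * s) g) has_real_derivative ?k g * b) (at s)" if "g \<in> G" for g
    by (rule DERIV_chain2[OF kern_has_derivative[OF that]]) (auto intro!: derivative_eq_intros)
  have "((\<lambda>s. avg (\<alpha> + b * s) (\<rho> s) x) has_real_derivative
      (\<Sum>g\<in>G. (?k g * b) * \<rho> s (g \<circ> x) + v (g \<circ> x) * kern ?a g)) (at s)"
    unfolding avg_def by (intro DERIV_sum DERIV_mult kern \<rho> comp_in x)
  also have "(\<Sum>g\<in>G. (?k g * b) * \<rho> s (g \<circ> x) + v (g \<circ> x) * kern ?a g)
      = avg ?a v x + b * (\<Sum>g\<in>G. ?k g * \<rho> s (g \<circ> x))"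
    unfolding avg_def sum.distrib sum_distrib_left by (simp add: mult_ac)
  also have "(\<Sum>g\<in>G. ?k g * \<rho> s (g \<circ> x)) =
      q * (\<Sum>\<tau>\<in>D. \<Sum>g\<in>G. kern ?a (g \<circ> \<tau>) * \<rho> s (g \<circ> x)) - exit_rate * avg ?a (\<rho> s) x"
    unfolding avg_def left_diff_distrib sum_subtractf sum_distrib_left sum_distrib_right
    by (subst sum.swap) (simp add: mult_ac)
  \<comment> \<open>Substituting \<open>g \<circ> \<tau>\<close> for g moves the generator from the
    kernel to the argument of the average.\<close>
  also have "(\<Sum>\<tau>\<in>D. \<Sum>g\<in>G. kern ?a (g \<circ> \<tau>) * \<rho> s (g \<circ> x)) = (\<Sum>\<tau>\<in>D. avg ?a (\<rho> s) (\<tau> \<circ> x))"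
  proof (rule sum.cong[OF refl])
    fix \<tau> assume \<tau>: "\<tau> \<in> D"
    have "(\<Sum>g\<in>G. kern ?a (g \<circ> \<tau>) * \<rho> s (g \<circ> x)) = (\<Sum>g\<in>G. kern ?a (g \<circ> \<tau>) * \<rho> s (g \<circ> \<tau> \<circ> (\<tau> \<circ> x)))"
      using \<tau> by (simp add: comp_assoc involution_assoc)
    also have "\<dots> = avg ?a (\<rho> s) (\<tau> \<circ> x)"
      unfolding avg_def by (rule sum_right[OF \<tau>, of "\<lambda>g. kern ?a g * \<rho> s (g \<circ> (\<tau> \<circ> x))"])
    finally show "(\<Sum>g\<in>G. kern ?a (g \<circ> \<tau>) * \<rho> s (g \<circ> x)) = avg ?a (\<rho> s) (\<tau> \<circ> x)" .
  qed
  finally show ?thesis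
    by (simp add: gen_def exit_rate_def sum_subtractf right_diff_distrib mult.assoc)
qed

text \<open>With \<open>\<phi> = \<psi> + h ln f\<close> the heat flux is removed: \<open>\<phi>\<close> solves the continuity equation for
  the averaged velocity alone, to which duality and the gradient estimate apply.\<close>

lemma action_estimate:
  fixes f :: "('a \<Rightarrow> 'a) \<Rightarrow> real"
  assumes t: "0 \<le> t" and \<rho>: "\<And>x. x \<in> G \<Longrightarrow> 0 \<le> \<rho> x"
    and m: "\<And>\<tau>. \<tau> \<in> D \<Longrightarrow> m \<le> kern t id * kern t \<tau>" and m1: "4 * m < 1"
    and CE: "\<And>x. x \<in> G \<Longrightarrow> v x + (\<Sum>y\<in>G. (\<psi>\<^sub>0 y - \<psi>\<^sub>0 x) * log_mean (\<rho> x) (\<rho> y) * rate x y) = 0"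
    and pos: "\<And>x. x \<in> G \<Longrightarrow> 0 < avg t \<rho> x"
    and f: "\<And>x. x \<in> G \<Longrightarrow> f x = avg t \<rho> x"
    and v': "\<And>x. x \<in> G \<Longrightarrow> v' x = avg t v x + h * gen (avg t \<rho>) x"
    and CE': "\<And>x. x \<in> G \<Longrightarrow> v' x + (\<Sum>y\<in>G. (\<psi> y - \<psi> x) * log_mean (f x) (f y) * rate x y) = 0"
  shows "form f \<psi> \<psi> \<le> (1 - 4 * m) * form \<rho> \<psi>\<^sub>0 \<psi>\<^sub>0 - 2 * h * (\<Sum>x\<in>G. unif x * ln (f x) * v' x)"
proof -
  define \<phi> where "\<phi> x = \<psi> x + h * ln (f x)" for x
  have f_pos: "0 < f x" if "x \<in> G" for x using pos[OF that] f[OF that] by simp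
  have gen_f: "gen (avg t \<rho>) x = gen f x" if "x \<in> G" for x
    using f that by (auto simp: gen_def comp_in D_in intro!: sum.cong)
  have CE_\<phi>: "avg t v x + (\<Sum>y\<in>G. (\<phi> y - \<phi> x) * log_mean (f x) (f y) * rate x y) = 0" if x: "x \<in> G" for x
  proof -
    have "(\<Sum>y\<in>G. (\<phi> y - \<phi> x) * log_mean (f x) (f y) * rate x y) =
        (\<Sum>y\<in>G. (\<psi> y - \<psi> x) * log_mean (f x) (f y) * rate x y) +
        h * (\<Sum>y\<in>G. (ln (f y) - ln (f x)) * log_mean (f x) (f y) * rate x y)"
      unfolding \<phi>_def sum_distrib_left sum.distrib[symmetric]
      by (intro sum.cong refl) (simp add: algebra_simps)
    also have "(\<Sum>y\<in>G. (ln (f y) - ln (f x)) * log_mean (f x) (f y) * rate x y) = gen f x"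
      by (rule gen_ln[OF f_pos x])
    finally show ?thesis using CE'[OF x] v'[OF x] gen_f[OF x] by simp
  qed
  \<comment> \<open>Both forms are pairings with one velocity: \<open>avg t v\<close> tested with
    \<phi> at f is v tested with the adjoint average of \<phi> at \<rho>.\<close>
  have "form f \<phi> \<phi> = (\<Sum>x\<in>G. unif x * \<phi> x * avg t v x)"
    using continuity_equation_weak[OF markov CE_\<phi>] by simp
  also have "\<dots> = form \<rho> (dual_avg t \<phi>) \<psi>\<^sub>0"
    unfolding sum_avg_dual by (rule continuity_equation_weak[OF markov CE])
  finally have eq: "form f \<phi> \<phi> = form \<rho> (dual_avg t \<phi>) \<psi>\<^sub>0" .
  have "form (avg t \<rho>) \<phi> \<phi> = form f \<phi> \<phi>" using f by (intro form_density_cong) simp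
  then have grad: "form \<rho> (dual_avg t \<phi>) (dual_avg t \<phi>) / (1 - 4 * m) \<le> form f \<phi> \<phi>"
    using gradient_estimate[where \<rho> = \<rho> and \<phi> = \<phi>, OF t \<rho> m] m1 by (simp add: divide_le_eq mult.commute)
  \<comment> \<open>With c = 1 - 4 m the first term is, by the gradient estimate, at most one of the
    two copies of \<open>form f \<phi> \<phi>\<close> on the left.\<close>
  have "2 * form f \<phi> \<phi> \<le> form \<rho> (dual_avg t \<phi>) (dual_avg t \<phi>) / (1 - 4 * m) +
      (1 - 4 * m) * form \<rho> \<psi>\<^sub>0 \<psi>\<^sub>0"
    unfolding eq using m1 by (intro grad_form_young[OF markov]) simp
  with grad have le: "form f \<phi> \<phi> \<le> (1 - 4 * m) * form \<rho> \<psi>\<^sub>0 \<psi>\<^sub>0" by simp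
  let ?l = "\<lambda>x. ln (f x)"
  have "form f \<phi> \<phi> = form f \<phi> \<psi> + h * form f \<phi> ?l"
    unfolding \<phi>_def[abs_def] by (rule grad_form_add_scaled)
  also have "form f \<phi> \<psi> = form f \<psi> \<psi> + h * form f ?l \<psi>"
    using grad_form_add_scaled[of G rate unif f \<psi> \<psi> h ?l]
    unfolding \<phi>_def[abs_def] by (metis grad_form_commute)
  also have "form f \<phi> ?l = form f ?l \<psi> + h * form f ?l ?l"
    using grad_form_add_scaled[of G rate unif f ?l \<psi> h ?l]
    unfolding \<phi>_def[abs_def] by (metis grad_form_commute)
  finally have "form f \<phi> \<phi> = form f \<psi> \<psi> + 2 * h * form f ?l \<psi> + h\<^sup>2 * form f ?l ?l"
    by (simp add: algebra_simps power2_eq_square)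
  \<comment> \<open>The Fisher information is of second order in the slope h and has the favourable
    sign, so it is discarded.\<close>
  moreover have "0 \<le> h\<^sup>2 * form f ?l ?l" by (simp add: grad_form_nonneg[OF markov])
  moreover have "form f ?l \<psi> = (\<Sum>x\<in>G. unif x * ln (f x) * v' x)"
    using continuity_equation_weak[OF markov CE', of ?l] by simp
  ultimately show ?thesis using le by simp
qed

lemma heat_piecewise_smooth:
  assumes T: "\<And>x. x \<in> G \<Longrightarrow> piecewise_smooth T (\<lambda>t. \<rho> t x)" and x: "x \<in> G"
  shows "piecewise_smooth T (\<lambda>t. avg (\<alpha> + b * t) (\<rho> t) x)"
proof -
  have kern: "smooth_on_Icc (\<lambda>t. kern (b * t + \<alpha>) g) c d" if "g \<in> G" for g c d
  proof -
    obtain A B where "\<And>t. t \<in> {c..d} \<Longrightarrow> b * t + \<alpha> \<in> {A..B}"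
    proof -
      have "continuous_on {c..d} (\<lambda>t. b * t + \<alpha>)" by (intro continuous_intros)
      then have "bounded ((\<lambda>t. b * t + \<alpha>) ` {c..d})"
        by (intro compact_imp_bounded compact_continuous_image) auto
      then obtain B where "\<forall>y\<in>(\<lambda>t. b * t + \<alpha>) ` {c..d}. \<bar>y\<bar> \<le> B"
        unfolding bounded_real by blast
      then have bound: "\<bar>b * t + \<alpha>\<bar> \<le> B" if "t \<in> {c..d}" for t
        using that by blast
      then have "b * t + \<alpha> \<in> {- B..B}" if "t \<in> {c..d}" for t
        unfolding atLeastAtMost_iff using abs_le_D1[OF bound[OF that]]
          abs_le_D2[OF bound[OF that]] by linarith
      then show ?thesis by (rule that)
    qed
    then show ?thesis by (rule smooth_on_Icc_affine[OF smooth_on_Icc_kern[OF \<open>g \<in> G\<close>]])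
  qed
  have smooth: "smooth_on_Icc (\<lambda>t. avg (\<alpha> + b * t) (\<rho> t) x) c d"
    if "c \<in> T" "d \<in> T" "c < d \<and> {c<..<d} \<inter> T = {}" for c d
  proof -
    have "smooth_on_Icc (\<lambda>t. \<rho> t (g \<circ> x)) c d" if "g \<in> G" for g
      using T[OF comp_in[OF that x]] \<open>c \<in> T\<close> \<open>d \<in> T\<close> \<open>c < d \<and> _\<close>
      unfolding piecewise_smooth_def by blast
    then show ?thesis
      unfolding avg_def add.commute[of \<alpha>] by (intro smooth_on_Icc_sum smooth_on_Icc_mult kern)
  qed
  have "finite T" "{0, 1} \<subseteq> T" "T \<subseteq> {0..1}"
    using T[OF x] unfolding piecewise_smooth_def by simp_all
  then show ?thesis
    unfolding piecewise_smooth_def by (simp add: smooth)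
qed

lemma continuous_on_ent:
  assumes "\<And>x. x \<in> G \<Longrightarrow> continuous_on S (\<lambda>t. \<rho> t x)" "\<And>x t. x \<in> G \<Longrightarrow> t \<in> S \<Longrightarrow> 0 \<le> \<rho> t x"
  shows "continuous_on S (\<lambda>t. ent (\<rho> t))"
  unfolding rel_entropy_def using assms
  by (intro continuous_on_sum continuous_on_mult_left
      continuous_on_compose2[OF continuous_on_mult_ln]) auto

text \<open>The heat time runs linearly from \<alpha> to \<beta>. With constant slope the last term
  of \<open>action_estimate\<close> is a multiple of the derivative of the entropy and integrates to
  boundary values. \<open>0 < \<alpha> + \<beta>\<close> makes the heat time, and thus the density,
  positive inside the interval. \<open>0 \<le> J\<close> is recorded because \<open>ennreal\<close>
  would conceal a negative bound.\<close>

lemma heat_admissible_bound: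
  assumes adm: "admissible_cost G rate unif \<rho>\<^sub>0 \<rho>\<^sub>1 I"
    and \<alpha>\<beta>: "0 \<le> \<alpha>" "0 \<le> \<beta>" "0 < \<alpha> + \<beta>"
    and m: "\<And>s \<tau>. s \<in> {0<..<1} \<Longrightarrow> \<tau> \<in> D \<Longrightarrow>
      m \<le> kern (\<alpha> + (\<beta> - \<alpha>) * s) id * kern (\<alpha> + (\<beta> - \<alpha>) * s) \<tau>"
    and m1: "4 * m < 1"
  defines "J \<equiv> (1 - 4 * m) * I - 2 * (\<beta> - \<alpha>) * (ent (heat \<beta> \<rho>\<^sub>1) - ent (heat \<alpha> \<rho>\<^sub>0))"
  shows "0 \<le> J" and "transport_cost G rate unif (heat \<alpha> \<rho>\<^sub>0) (heat \<beta> \<rho>\<^sub>1) \<le> ennreal J"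
proof -
  obtain \<rho> \<psi>\<^sub>0 where curve: "transport_curve G rate unif \<rho>\<^sub>0 \<rho>\<^sub>1 \<rho> \<psi>\<^sub>0"
    and I: "((\<lambda>t. form (\<rho> t) (\<psi>\<^sub>0 t) (\<psi>\<^sub>0 t)) has_integral I) {0..1}"
    using adm unfolding admissible_cost_def by (elim exE conjE)
  have dens: "\<And>t. t \<in> {0..1} \<Longrightarrow> \<rho> t \<in> dens" "\<rho> 0 = \<rho>\<^sub>0" "\<rho> 1 = \<rho>\<^sub>1"
    using curve unfolding transport_curve_def by auto
  obtain T where T: "\<forall>x\<in>G. piecewise_smooth T (\<lambda>t. \<rho> t x)"
    and CE: "\<forall>t\<in>{0..1} - T. \<forall>x\<in>G. \<exists>d. ((\<lambda>s. \<rho> s x) has_real_derivative d) (at t) \<and>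
      d + (\<Sum>y\<in>G. (\<psi>\<^sub>0 t y - \<psi>\<^sub>0 t x) * log_mean (\<rho> t x) (\<rho> t y) * rate x y) = 0"
    using curve unfolding transport_curve_def by (elim conjE exE)
  have T01: "finite T" "0 \<in> T" "1 \<in> T"
    using T id_in unfolding piecewise_smooth_def by auto
  define b where "b = \<beta> - \<alpha>"
  define a where "a s = \<alpha> + b * s" for s
  have a_eq: "a s = (1 - s) * \<alpha> + s * \<beta>" for s by (simp add: a_def b_def algebra_simps)
  have a: "0 < a s" if "s \<in> {0<..<1}" for s
  proof (cases "\<alpha> = 0")
    case True
    with \<alpha>\<beta> that show ?thesis by (simp add: a_eq)
  next
    case False
    with \<alpha>\<beta> that show ?thesis unfolding a_eq by (intro add_pos_nonneg) simp_all
  qed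
  have a01: "a 0 = \<alpha>" "a 1 = \<beta>" by (simp_all add: a_eq)
  have a_nonneg: "0 \<le> a s" if "s \<in> {0..1}" for s
    using \<alpha>\<beta> that unfolding a_eq by (intro add_nonneg_nonneg mult_nonneg_nonneg) simp_all
  define r where "r s = heat (a s) (\<rho> s)" for s
  define v where "v t x = - (\<Sum>y\<in>G. (\<psi>\<^sub>0 t y - \<psi>\<^sub>0 t x) * log_mean (\<rho> t x) (\<rho> t y) * rate x y)" for t x
  define v' where "v' t x = avg (a t) (v t) x + b * gen (avg (a t) (\<rho> t)) x" for t x
  have \<rho>_deriv: "((\<lambda>s. \<rho> s x) has_real_derivative v t x) (at t)" if t: "t \<in> {0..1} - T" "x \<in> G" for t x
  proof -
    obtain d where d: "((\<lambda>s. \<rho> s x) has_real_derivative d) (at t)"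
      "d + (\<Sum>y\<in>G. (\<psi>\<^sub>0 t y - \<psi>\<^sub>0 t x) * log_mean (\<rho> t x) (\<rho> t y) * rate x y) = 0"
      using bspec[OF bspec[OF CE t(1)] t(2)] by (elim exE conjE)
    then have "d = v t x" by (simp add: v_def)
    with d show ?thesis by simp
  qed
  have r_eq: "r s x = avg (a s) (\<rho> s) x" if "x \<in> G" for s x
    using that by (simp add: r_def heat_def)
  have r_deriv: "((\<lambda>s. r s x) has_real_derivative v' t x) (at t)" if "t \<in> {0..1} - T" "x \<in> G" for t x
    unfolding r_eq[OF that(2)] unfolding a_def v'_def
    by (rule avg_has_derivative[OF that(2) \<rho>_deriv[OF that(1)]])
  have in01: "t \<in> {0<..<1}" if "t \<in> {0..1} - T" for t
    using that T01 by (cases "t = 0"; cases "t = 1") auto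
  have r_pos: "0 < r t x" if "t \<in> {0..1} - T" "x \<in> G" for t x
    unfolding r_eq[OF that(2)] using that in01[OF that(1)] by (intro avg_pos a dens) auto
  have v_sum: "(\<Sum>x\<in>G. unif x * v' t x) = 0" if "t \<in> {0..1} - T" for t
  proof (rule DERIV_unique)
    show "((\<lambda>s. \<Sum>x\<in>G. unif x * r s x) has_real_derivative (\<Sum>x\<in>G. unif x * v' t x)) (at t)"
      by (intro DERIV_sum DERIV_cmult r_deriv that)
    have "((\<lambda>s. 1::real) has_real_derivative 0) (at t)" by simp
    then show "((\<lambda>s. \<Sum>x\<in>G. unif x * r s x) has_real_derivative 0) (at t)"
    proof (rule has_field_derivative_transform_within_open[of _ _ _ "{0<..<1}"])
      fix s :: real assume "s \<in> {0<..<1}"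
      then have "r s \<in> dens" unfolding r_def by (intro heat_in a_nonneg dens) auto
      then show "1 = (\<Sum>x\<in>G. unif x * r s x)" by (simp add: dens_sum)
    qed (use in01[OF that] in auto)
  qed
  define \<psi> where "\<psi> t = (SOME \<psi>. \<forall>x\<in>G. v' t x +
      (\<Sum>y\<in>G. (\<psi> y - \<psi> x) * log_mean (r t x) (r t y) * rate x y) = 0)" for t
  have \<psi>: "v' t x + (\<Sum>y\<in>G. (\<psi> t y - \<psi> t x) * log_mean (r t x) (r t y) * rate x y) = 0"
    if t: "t \<in> {0..1} - T" and "x \<in> G" for t x
  proof -
    have "\<exists>\<psi>. \<forall>x\<in>G. v' t x + (\<Sum>y\<in>G. (\<psi> y - \<psi> x) * log_mean (r t x) (r t y) * rate x y) = 0"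
      by (rule continuity_solvable) (use r_pos[OF t] v_sum[OF t] in simp_all)
    from someI_ex[OF this] show ?thesis unfolding \<psi>_def[symmetric] using \<open>x \<in> G\<close> by blast
  qed
  have r_smooth: "piecewise_smooth T (\<lambda>t. r t x)" if "x \<in> G" for x
    unfolding r_eq[OF that] a_def using T that by (intro heat_piecewise_smooth) auto
  have r_curve: "transport_curve G rate unif (heat \<alpha> \<rho>\<^sub>0) (heat \<beta> \<rho>\<^sub>1) r \<psi>"
    unfolding transport_curve_def
  proof (intro conjI ballI exI[of _ T])
    show "r t \<in> dens" if "t \<in> {0..1}" for t
      unfolding r_def using that by (intro heat_in a_nonneg dens)
    show "r 0 = heat \<alpha> \<rho>\<^sub>0" "r 1 = heat \<beta> \<rho>\<^sub>1" by (simp_all add: r_def a01 dens)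
    show "piecewise_smooth T (\<lambda>t. r t x)" if "x \<in> G" for x using that by (rule r_smooth)
    show "\<exists>d. ((\<lambda>s. r s x) has_real_derivative d) (at t) \<and>
        d + (\<Sum>y\<in>G. (\<psi> t y - \<psi> t x) * log_mean (r t x) (r t y) * rate x y) = 0"
      if "t \<in> {0..1} - T" "x \<in> G" for t x
      using r_deriv[OF that] \<psi>[OF that] by blast
  qed
  define A where "A t = form (r t) (\<psi> t) (\<psi> t)" for t
  define h where "h t = (\<Sum>x\<in>G. unif x * ln (r t x) * v' t x)" for t
  define B where "B t = (1 - 4 * m) * form (\<rho> t) (\<psi>\<^sub>0 t) (\<psi>\<^sub>0 t) - 2 * b * h t" for t
  have AB: "A t \<le> B t" if t: "t \<in> {0..1} - T" for t
    unfolding A_def B_def h_def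
  proof (rule action_estimate[where t = "a t" and v = "v t"])
    have t01: "t \<in> {0..1}" using t by blast
    show "0 \<le> a t" using t01 by (rule a_nonneg)
    show "0 \<le> \<rho> t x" if "x \<in> G" for x using dens(1)[OF t01] that by (rule dens_nonneg)
    show "m \<le> kern (a t) id * kern (a t) \<tau>" if "\<tau> \<in> D" for \<tau>
      unfolding a_def b_def using in01[OF t] that by (rule m)
    show "0 < avg (a t) (\<rho> t) x" if "x \<in> G" for x using r_pos[OF t that] r_eq[OF that] by simp
    show "v t x + (\<Sum>y\<in>G. (\<psi>\<^sub>0 t y - \<psi>\<^sub>0 t x) * log_mean (\<rho> t x) (\<rho> t y) * rate x y) = 0" for x
      by (simp add: v_def)
  qed (use m1 r_eq v'_def \<psi>[OF t] in simp_all)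
  \<comment> \<open>At the ends the density may vanish and at break points the curve may have a
    kink, so differentiability is used only in between, together with continuity of the entropy on
    the whole interval.\<close>
  have h_int: "(h has_integral (ent (r 1) - ent (r 0))) {0..1}"
  proof (rule fundamental_theorem_of_calculus_interior_strong[OF T01(1)])
    fix t assume "t \<in> {0<..<1} - T"
    then have t: "t \<in> {0..1} - T" by auto
    have "((\<lambda>s. r s x * ln (r s x)) has_real_derivative v' t x + ln (r t x) * v' t x) (at t)" if "x \<in> G" for x
    proof -
      have "((\<lambda>s. ln (r s x)) has_real_derivative 1 / r t x * v' t x) (at t)"
        by (rule DERIV_chain2[OF DERIV_ln_divide[OF r_pos[OF t that]] r_deriv[OF t that]])
      from DERIV_mult[OF r_deriv[OF t that] this] show ?thesis
        using r_pos[OF t that] by (simp add: algebra_simps)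
    qed
    then have "((\<lambda>s. ent (r s)) has_real_derivative
        (\<Sum>x\<in>G. unif x * (v' t x + ln (r t x) * v' t x))) (at t)"
      unfolding rel_entropy_def by (intro DERIV_sum DERIV_cmult)
    \<comment> \<open>The derivative of r ln r contributes v' itself, which has mean zero by
      conservation of mass.\<close>
    also have "(\<Sum>x\<in>G. unif x * (v' t x + ln (r t x) * v' t x)) = h t"
      using v_sum[OF t] by (simp add: h_def distrib_left sum.distrib mult.assoc)
    finally show "((\<lambda>s. ent (r s)) has_vector_derivative h t) (at t)"
      by (simp add: has_real_derivative_iff_has_vector_derivative)
  next
    show "continuous_on {0..1} (\<lambda>s. ent (r s))"
      using piecewise_smooth_continuous[OF r_smooth] r_eq avg_nonneg[OF a_nonneg dens(1)]
      by (intro continuous_on_ent) auto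
  qed simp
  have J_eq: "J = (1 - 4 * m) * I - 2 * b * (ent (r 1) - ent (r 0))"
    by (simp add: J_def b_def r_def a01 dens)
  have "(B has_integral J) {0..1}"
    unfolding B_def J_eq by (intro has_integral_diff has_integral_mult_right I h_int)
  \<comment> \<open>The comparison with A is known only off the break points; substituting A there
    leaves the integral unchanged.\<close>
  then have B': "((\<lambda>t. if t \<in> T then A t else B t) has_integral J) {0..1}"
    by (rule has_integral_spike_finite[OF T01(1), rotated]) simp
  have A_nonneg: "0 \<le> A t" for t unfolding A_def by (rule grad_form_nonneg[OF markov])
  show "0 \<le> J"
    using AB A_nonneg by (intro has_integral_nonneg[OF B']) (auto intro: order_trans)
  have "transport_action G rate unif r \<psi> =
      (\<integral>\<^sup>+t. ennreal (A t) * indicator {0..1} t \<partial>lborel)"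
    by (simp add: transport_action_eq A_def)
  also have "\<dots> \<le> (\<integral>\<^sup>+t. ennreal (if t \<in> T then A t else B t) * indicator {0..1} t \<partial>lborel)"
    using AB by (intro nn_integral_mono) (auto simp: indicator_def intro!: ennreal_leI)
  also have "\<dots> = ennreal J"
    using AB A_nonneg by (intro nn_integral_has_integral_lebesgue'[OF _ B']) (auto intro: order_trans)
  finally have "transport_action G rate unif r \<psi> \<le> ennreal J" .
  moreover have "transport_cost G rate unif (heat \<alpha> \<rho>\<^sub>0) (heat \<beta> \<rho>\<^sub>1) \<le> transport_action G rate unif r \<psi>"
    unfolding transport_cost_def using r_curve by (intro Inf_lower) blast
  ultimately show "transport_cost G rate unif (heat \<alpha> \<rho>\<^sub>0) (heat \<beta> \<rho>\<^sub>1) \<le> ennreal J"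
    by (rule order_trans[rotated])
qed

section \<open>Finiteness of the transport cost\<close>

text \<open>The curve passes through the interior: its mixing weight \<open>t\<^sup>2 (1 - t)\<^sup>2\<close> of the constant
  density dominates the squared derivatives of the other two weights.\<close>

lemma transport_cost_finite:
  assumes \<rho>\<^sub>0: "\<rho>\<^sub>0 \<in> dens" and \<rho>\<^sub>1: "\<rho>\<^sub>1 \<in> dens"
  shows "transport_cost G rate unif \<rho>\<^sub>0 \<rho>\<^sub>1 \<noteq> \<infinity>"
proof -
  define p :: "real \<Rightarrow> real" where "p t = t\<^sup>2 * (1 - t)\<^sup>2" for t
  \<comment> \<open>Cubic weights with vanishing slope at both ends, each lowered by p / 2 so that
    the three weights add up to 1. Their derivatives contain the factor t (1 - t), whose square is
    p; the remaining factors are at most 7 in absolute value.\<close>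
  define a :: "real \<Rightarrow> real" where "a t = 1 - 3 * t\<^sup>2 + 2 * t ^ 3 - p t / 2" for t
  define b :: "real \<Rightarrow> real" where "b t = 3 * t\<^sup>2 - 2 * t ^ 3 - p t / 2" for t
  define a' :: "real \<Rightarrow> real" where "a' t = - (t * (1 - t)) * (7 - 2 * t)" for t
  define b' :: "real \<Rightarrow> real" where "b' t = t * (1 - t) * (5 + 2 * t)" for t
  have sum1: "a t + p t + b t = 1" for t by (simp add: a_def b_def)
  have da: "(a has_real_derivative a' t) (at t)" for t
    unfolding a_def[abs_def] p_def a'_def
    by (auto intro!: derivative_eq_intros simp: field_simps power2_eq_square power3_eq_cube)
  have db: "(b has_real_derivative b' t) (at t)" for t
    unfolding b_def[abs_def] p_def b'_def
    by (auto intro!: derivative_eq_intros simp: field_simps power2_eq_square power3_eq_cube)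
  have p_nonneg: "0 \<le> p t" for t by (simp add: p_def)
  have p_pos: "0 < p t" if "t \<in> {0<..<1}" for t using that by (simp add: p_def)
  have p_le: "p t \<le> t\<^sup>2" "p t \<le> (1 - t)\<^sup>2" if "t \<in> {0..1}" for t
    using that mult_left_le[of "(1 - t)\<^sup>2" "t\<^sup>2"] mult_right_le_one_le[of "(1 - t)\<^sup>2" "t\<^sup>2"]
    by (auto simp: p_def power_le_one mult.commute)
  have b_nonneg: "0 \<le> b t" if "t \<in> {0..1}" for t
  proof -
    have "b t = t\<^sup>2 + 2 * (t\<^sup>2 * (1 - t)) - p t / 2"
      by (simp add: b_def algebra_simps power2_eq_square power3_eq_cube)
    moreover have "0 \<le> t\<^sup>2 * (1 - t)" using that by simp
    moreover have "0 \<le> t\<^sup>2" by simp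
    ultimately show ?thesis using p_le(1)[OF that] by linarith
  qed
  have a_nonneg: "0 \<le> a t" if "t \<in> {0..1}" for t
  proof -
    have "a t = (1 - t)\<^sup>2 + 2 * (t * (1 - t)\<^sup>2) - p t / 2"
      by (simp add: a_def algebra_simps power2_eq_square power3_eq_cube)
    moreover have "0 \<le> t * (1 - t)\<^sup>2" using that by simp
    moreover have "0 \<le> (1 - t)\<^sup>2" by simp
    ultimately show ?thesis using p_le(2)[OF that] by linarith
  qed
  define \<rho> where "\<rho> t = restrict (\<lambda>x. a t * \<rho>\<^sub>0 x + p t + b t * \<rho>\<^sub>1 x) G" for t
  define v where "v t x = a' t * (\<rho>\<^sub>0 x - 1) + b' t * (\<rho>\<^sub>1 x - 1)" for t x
  have \<rho>_eq: "\<rho> t x = a t * (\<rho>\<^sub>0 x - 1) + 1 + b t * (\<rho>\<^sub>1 x - 1)" if "x \<in> G" for t x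
  proof -
    have "p t = 1 - a t - b t" using sum1[of t] by simp
    then show ?thesis using that by (simp add: \<rho>_def algebra_simps)
  qed
  have \<rho>_ge: "p t \<le> \<rho> t x" if "t \<in> {0..1}" "x \<in> G" for t x
    using that a_nonneg[of t] b_nonneg[of t] dens_nonneg[OF \<rho>\<^sub>0] dens_nonneg[OF \<rho>\<^sub>1]
    by (simp add: \<rho>_def)
  have mean0: "(\<Sum>x\<in>G. unif x * (\<mu> x - 1)) = 0" if "\<mu> \<in> dens" for \<mu>
    using dens_sum[OF that] sum_unif by (simp add: right_diff_distrib sum_subtractf)
  \<comment> \<open>Reference potentials at the constant density 1. By linearity the combination
    with coefficients a' and b' is a potential of v at density 1, with a form of order p.\<close>
  obtain \<psi>\<^sub>0 where \<psi>\<^sub>0: "\<forall>x\<in>G. (\<rho>\<^sub>0 x - 1) + (\<Sum>y\<in>G. (\<psi>\<^sub>0 y - \<psi>\<^sub>0 x) * log_mean 1 1 * rate x y) = 0"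
    using continuity_solvable[of "\<lambda>_. 1", OF _ mean0[OF \<rho>\<^sub>0]] by auto
  obtain \<psi>\<^sub>1 where \<psi>\<^sub>1: "\<forall>x\<in>G. (\<rho>\<^sub>1 x - 1) + (\<Sum>y\<in>G. (\<psi>\<^sub>1 y - \<psi>\<^sub>1 x) * log_mean 1 1 * rate x y) = 0"
    using continuity_solvable[of "\<lambda>_. 1", OF _ mean0[OF \<rho>\<^sub>1]] by auto
  define \<psi> where "\<psi> t = (if t \<in> {0<..<1} then SOME \<psi>. \<forall>x\<in>G. v t x +
      (\<Sum>y\<in>G. (\<psi> y - \<psi> x) * log_mean (\<rho> t x) (\<rho> t y) * rate x y) = 0 else (\<lambda>_. 0))" for t
  have v0: "(\<Sum>x\<in>G. unif x * v t x) = 0" for t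
  proof -
    have "(\<Sum>x\<in>G. unif x * v t x) =
        a' t * (\<Sum>x\<in>G. unif x * (\<rho>\<^sub>0 x - 1)) + b' t * (\<Sum>x\<in>G. unif x * (\<rho>\<^sub>1 x - 1))"
      unfolding v_def sum_distrib_left sum.distrib[symmetric]
      by (intro sum.cong refl) (simp add: algebra_simps)
    then show ?thesis using mean0[OF \<rho>\<^sub>0] mean0[OF \<rho>\<^sub>1] by simp
  qed
  have \<psi>: "v t x + (\<Sum>y\<in>G. (\<psi> t y - \<psi> t x) * log_mean (\<rho> t x) (\<rho> t y) * rate x y) = 0"
    if t: "t \<in> {0<..<1}" and "x \<in> G" for t x
  proof -
    have "0 < \<rho> t x" if "x \<in> G" for x using \<rho>_ge[OF _ that, of t] p_pos[OF t] t by auto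
    then have "\<exists>\<psi>. \<forall>x\<in>G. v t x + (\<Sum>y\<in>G. (\<psi> y - \<psi> x) * log_mean (\<rho> t x) (\<rho> t y) * rate x y) = 0"
      by (rule continuity_solvable) (use v0 in simp_all)
    from someI_ex[OF this] show ?thesis unfolding \<psi>_def using t \<open>x \<in> G\<close> by simp
  qed
  have "transport_curve G rate unif \<rho>\<^sub>0 \<rho>\<^sub>1 \<rho> \<psi>"
    unfolding transport_curve_def
  proof (intro conjI ballI exI[of _ "{0, 1}"])
    show "\<rho> t \<in> dens" if "t \<in> {0..1}" for t
    proof -
      have "0 \<le> \<rho> t x" if "x \<in> G" for x
        using p_nonneg \<rho>_ge[OF \<open>t \<in> {0..1}\<close> that] by (rule order_trans)
      moreover have "(\<Sum>x\<in>G. unif x * \<rho> t x) =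
          a t * (\<Sum>x\<in>G. unif x * \<rho>\<^sub>0 x) + p t * (\<Sum>x\<in>G. unif x) + b t * (\<Sum>x\<in>G. unif x * \<rho>\<^sub>1 x)"
        unfolding \<rho>_def sum_distrib_left sum.distrib[symmetric]
        by (intro sum.cong refl) (simp add: algebra_simps)
      moreover have "\<rho> t \<in> extensional G" by (simp add: \<rho>_def)
      ultimately show ?thesis
        using sum1[of t] by (simp add: densities_def PiE_iff dens_sum[OF \<rho>\<^sub>0] dens_sum[OF \<rho>\<^sub>1] sum_unif)
    qed
    have ext: "restrict \<mu> G = \<mu>" if "\<mu> \<in> dens" for \<mu>
      using that by (auto simp: densities_def PiE_iff extensional_restrict)
    have "a 0 = 1" "p 0 = 0" "b 0 = 0" "a 1 = 0" "p 1 = 0" "b 1 = 1"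
      by (simp_all add: a_def p_def b_def)
    then show "\<rho> 0 = \<rho>\<^sub>0" "\<rho> 1 = \<rho>\<^sub>1" using ext[OF \<rho>\<^sub>0] ext[OF \<rho>\<^sub>1] by (simp_all add: \<rho>_def)
    show "piecewise_smooth {0, 1} (\<lambda>t. \<rho> t x)" if "x \<in> G" for x
    proof -
      have "smooth_on_Icc (\<lambda>t. \<rho> t x) c d" for c d
        unfolding \<rho>_eq[OF that] a_def b_def p_def divide_inverse
        by (intro smooth_on_Icc_intros)
      then show ?thesis unfolding piecewise_smooth_def by simp
    qed
    show "\<exists>d. ((\<lambda>s. \<rho> s x) has_real_derivative d) (at t) \<and>
        d + (\<Sum>y\<in>G. (\<psi> t y - \<psi> t x) * log_mean (\<rho> t x) (\<rho> t y) * rate x y) = 0"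
      if t: "t \<in> {0..1} - {0, 1}" and x: "x \<in> G" for t x
    proof (intro exI[of _ "v t x"] conjI)
      show "((\<lambda>s. \<rho> s x) has_real_derivative v t x) (at t)"
        unfolding \<rho>_eq[OF x] v_def by (auto intro!: derivative_eq_intros da db)
      show "v t x + (\<Sum>y\<in>G. (\<psi> t y - \<psi> t x) * log_mean (\<rho> t x) (\<rho> t y) * rate x y) = 0"
        using t x by (intro \<psi>) auto
    qed
  qed
  then have "transport_cost G rate unif \<rho>\<^sub>0 \<rho>\<^sub>1 \<le> transport_action G rate unif \<rho> \<psi>"
    unfolding transport_cost_def by (intro Inf_lower) blast
  also have "\<dots> < \<infinity>"
  proof -
    let ?one = "\<lambda>_. 1 :: real"
    define K where "K = 98 * (form ?one \<psi>\<^sub>0 \<psi>\<^sub>0 + form ?one \<psi>\<^sub>1 \<psi>\<^sub>1)"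
    note nn = grad_form_nonneg[OF markov]
    have "form (\<rho> t) (\<psi> t) (\<psi> t) \<le> K" if "t \<in> {0..1}" for t
    proof (cases "t \<in> {0<..<1}")
      case False
      then have "\<psi> t = (\<lambda>_. 0)" unfolding \<psi>_def by (rule if_not_P)
      then have "form (\<rho> t) (\<psi> t) (\<psi> t) = 0" by (simp add: grad_form_def)
      then show ?thesis using nn[of ?one \<psi>\<^sub>0] nn[of ?one \<psi>\<^sub>1] by (simp add: K_def)
    next
      case True
      define \<phi> where "\<phi> x = a' t * \<psi>\<^sub>0 x + b' t * \<psi>\<^sub>1 x" for x
      have CE: "v t x + (\<Sum>y\<in>G. (\<phi> y - \<phi> x) * log_mean 1 1 * rate x y) = 0" if x: "x \<in> G" for x
      proof -
        have "v t x + (\<Sum>y\<in>G. (\<phi> y - \<phi> x) * log_mean 1 1 * rate x y) =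
            a' t * ((\<rho>\<^sub>0 x - 1) + (\<Sum>y\<in>G. (\<psi>\<^sub>0 y - \<psi>\<^sub>0 x) * log_mean 1 1 * rate x y)) +
            b' t * ((\<rho>\<^sub>1 x - 1) + (\<Sum>y\<in>G. (\<psi>\<^sub>1 y - \<psi>\<^sub>1 x) * log_mean 1 1 * rate x y))"
          unfolding \<phi>_def v_def distrib_left sum_distrib_left
          by (simp add: algebra_simps flip: sum.distrib)
        then show ?thesis using \<psi>\<^sub>0 \<psi>\<^sub>1 x by simp
      qed
      have "form (\<rho> t) (\<psi> t) (\<psi> t) = (\<Sum>x\<in>G. unif x * \<psi> t x * v t x)"
        using continuity_equation_weak[OF markov \<psi>[OF True]] by simp
      also have "\<dots> = form ?one (\<psi> t) \<phi>"
        by (rule continuity_equation_weak[OF markov CE])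
      finally have eq: "form (\<rho> t) (\<psi> t) (\<psi> t) = form ?one (\<psi> t) \<phi>" .
      have lower: "p t * form ?one (\<psi> t) (\<psi> t) \<le> form (\<rho> t) (\<psi> t) (\<psi> t)"
      proof -
        have "p t * (\<Sum>x\<in>G. \<Sum>\<tau>\<in>D. (\<psi> t x - \<psi> t (\<tau> \<circ> x)) * (\<psi> t x - \<psi> t (\<tau> \<circ> x)) * log_mean 1 1)
          \<le> (\<Sum>x\<in>G. \<Sum>\<tau>\<in>D. (\<psi> t x - \<psi> t (\<tau> \<circ> x)) * (\<psi> t x - \<psi> t (\<tau> \<circ> x)) * log_mean (\<rho> t x) (\<rho> t (\<tau> \<circ> x)))"
          unfolding sum_distrib_left
        proof (intro sum_mono)
          fix x \<tau> assume "x \<in> G" "\<tau> \<in> D"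
          then have "p t \<le> log_mean (\<rho> t x) (\<rho> t (\<tau> \<circ> x))"
            using True p_nonneg by (intro log_mean_ge \<rho>_ge) (simp_all add: comp_in D_in)
          then have "(\<psi> t x - \<psi> t (\<tau> \<circ> x)) * (\<psi> t x - \<psi> t (\<tau> \<circ> x)) * p t \<le>
              (\<psi> t x - \<psi> t (\<tau> \<circ> x)) * (\<psi> t x - \<psi> t (\<tau> \<circ> x)) * log_mean (\<rho> t x) (\<rho> t (\<tau> \<circ> x))"
            by (intro mult_left_mono) simp_all
          then show "p t * ((\<psi> t x - \<psi> t (\<tau> \<circ> x)) * (\<psi> t x - \<psi> t (\<tau> \<circ> x)) * log_mean 1 1) \<le>
              (\<psi> t x - \<psi> t (\<tau> \<circ> x)) * (\<psi> t x - \<psi> t (\<tau> \<circ> x)) * log_mean (\<rho> t x) (\<rho> t (\<tau> \<circ> x))"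
            by (simp add: log_mean_same mult.commute)
        qed
        then have "q / (2 * real (card G)) * (p t * (\<Sum>x\<in>G. \<Sum>\<tau>\<in>D. (\<psi> t x - \<psi> t (\<tau> \<circ> x)) * (\<psi> t x - \<psi> t (\<tau> \<circ> x)) * log_mean 1 1))
          \<le> form (\<rho> t) (\<psi> t) (\<psi> t)"
          unfolding form_eq using rate_pos by (intro mult_left_mono) simp_all
        then show ?thesis unfolding form_eq[of ?one] by (simp only: mult.left_commute)
      qed
      \<comment> \<open>With c = 1 / p the first term is, by \<open>lower\<close>, at most one of
        the two copies on the left; the remaining bound \<open>form ?one \<phi> \<phi> / p t\<close>
        stays finite because p dominates the squared derivatives.\<close>
      have "2 * form ?one (\<psi> t) \<phi> \<le> form ?one (\<psi> t) (\<psi> t) / (1 / p t) + 1 / p t * form ?one \<phi> \<phi>"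
        using p_pos[OF True] by (intro grad_form_young[OF markov]) simp
      with lower eq have "form (\<rho> t) (\<psi> t) (\<psi> t) \<le> form ?one \<phi> \<phi> / p t" by (simp add: mult.commute)
      also have "form ?one \<phi> \<phi> \<le> 2 * ((a' t)\<^sup>2 * form ?one \<psi>\<^sub>0 \<psi>\<^sub>0 + (b' t)\<^sup>2 * form ?one \<psi>\<^sub>1 \<psi>\<^sub>1)"
      proof -
        have "form ?one \<phi> \<phi> \<le> 2 * (form ?one (\<lambda>x. a' t * \<psi>\<^sub>0 x) (\<lambda>x. a' t * \<psi>\<^sub>0 x) +
            form ?one (\<lambda>x. b' t * \<psi>\<^sub>1 x) (\<lambda>x. b' t * \<psi>\<^sub>1 x))"
          unfolding \<phi>_def[abs_def] grad_form_parallelogram[symmetric] using nn by simp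
        then show ?thesis by (simp only: grad_form_scale)
      qed
      also have "2 * ((a' t)\<^sup>2 * form ?one \<psi>\<^sub>0 \<psi>\<^sub>0 + (b' t)\<^sup>2 * form ?one \<psi>\<^sub>1 \<psi>\<^sub>1)
          \<le> 2 * (49 * p t * form ?one \<psi>\<^sub>0 \<psi>\<^sub>0 + 49 * p t * form ?one \<psi>\<^sub>1 \<psi>\<^sub>1)"
      proof -
        have "(7 - 2 * t)\<^sup>2 \<le> 7\<^sup>2" "(5 + 2 * t)\<^sup>2 \<le> 7\<^sup>2"
          using True by (intro power_mono; simp)+
        then have "(7 - 2 * t)\<^sup>2 * p t \<le> 49 * p t" "(5 + 2 * t)\<^sup>2 * p t \<le> 49 * p t"
          using p_pos[OF True] by (intro mult_right_mono; simp)+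
        moreover have "(a' t)\<^sup>2 = (7 - 2 * t)\<^sup>2 * p t" "(b' t)\<^sup>2 = (5 + 2 * t)\<^sup>2 * p t"
          by (simp_all add: a'_def b'_def p_def power_mult_distrib)
        ultimately show ?thesis using nn by (intro mult_left_mono add_mono mult_right_mono) auto
      qed
      also have "\<dots> = K * p t" by (simp add: K_def algebra_simps)
      finally show ?thesis using p_pos[OF True] by (simp add: divide_right_mono)
    qed
    then have "transport_action G rate unif \<rho> \<psi> \<le> (\<integral>\<^sup>+t\<in>{0..1}. ennreal K \<partial>(lborel :: real measure))"
      unfolding transport_action_eq
      by (intro nn_integral_mono) (simp add: indicator_def ennreal_leI)
    also have "(\<integral>\<^sup>+t\<in>{0..1}. ennreal K \<partial>(lborel :: real measure)) = ennreal K"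
      by (simp add: nn_integral_cmult_indicator)
    finally show ?thesis by (simp add: order_le_less_trans)
  qed
  finally show ?thesis by simp
qed

section \<open>Convexity of the entropy along geodesics\<close>

abbreviation "cost \<rho> \<mu> \<equiv> enn2real (transport_cost G rate unif \<rho> \<mu>)"

lemma cost_concat:
  assumes "\<rho> \<in> dens" "\<mu> \<in> dens" "\<nu> \<in> dens" "0 < l" "l < 1"
  shows "cost \<rho> \<nu> \<le> cost \<rho> \<mu> / l + cost \<mu> \<nu> / (1 - l)"
  using assms by (intro transport_cost_concat[OF markov] transport_cost_finite)

text \<open>Triangle inequality and Cauchy-Schwarz for k steps at once. The ratio l = k / (k + 1)
  gives every step the same share of the time.\<close>

lemma cost_chain:
  assumes k: "0 < k" and z: "\<And>i. i \<le> k \<Longrightarrow> z i \<in> dens"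
  shows "cost (z 0) (z k) / real k \<le> (\<Sum>i<k. cost (z i) (z (Suc i)))"
  using k z
proof (induction k rule: nat_induct_non_zero)
  case (Suc k)
  let ?l = "real k / real (Suc k)"
  have l: "0 < ?l" "?l < 1" "1 - ?l = 1 / real (Suc k)" using Suc by (auto simp: field_simps)
  have "cost (z 0) (z (Suc k)) \<le> cost (z 0) (z k) / ?l + cost (z k) (z (Suc k)) / (1 - ?l)"
    using l Suc.prems by (intro cost_concat) auto
  also have "\<dots> = real (Suc k) * (cost (z 0) (z k) / real k + cost (z k) (z (Suc k)))"
    unfolding l(3) by (simp add: algebra_simps)
  also have "\<dots> \<le> real (Suc k) * (\<Sum>i<Suc k. cost (z i) (z (Suc i)))"
    using Suc by (intro mult_left_mono) auto
  finally show ?case by (simp add: divide_le_eq mult.commute)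
qed simp

text \<open>At heat time a the kernel is at least exp(- exit_rate a) at the identity and at least q
  a times that at each \<tau>; the product gives m after bounding a below by the minimum of the end
  times and, in the exponential, above by M. \<open>4 * q * M < 1\<close> keeps the contraction
  factor positive, so that an almost optimal curve can be inserted.\<close>

lemma heat_cost_bound:
  assumes \<rho>: "\<rho>\<^sub>0 \<in> dens" "\<rho>\<^sub>1 \<in> dens" and \<alpha>\<beta>: "0 \<le> \<alpha>" "0 \<le> \<beta>" "0 < \<alpha> + \<beta>"
    and M: "\<alpha> \<le> M" "\<beta> \<le> M" "4 * q * M < 1"
  shows "cost (heat \<alpha> \<rho>\<^sub>0) (heat \<beta> \<rho>\<^sub>1) \<le>
    (1 - 4 * q * exp (- 2 * exit_rate * M) * min \<alpha> \<beta>) * cost \<rho>\<^sub>0 \<rho>\<^sub>1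
      - 2 * (\<beta> - \<alpha>) * (ent (heat \<beta> \<rho>\<^sub>1) - ent (heat \<alpha> \<rho>\<^sub>0))"
proof -
  define m where "m = q * exp (- 2 * exit_rate * M) * min \<alpha> \<beta>"
  have M0: "0 \<le> M" using \<alpha>\<beta> M by simp
  have exp1: "exp (- 2 * exit_rate * M) \<le> 1"
    using exit_rate_nonneg M0 by (simp add: mult_nonneg_nonneg)
  have m1: "4 * m < 1"
  proof -
    have "exp (- 2 * exit_rate * M) * min \<alpha> \<beta> \<le> 1 * M"
      using exp1 M M0 \<alpha>\<beta> by (intro mult_mono) auto
    then have "q * (exp (- 2 * exit_rate * M) * min \<alpha> \<beta>) \<le> q * M"
      using rate_pos by (intro mult_left_mono) auto
    then show ?thesis using M(3) by (simp add: m_def mult.assoc)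
  qed
  have m: "m \<le> kern (\<alpha> + (\<beta> - \<alpha>) * s) id * kern (\<alpha> + (\<beta> - \<alpha>) * s) \<tau>"
    if s: "s \<in> {0<..<1}" and \<tau>: "\<tau> \<in> D" for s \<tau>
  proof -
    define a where "a = \<alpha> + (\<beta> - \<alpha>) * s"
    have a_eq: "a = (1 - s) * \<alpha> + s * \<beta>" by (simp add: a_def algebra_simps)
    have "(1 - s) * min \<alpha> \<beta> + s * min \<alpha> \<beta> \<le> a" "a \<le> (1 - s) * M + s * M"
      unfolding a_eq using s M by (intro add_mono mult_left_mono; simp)+
    then have a: "min \<alpha> \<beta> \<le> a" "a \<le> M" by (simp_all add: algebra_simps)
    have a0: "0 \<le> a" using a \<alpha>\<beta> by simp
    have "exit_rate * a \<le> exit_rate * M" using a exit_rate_nonneg by (intro mult_left_mono)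
    then have "m \<le> q * exp (- 2 * exit_rate * a) * a"
      unfolding m_def using a \<alpha>\<beta> rate_pos by (intro mult_mono) auto
    also have "\<dots> = exp (- exit_rate * a) * (exp (- exit_rate * a) * (q * a))"
      by (simp add: mult_ac flip: exp_add)
    also have "\<dots> \<le> kern a id * kern a \<tau>"
      using a0 rate_pos by (intro mult_mono kern_id_ge kern_D_ge \<tau> kern_nonneg id_in) auto
    finally show ?thesis unfolding a_def .
  qed
  let ?d = "2 * (\<beta> - \<alpha>) * (ent (heat \<beta> \<rho>\<^sub>1) - ent (heat \<alpha> \<rho>\<^sub>0))"
  have "cost (heat \<alpha> \<rho>\<^sub>0) (heat \<beta> \<rho>\<^sub>1) \<le> (1 - 4 * m) * cost \<rho>\<^sub>0 \<rho>\<^sub>1 - ?d"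
  proof (rule field_le_epsilon)
    fix e :: real assume e: "0 < e"
    define e' where "e' = e / (1 - 4 * m)"
    have e': "0 < e'" "(1 - 4 * m) * e' = e" using e m1 by (auto simp: e'_def)
    have "transport_cost G rate unif \<rho>\<^sub>0 \<rho>\<^sub>1 = ennreal (cost \<rho>\<^sub>0 \<rho>\<^sub>1)"
      using transport_cost_finite[OF \<rho>] by (simp add: less_top)
    also have "\<dots> < ennreal (cost \<rho>\<^sub>0 \<rho>\<^sub>1 + e')" using e' by (simp add: ennreal_less_iff)
    finally obtain I where I: "0 \<le> I" "I < cost \<rho>\<^sub>0 \<rho>\<^sub>1 + e'" "admissible_cost G rate unif \<rho>\<^sub>0 \<rho>\<^sub>1 I"
      using transport_cost_less_admissible[OF markov] by blast
    have le: "(1 - 4 * m) * I \<le> (1 - 4 * m) * (cost \<rho>\<^sub>0 \<rho>\<^sub>1 + e')"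
      using I m1 by (intro mult_left_mono) auto
    have "cost (heat \<alpha> \<rho>\<^sub>0) (heat \<beta> \<rho>\<^sub>1) \<le> (1 - 4 * m) * I - ?d"
      using heat_admissible_bound[OF I(3) \<alpha>\<beta> m m1] by (intro enn2real_leI)
    with le e' show "cost (heat \<alpha> \<rho>\<^sub>0) (heat \<beta> \<rho>\<^sub>1) \<le> (1 - 4 * m) * cost \<rho>\<^sub>0 \<rho>\<^sub>1 - ?d + e"
      by (simp add: distrib_left)
  qed
  then show ?thesis by (simp add: m_def mult.assoc)
qed

lemma geodesic_cost:
  assumes geo: "const_speed_geodesic G rate unif \<gamma>" and st: "s \<in> {0..1}" "t \<in> {0..1}"
  shows "cost (\<gamma> s) (\<gamma> t) = (t - s)\<^sup>2 * cost (\<gamma> 0) (\<gamma> 1)"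
proof -
  have "transport_dist G rate unif (\<gamma> s) (\<gamma> t) = ennreal \<bar>t - s\<bar> * transport_dist G rate unif (\<gamma> 0) (\<gamma> 1)"
    using geo st unfolding const_speed_geodesic_def by blast
  then have "transport_cost G rate unif (\<gamma> s) (\<gamma> t) = (ennreal \<bar>t - s\<bar> * transport_dist G rate unif (\<gamma> 0) (\<gamma> 1))\<^sup>2"
    by (simp only: transport_dist_power2[symmetric])
  also have "\<dots> = ennreal ((t - s)\<^sup>2) * transport_cost G rate unif (\<gamma> 0) (\<gamma> 1)"
    by (simp add: power_mult_distrib transport_dist_power2 ennreal_power)
  finally show ?thesis by (simp add: enn2real_mult)
qed

lemma sum_odd: "(\<Sum>i<N. 2 * real i + 1) = (real N)\<^sup>2"
  by (induction N) (simp_all add: power2_eq_square algebra_simps)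

text \<open>Improves the minimum in \<open>heat_cost_bound\<close> to the mean: on N equal pieces
  the minimum differs from the midpoint by O(1 / N). The squared lengths carry 1 / N^2, which the N
  terms and the factor N of \<open>cost_chain\<close> compensate exactly.\<close>

lemma heat_geodesic_bound:
  assumes geo: "const_speed_geodesic G rate unif \<gamma>" and su: "0 \<le> s" "s < u" "u \<le> 1"
    and \<alpha>\<beta>: "0 \<le> \<alpha>" "0 \<le> \<beta>" "0 < \<alpha> + \<beta>" and M: "\<alpha> \<le> M" "\<beta> \<le> M" "4 * q * M < 1"
  shows "cost (heat \<alpha> (\<gamma> s)) (heat \<beta> (\<gamma> u)) \<le>
    (u - s)\<^sup>2 * cost (\<gamma> 0) (\<gamma> 1) * (1 - 2 * q * exp (- 2 * exit_rate * M) * (\<alpha> + \<beta>))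
      - 2 * (\<beta> - \<alpha>) * (ent (heat \<beta> (\<gamma> u)) - ent (heat \<alpha> (\<gamma> s)))"
    (is "?X \<le> ?Y")
proof -
  define K where "K = 4 * q * exp (- 2 * exit_rate * M)"
  define C where "C = cost (\<gamma> 0) (\<gamma> 1)"
  define Z where "Z = (u - s)\<^sup>2 * C * K * \<bar>\<beta> - \<alpha>\<bar> / 2"
  have dens: "\<gamma> t \<in> dens" if "t \<in> {0..1}" for t
    using geo that unfolding const_speed_geodesic_def by blast
  have approx: "?X \<le> ?Y + Z / real N" if N: "0 < N" for N
  proof -
    define f where "f i = real i / real N" for i
    define t where "t i = s + (u - s) * f i" for i
    define a where "a i = \<alpha> + (\<beta> - \<alpha>) * f i" for i
    define z where "z i = heat (a i) (\<gamma> (t i))" for i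
    have f: "f i \<in> {0..1}" if "i \<le> N" for i using that N by (simp add: f_def)
    have f_Suc: "f (Suc i) = f i + 1 / real N" for i by (simp add: f_def add_divide_distrib)
    have f_ends: "f 0 = 0" "f N = 1" using N by (simp_all add: f_def)
    have t: "t i \<in> {0..1}" if "i \<le> N" for i
    proof -
      have "(u - s) * f i \<le> u - s" "0 \<le> (u - s) * f i"
        using f[OF that] su by (simp_all add: mult_left_le)
      with su show ?thesis unfolding t_def atLeastAtMost_iff by linarith
    qed
    have a_eq: "a i = (1 - f i) * \<alpha> + f i * \<beta>" for i by (simp add: a_def algebra_simps)
    have a: "0 \<le> a i" "a i \<le> M" if "i \<le> N" for i
    proof -
      show "0 \<le> a i" unfolding a_eq using f[OF that] \<alpha>\<beta> by (intro add_nonneg_nonneg mult_nonneg_nonneg) auto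
      have "a i \<le> (1 - f i) * M + f i * M"
        unfolding a_eq using f[OF that] M by (intro add_mono mult_left_mono) auto
      then show "a i \<le> M" by (simp add: algebra_simps)
    qed
    have a_Suc: "a (Suc i) = a i + (\<beta> - \<alpha>) / real N" for i
      by (simp add: a_def f_Suc distrib_left)
    have z: "z i \<in> dens" if "i \<le> N" for i unfolding z_def using that by (intro heat_in a dens t)
    have step: "cost (z i) (z (Suc i)) \<le> (1 - K * ((2 * \<alpha> + (\<beta> - \<alpha>) * (2 * real i + 1) / real N) / 2
          - \<bar>\<beta> - \<alpha>\<bar> / real N / 2)) * (((u - s) / real N)\<^sup>2 * C)
        - 2 * ((\<beta> - \<alpha>) / real N) * (ent (z (Suc i)) - ent (z i))" if i: "i < N" for i
    proof -
      \<comment> \<open>A linear profile that is positive at one end can vanish only at the other,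
        so consecutive heat times are not both 0.\<close>
      have pos: "0 < a i + a (Suc i)"
      proof (cases "\<alpha> = 0")
        case True
        then have "0 < f (Suc i) * \<beta>" using \<alpha>\<beta> N by (simp add: f_def)
        then have "0 < a (Suc i)" using True by (simp add: a_eq)
        then show ?thesis using a(1)[of i] i by simp
      next
        case False
        have "f i < 1" using i by (simp add: f_def)
        then have "0 < (1 - f i) * \<alpha>" using False \<alpha>\<beta> by simp
        moreover have "0 \<le> f i * \<beta>" using f[of i] i \<alpha>\<beta> by simp
        ultimately have "0 < a i" by (simp add: a_eq)
        then show ?thesis using a(1)[of "Suc i"] i by simp
      qed
      have "cost (z i) (z (Suc i)) \<le> (1 - K * min (a i) (a (Suc i))) * cost (\<gamma> (t i)) (\<gamma> (t (Suc i)))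
          - 2 * (a (Suc i) - a i) * (ent (z (Suc i)) - ent (z i))"
        unfolding z_def K_def using i by (intro heat_cost_bound dens t a pos M) auto
      also have "cost (\<gamma> (t i)) (\<gamma> (t (Suc i))) = (t (Suc i) - t i)\<^sup>2 * C"
        unfolding C_def using i by (intro geodesic_cost geo t) auto
      also have "t (Suc i) - t i = (u - s) / real N" by (simp add: t_def f_Suc distrib_left)
      also have "a (Suc i) - a i = (\<beta> - \<alpha>) / real N" by (simp add: a_Suc)
      \<comment> \<open>The second term is the source of the error Z / N.\<close>
      also have "min (a i) (a (Suc i)) = (a i + a (Suc i)) / 2 - \<bar>a (Suc i) - a i\<bar> / 2"
        by (simp add: min_def abs_if field_simps)
      also have "a i + a (Suc i) = 2 * \<alpha> + (\<beta> - \<alpha>) * (2 * real i + 1) / real N"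
        using N by (simp add: a_def f_def field_simps)
      also have "\<bar>a (Suc i) - a i\<bar> = \<bar>\<beta> - \<alpha>\<bar> / real N" by (simp add: a_Suc)
      finally show ?thesis .
    qed
    have "?X / real N = cost (z 0) (z N) / real N"
      by (simp add: z_def t_def a_def f_ends)
    also have "\<dots> \<le> (\<Sum>i<N. cost (z i) (z (Suc i)))"
      using N z by (intro cost_chain)
    also have "\<dots> \<le> (\<Sum>i<N. (1 - K * ((2 * \<alpha> + (\<beta> - \<alpha>) * (2 * real i + 1) / real N) / 2
          - \<bar>\<beta> - \<alpha>\<bar> / real N / 2)) * (((u - s) / real N)\<^sup>2 * C)
        - 2 * ((\<beta> - \<alpha>) / real N) * (ent (z (Suc i)) - ent (z i)))"
      by (intro sum_mono step) simp
    also have "\<dots> = (\<Sum>i<N. 1 - K * ((2 * \<alpha> + (\<beta> - \<alpha>) * (2 * real i + 1) / real N) / 2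
          - \<bar>\<beta> - \<alpha>\<bar> / real N / 2)) * (((u - s) / real N)\<^sup>2 * C)
        - 2 * ((\<beta> - \<alpha>) / real N) * (\<Sum>i<N. ent (z (Suc i)) - ent (z i))"
      by (simp only: sum_subtractf[of "\<lambda>i. _ i * _" ] sum_distrib_left sum_distrib_right)
    also have "(\<Sum>i<N. ent (z (Suc i)) - ent (z i)) = ent (z N) - ent (z 0)"
      by (rule sum_lessThan_telescope)
    \<comment> \<open>Isolates the part linear in 2 i + 1; the sum N^2 of the odd numbers turns the
      midpoints into the mean (\<alpha> + \<beta>) / 2.\<close>
    also have "(\<Sum>i<N. 1 - K * ((2 * \<alpha> + (\<beta> - \<alpha>) * (2 * real i + 1) / real N) / 2 - \<bar>\<beta> - \<alpha>\<bar> / real N / 2))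
        = (\<Sum>i<N. (1 - K * (\<alpha> - \<bar>\<beta> - \<alpha>\<bar> / real N / 2)) - K * ((\<beta> - \<alpha>) / real N / 2) * (2 * real i + 1))"
      by (intro sum.cong refl) (simp add: algebra_simps add_divide_distrib diff_divide_distrib)
    also have "\<dots> = real N * (1 - K * (\<alpha> - \<bar>\<beta> - \<alpha>\<bar> / real N / 2)) - K * ((\<beta> - \<alpha>) / real N / 2) * (real N)\<^sup>2"
      by (simp only: sum_subtractf sum_odd sum_constant card_lessThan flip: sum_distrib_left)
        (simp only: right_diff_distrib)
    also have "\<dots> = real N * (1 - K * (\<alpha> + \<beta>) / 2 + K * \<bar>\<beta> - \<alpha>\<bar> / real N / 2)"
      using N by (simp add: power2_eq_square field_simps)
    finally have "?X / real N \<le> real N * (1 - K * (\<alpha> + \<beta>) / 2 + K * \<bar>\<beta> - \<alpha>\<bar> / real N / 2) *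
        (((u - s) / real N)\<^sup>2 * C) - 2 * ((\<beta> - \<alpha>) / real N) * (ent (z N) - ent (z 0))" .
    then have "real N * (?X / real N) \<le> real N * (real N * (1 - K * (\<alpha> + \<beta>) / 2 + K * \<bar>\<beta> - \<alpha>\<bar> / real N / 2) *
        (((u - s) / real N)\<^sup>2 * C) - 2 * ((\<beta> - \<alpha>) / real N) * (ent (z N) - ent (z 0)))"
      by (intro mult_left_mono) auto
    also have "\<dots> = (u - s)\<^sup>2 * C * (1 - K * (\<alpha> + \<beta>) / 2) + Z / real N - 2 * (\<beta> - \<alpha>) * (ent (z N) - ent (z 0))"
      using N by (simp add: Z_def power2_eq_square field_simps)
    also have "\<dots> = ?Y + Z / real N"
      by (simp add: z_def t_def a_def f_ends K_def C_def)
    finally show ?thesis using N by simp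
  qed
  have "(\<lambda>N. ?Y + Z / real (Suc N)) \<longlonglongrightarrow> ?Y + 0"
    by (intro tendsto_add tendsto_const LIMSEQ_Suc[OF lim_const_over_n])
  then have "?X \<le> ?Y + 0"
    by (rule LIMSEQ_le_const) (use approx[OF zero_less_Suc] in blast)
  then show ?thesis by simp
qed

lemma continuous_on_ent_heat:
  assumes "\<rho> \<in> dens"
  shows "continuous_on {0..} (\<lambda>t. ent (heat t \<rho>))"
proof (rule continuous_on_ent)
  fix x assume x: "x \<in> G"
  have "continuous_on {0..} (\<lambda>t. kern t g)" if "g \<in> G" for g
    using kern_has_derivative[OF that] by (intro DERIV_continuous_on)
  then have "continuous_on {0..} (\<lambda>t. avg t \<rho> x)"
    unfolding avg_def by (intro continuous_intros)
  with x show "continuous_on {0..} (\<lambda>t. heat t \<rho> x)" by (simp add: heat_def)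
  show "0 \<le> heat t \<rho> x" if "t \<in> {0..}" for t
    using heat_in[OF _ assms, of t] that x by (intro dens_nonneg) auto
qed

text \<open>The two sides of the tent are joined at the heated point with ratio t, the optimal one
  for a geodesic. The terms of order 0 in b then cancel exactly, and the terms of order b give the
  inequality as b tends to 0.\<close>

lemma entropy_convex:
  assumes geo: "const_speed_geodesic G rate unif \<gamma>" and t: "0 < t" "t < 1"
  shows "ent (\<gamma> t) \<le> (1 - t) * ent (\<gamma> 0) + t * ent (\<gamma> 1) - q * t * (1 - t) * cost (\<gamma> 0) (\<gamma> 1)"
proof -
  define C where "C = cost (\<gamma> 0) (\<gamma> 1)"
  have dens: "\<gamma> s \<in> dens" if "s \<in> {0..1}" for s
    using geo that unfolding const_speed_geodesic_def by blast
  let ?f = "\<lambda>b. ent (heat b (\<gamma> t)) + q * exp (- 2 * exit_rate * b) * t * (1 - t) * C"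
  have le: "?f b \<le> (1 - t) * ent (\<gamma> 0) + t * ent (\<gamma> 1)" if b: "0 < b" "4 * q * b < 1" for b
  proof -
    define K where "K = 2 * q * exp (- 2 * exit_rate * b) * b"
    let ?H = "ent (heat b (\<gamma> t))"
    have ends: "heat 0 (\<gamma> 0) = \<gamma> 0" "heat 0 (\<gamma> 1) = \<gamma> 1" by (simp_all add: heat_0 dens)
    have left: "cost (\<gamma> 0) (heat b (\<gamma> t)) \<le> t\<^sup>2 * C * (1 - K) - 2 * b * (?H - ent (\<gamma> 0))"
      using heat_geodesic_bound[OF geo, of 0 t 0 b b] b t by (simp add: ends C_def K_def)
    have right: "cost (heat b (\<gamma> t)) (\<gamma> 1) \<le> (1 - t)\<^sup>2 * C * (1 - K) + 2 * b * (ent (\<gamma> 1) - ?H)"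
      using heat_geodesic_bound[OF geo, of t 1 b 0 b] b t by (simp add: ends C_def K_def)
    have "C \<le> cost (\<gamma> 0) (heat b (\<gamma> t)) / t + cost (heat b (\<gamma> t)) (\<gamma> 1) / (1 - t)"
      unfolding C_def using t b by (intro cost_concat heat_in dens) auto
    also have "\<dots> \<le> (t\<^sup>2 * C * (1 - K) - 2 * b * (?H - ent (\<gamma> 0))) / t +
        ((1 - t)\<^sup>2 * C * (1 - K) + 2 * b * (ent (\<gamma> 1) - ?H)) / (1 - t)"
      using t by (intro add_mono divide_right_mono left right) auto
    \<comment> \<open>Multiplying by t (1 - t) gives the entropies at 0 and 1 the weights 1 - t and
      t.\<close>
    finally have "t * (1 - t) * C \<le> t * (1 - t) * ((t\<^sup>2 * C * (1 - K) - 2 * b * (?H - ent (\<gamma> 0))) / t +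
        ((1 - t)\<^sup>2 * C * (1 - K) + 2 * b * (ent (\<gamma> 1) - ?H)) / (1 - t))"
      using t by (intro mult_left_mono) auto
    also have "\<dots> = (1 - t) * (t\<^sup>2 * C * (1 - K) - 2 * b * (?H - ent (\<gamma> 0))) +
        t * ((1 - t)\<^sup>2 * C * (1 - K) + 2 * b * (ent (\<gamma> 1) - ?H))"
    proof -
      have "x * y * (A / x + B / y) = y * A + x * B" if "x \<noteq> 0" "y \<noteq> 0" for x y A B :: real
        using that by (simp add: field_simps)
      then show ?thesis using t by simp
    qed
    also have "\<dots> = t * (1 - t) * C * (1 - K) + 2 * b * ((1 - t) * ent (\<gamma> 0) + t * ent (\<gamma> 1) - ?H)"
      by (simp add: algebra_simps power2_eq_square)
    \<comment> \<open>Both sides contained t (1 - t) C; what is left has the common factor 2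
      b.\<close>
    finally have "2 * b * (q * exp (- 2 * exit_rate * b) * t * (1 - t) * C) \<le>
        2 * b * ((1 - t) * ent (\<gamma> 0) + t * ent (\<gamma> 1) - ?H)"
      by (simp add: K_def algebra_simps)
    then have "q * exp (- 2 * exit_rate * b) * t * (1 - t) * C \<le> (1 - t) * ent (\<gamma> 0) + t * ent (\<gamma> 1) - ?H"
      using b by (simp only: mult_le_cancel_left_pos)
    then show ?thesis by simp
  qed
  have "((\<lambda>b. ent (heat b (\<gamma> t))) \<longlongrightarrow> ent (heat 0 (\<gamma> t))) (at_right 0)"
    using continuous_on_ent_heat[OF dens[of t]] t unfolding continuous_on_def
    by (auto intro: tendsto_within_subset)
  then have lim: "(?f \<longlongrightarrow> ent (heat 0 (\<gamma> t)) + q * exp (- 2 * exit_rate * 0) * t * (1 - t) * C) (at_right 0)"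
    by (intro tendsto_intros)
  have "\<forall>\<^sub>F b in at_right 0. b < 1 / (4 * q)"
    using rate_pos by (intro order_tendstoD[OF tendsto_ident_at]) simp
  moreover have "\<forall>\<^sub>F b in at_right (0::real). 0 < b"
    by (simp add: eventually_at_filter)
  ultimately have "\<forall>\<^sub>F b in at_right 0. ?f b \<le> (1 - t) * ent (\<gamma> 0) + t * ent (\<gamma> 1)"
  proof eventually_elim
    case (elim b)
    then have "4 * q * b < 1" using rate_pos by (simp add: less_divide_eq mult.commute)
    with elim show ?case by (intro le)
  qed
  from tendsto_upperbound[OF lim this]
  show ?thesis using t by (simp add: heat_0 dens C_def)
qed

theorem ricci_bounded_below_involution_walk: "ricci_bounded_below G rate unif (2 * q)"
  unfolding ricci_bounded_below_def
proof (intro allI impI ballI)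
  fix \<gamma> and t :: real
  assume geo: "const_speed_geodesic G rate unif \<gamma>" and t: "t \<in> {0..1}"
  let ?C = "cost (\<gamma> 0) (\<gamma> 1)"
  have dens: "\<gamma> 0 \<in> dens" "\<gamma> 1 \<in> dens"
    using geo by (auto simp: const_speed_geodesic_def)
  have "ent (\<gamma> t) \<le> (1 - t) * ent (\<gamma> 0) + t * ent (\<gamma> 1) - q * t * (1 - t) * ?C"
    using entropy_convex[OF geo, of t] t by (cases "t = 0 \<or> t = 1") auto
  moreover have "(transport_dist G rate unif (\<gamma> 0) (\<gamma> 1))\<^sup>2 = ennreal ?C"
    unfolding transport_dist_power2 using transport_cost_finite[OF dens] by (simp add: less_top)
  ultimately show "ereal (ent (\<gamma> t)) \<le> ereal ((1 - t) * ent (\<gamma> 0) + t * ent (\<gamma> 1)) -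
      ereal (2 * q / 2 * t * (1 - t)) * enn2ereal ((transport_dist G rate unif (\<gamma> 0) (\<gamma> 1))\<^sup>2)"
    by (simp add: enn2ereal_ennreal)
qed

end

section \<open>Random transpositions as an involution walk\<close>

theorem theorem1p2:
  fixes n :: nat
  assumes "n > 1"
  shows "ricci_bounded_below (perms n) (Q_RT n) (pi_RT n) (4 / (real n * (real n - 1)))"
proof -
  define D where "D = {Transposition.transpose i j | i j. i \<in> {1..n} \<and> j \<in> {1..n} \<and> i \<noteq> j}"
  define q where "q = 2 / (real n * (real n - 1))"
  interpret involution_walk "perms n" D q
  proof
    show "finite (perms n)" by (simp add: perms_def finite_permutations)
    show "id \<in> perms n" by (simp add: perms_def permutes_id)
    show "g \<circ> h \<in> perms n" if "g \<in> perms n" "h \<in> perms n" for g h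
      using that by (simp add: perms_def permutes_compose)
    show "inv g \<in> perms n" "bij g" if "g \<in> perms n" for g
      using that by (simp_all add: perms_def permutes_inv permutes_bij)
    show "D \<subseteq> perms n" by (auto simp: D_def perms_def intro: permutes_swap_id)
    show "\<tau> \<circ> \<tau> = id" if "\<tau> \<in> D" for \<tau> using that by (auto simp: D_def)
    show "id \<notin> D"
    proof
      assume "id \<in> D"
      then obtain i j :: nat where "i \<noteq> j" "id = Transposition.transpose i j" unfolding D_def by blast
      then show False by (metis id_apply transpose_apply_first)
    qed
    show "g \<circ> \<tau> \<circ> inv g \<in> D" if "g \<in> perms n" "\<tau> \<in> D" for g \<tau>
    proof -
      obtain i j where ij: "i \<in> {1..n}" "j \<in> {1..n}" "i \<noteq> j" "\<tau> = Transposition.transpose i j"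
        using \<open>\<tau> \<in> D\<close> by (auto simp: D_def)
      have g: "g permutes {1..n}" using that by (simp add: perms_def)
      have "g \<circ> \<tau> \<circ> inv g = Transposition.transpose (g i) (g j)"
      \<comment> \<open>Evaluated at x = g y, conjugation amounts to relabelling the transposed
        points by g.\<close>
      proof
        fix x
        obtain y where "x = g y" using g by (metis permutes_surj surjD)
        then show "(g \<circ> \<tau> \<circ> inv g) x = Transposition.transpose (g i) (g j) x"
          using permutes_inj[OF g] by (simp add: ij permutes_inverses[OF g] Transposition.transpose_def inj_eq)
      qed
      moreover have "g i \<in> {1..n}" "g j \<in> {1..n}" "g i \<noteq> g j"
        using ij permutes_in_image[OF g] permutes_inj[OF g] by (simp_all add: inj_eq)
      ultimately show ?thesis unfolding D_def by blast
    qed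
    \<comment> \<open>Every permutation of a finite set is a product of transpositions; the reversed
      induction appends them on the right, as the locale requires.\<close>
    show "P g" if "g \<in> perms n" "P id" "\<And>g \<tau>. g \<in> perms n \<Longrightarrow> \<tau> \<in> D \<Longrightarrow> P g \<Longrightarrow> P (g \<circ> \<tau>)" for g P
      using finite_atLeastAtMost[of 1 n] that(1)[unfolded perms_def mem_Collect_eq]
    proof (induction rule: permutes_rev_induct)
      case (swap a b p)
      then show ?case by (intro that(3)) (auto simp: perms_def D_def)
    qed (rule that(2))
    show "0 < q" using assms by (simp add: q_def)
  qed
  have "card (perms n) = fact n" by (simp add: perms_def card_permutations)
  then have "unif = pi_RT n" by (intro ext) (simp add: unif_def pi_RT_def)
  moreover have "(\<exists>\<tau>\<in>D. y = \<tau> \<circ> x) \<longleftrightarrow> transposition_adjacent n x y" for x y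
    unfolding D_def transposition_adjacent_def by blast
  then have "rate = Q_RT n" unfolding rate_def Q_RT_def by (intro ext) (simp add: q_def)
  ultimately show ?thesis
    using ricci_bounded_below_involution_walk by (simp add: q_def)
qed

end
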